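(* Let $n\geqslant 1$ and let $q$ be a nonzero complex number which is not a root of unity. For any Young diagram $\mu$ with $m$ boxes and any standard $\mu$-tableau $\mathcal U$, the image of the element $$\Big(K_{\overline 1}+\frac{q^{-2c_1(\mathcal U)}-1}{q-q^{-1}}\Big)\cdots\Big(K_{\overline m}+\frac{q^{-2c_m(\mathcal U)}-1}{q-q^{-1}}\Big)\,\mathcal E_{\mathcal U}\in(\mathrm{End}\,\mathbb C^n)^{\otimes m}\otimes\mathrm U^\circ_q(\mathfrak{gl}_n)$$ under the homomorphism $\mathrm U^\circ_q(\mathfrak{gl}_n)\to\mathcal W_n$ defined by $K\mapsto M\mathcal D$ (applied to the second factor) equals $$a_\mu\,M_{\overline 1}\cdots M_{\overline m}\,\mathcal D_{\overline m}\cdots\mathcal D_{\overline 1}\,\mathcal E_{\mathcal U},\qquad a_\mu=\prod_{\alpha\in\mu}q^{-2c(\alpha)}.$$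
   Context: $R$-matrices. Let $e_{ij}\in\mathrm{End}\,\mathbb C^n$ be the matrix units, $P=\sum_{i,j}e_{ij}\otimes e_{ji}$, $R=q\sum_i e_{ii}\otimes e_{ii}+\sum_{i\ne j}e_{ii}\otimes e_{jj}+(q-q^{-1})\sum_{i<j}e_{ij}\otimes e_{ji}$, $\check R=PR$, and let $\check R_k$ denote $\check R$ acting in the tensor factors $k,k+1$ of $(\mathbb C^n)^{\otimes m}$. The algebra $\mathrm U^\circ_q(\mathfrak{gl}_n)$. $\mathrm U_q(\mathfrak{gl}_n)$ is the associative algebra generated by the entries of an upper triangular matrix $L^+=[l^+_{ij}]$ and a lower triangular matrix $L^-=[l^-_{ij}]$ subject to $l^+_{ii}l^-_{ii}=l^-_{ii}l^+_{ii}=1$, $RL^\pm_1L^\pm_2=L^\pm_2L^\pm_1R$, $RL^+_1L^-_2=L^-_2L^+_1R$ (the subscript of a matrix indicates the copy of $\mathrm{End}\,\mathbb C^n$ in which it is placed). $\mathrm U^\circ_q(\mathfrak{gl}_n)$ is the subalgebra generated by the entries of $L=L^+(L^-)^{-1}$; the matrix $L$ satisfies the reflection equation $\check RL_1\check RL_1=L_1\check RL_1\check R$. Set $K=L+\frac{1}{q-q^{-1}}$ (a scalar added to a matrix means that multiple of the identity matrix); the reflection equation then becomes $\check RK_1\check RK_1-K_1\check RK_1\check R=\check RK_1-K_1\check R$. Braided Weyl algebra. $\mathcal W_n$ is the associative algebra generated by $m_{ij},\partial_{ij}$, $1\leqslant i,j\leqslant n$, with relations, for $M=[m_{ij}]$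 and $\mathcal D=[\partial_{ij}]$: $\check RM_1\check RM_1=M_1\check RM_1\check R$; $\check R^{-1}\mathcal D_1\check R^{-1}\mathcal D_1=\mathcal D_1\check R^{-1}\mathcal D_1\check R^{-1}$; $\mathcal D_1\check RM_1\check R=\check RM_1\check R^{-1}\mathcal D_1+\check R$. It is a known result of Gurevich, Pyatov and Saponov that the mapping $K\mapsto M\mathcal D$ defines a homomorphism $\mathrm U^\circ_q(\mathfrak{gl}_n)\to\mathcal W_n$. Overlined subscripts. For an $n\times n$ matrix $X$ with entries in an algebra $\mathcal A$, elements of $(\mathrm{End}\,\mathbb C^n)^{\otimes m}\otimes\mathcal A$ are defined by $X_{\overline 1}=X_1$ and $X_{\overline k}=\check R_{k-1}\cdots\check R_1X_1\check R_1^{-1}\cdots\check R_{k-1}^{-1}$ for $k\geqslant 2$. Idempotents. $\mathcal H_m$ is the Hecke algebra over $\mathbb C$ with generators $T_1,\dots,T_{m-1}$ and relations $(T_i-q)(T_i+q^{-1})=0$, $T_iT_{i+1}T_i=T_{i+1}T_iT_{i+1}$, $T_iT_j=T_jT_i$ for $|i-j|>1$; its Jucys–Murphy elements are $y_1=1$, $y_{k+1}=T_k\cdots T_2T_1^2T_2\cdots T_k$. A standard tableau $\mathcal U$ of shape $\mu\vdash m$ is a bijective filling of the boxes of $\mu$ by $1,\dots,m$ strictly increasing along rows and down columns; the content of a box $\alpha=(i,j)$ is $c(\alpha)=j-i$, and $c_k(\mathcal U)$ is the content of the box occupied by $k$. $\mathcal H_m\cong\bigoplus_{\mu\vdash m}\mathrm{Mat}_{f_\mu}(\mathbb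 C)$, where $f_\mu$ is the number of standard $\mu$-tableaux; $e_{\mathcal U}$ is the diagonal matrix unit (primitive idempotent) corresponding to $\mathcal U$, characterized as the nonzero idempotent with $y_ke_{\mathcal U}=e_{\mathcal U}y_k=q^{2c_k(\mathcal U)}e_{\mathcal U}$ for $k=1,\dots,m$. $\mathcal E_{\mathcal U}$ is the image of $e_{\mathcal U}$ under the action $T_k\mapsto\check R_k$ on $(\mathbb C^n)^{\otimes m}$. *)

theory Defs
  imports
    "HOL-Library.Poly_Mapping"
    "HOL-Algebra.Module"
    "HOL-Algebra.QuotRing"
    "HOL-Algebra.Generated_Rings"
begin

section \<open>Associative algebras over the complex numbers\<close>

text \<open>
  A (not necessarily commutative) associative unital algebra over \<open>\<complex>\<close> is represented by a record
  of type \<open>(complex, 'a) module\<close>: its ring part together with the scalar multiplication \<open>\<odot>\<close>.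
\<close>

definition complex_alg :: "(complex, complex) module" where
  "complex_alg = \<lparr>carrier = UNIV, mult = (*), one = 1, zero = 0, add = (+), smult = (*)\<rparr>"

definition alg_hom ::
  "(complex, 'a, 'c) module_scheme \<Rightarrow> (complex, 'b, 'd) module_scheme \<Rightarrow> ('a \<Rightarrow> 'b) set" where
  "alg_hom A B =
     {f \<in> ring_hom A B. \<forall>c. \<forall>x \<in> carrier A. f (c \<odot>\<^bsub>A\<^esub> x) = c \<odot>\<^bsub>B\<^esub> f x}"

definition lprod :: "('a, 'c) monoid_scheme \<Rightarrow> 'a list \<Rightarrow> 'a" where
  "lprod G xs = foldr (\<otimes>\<^bsub>G\<^esub>) xs \<one>\<^bsub>G\<^esub>"

definition subalg :: "(complex, 'a) module \<Rightarrow> 'a set \<Rightarrow> (complex, 'a) module" where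
  "subalg A S = A\<lparr>carrier := generate_ring A (range (\<lambda>c. c \<odot>\<^bsub>A\<^esub> \<one>\<^bsub>A\<^esub>) \<union> S)\<rparr>"


subsection \<open>Free algebras and algebras given by generators and relations\<close>

datatype 'g free_word = Word (letters: "'g list")

instantiation free_word :: (type) monoid_add
begin

definition zero_free_word :: "'a free_word" where "0 = Word []"

definition plus_free_word :: "'a free_word \<Rightarrow> 'a free_word \<Rightarrow> 'a free_word" where
  "u + v = Word (letters u @ letters v)"

instance by standard (simp_all add: zero_free_word_def plus_free_word_def)

end

text \<open>
  Since addition of words is concatenation, the convolution product of \<^theory>\<open>HOL-Library.Poly_Mapping\<close>
  is the product of noncommutative polynomials.
\<close>

type_synonym 'g free_poly = "'g free_word \<Rightarrow>\<^sub>0 complex"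

definition const :: "complex \<Rightarrow> 'g free_poly" where
  "const c = Poly_Mapping.single 0 c"

definition gen :: "'g \<Rightarrow> 'g free_poly" where
  "gen g = Poly_Mapping.single (Word [g]) 1"

definition free_alg :: "'g set \<Rightarrow> (complex, 'g free_poly) module" where
  "free_alg X =
     \<lparr>carrier = {p. \<forall>w \<in> Poly_Mapping.keys p. set (letters w) \<subseteq> X},
      mult = (*), one = 1, zero = 0, add = (+), smult = (\<lambda>c p. const c * p)\<rparr>"

text \<open>Evaluation of a noncommutative polynomial in an algebra \<open>B\<close>, sending the generator \<open>g\<close> to \<open>f g\<close>.\<close>

definition free_eval :: "(complex, 'b) module \<Rightarrow> ('g \<Rightarrow> 'b) \<Rightarrow> 'g free_poly \<Rightarrow> 'b" where
  "free_eval B f p =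
     (\<Oplus>\<^bsub>B\<^esub>w \<in> Poly_Mapping.keys p. Poly_Mapping.lookup p w \<odot>\<^bsub>B\<^esub> lprod B (map f (letters w)))"

text \<open>
  In \<open>presented X rels\<close> every element of \<open>rels\<close> is set to zero; note that \<open>ideal\<close>, and hence \<open>Idl\<close>,
  is two-sided in \<^theory>\<open>HOL-Algebra.Ideal\<close>.
\<close>

definition presented_proj :: "'g set \<Rightarrow> 'g free_poly set \<Rightarrow> 'g free_poly \<Rightarrow> 'g free_poly set" where
  "presented_proj X rels p = (Idl\<^bsub>free_alg X\<^esub> rels) +>\<^bsub>free_alg X\<^esub> p"

definition presented :: "'g set \<Rightarrow> 'g free_poly set \<Rightarrow> (complex, 'g free_poly set) module" where
  "presented X rels =
     (let Q = free_alg X Quot (Idl\<^bsub>free_alg X\<^esub> rels) in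
      \<lparr>carrier = carrier Q, mult = mult Q, one = one Q, zero = zero Q, add = add Q,
       smult = (\<lambda>c x. presented_proj X rels (const c) \<otimes>\<^bsub>Q\<^esub> x)\<rparr>)"


section \<open>Matrices and tensor factors\<close>

type_synonym ('i, 'a) mtx = "'i \<Rightarrow> 'i \<Rightarrow> 'a"

text \<open>Matrices over \<open>A\<close> with rows and columns indexed by the finite set \<open>S\<close>, i.e. \<open>End \<complex>\<^sup>S \<otimes> A\<close>.\<close>

definition mat_alg :: "'i set \<Rightarrow> (complex, 'a) module \<Rightarrow> (complex, ('i, 'a) mtx) module" where
  "mat_alg S A =
     \<lparr>carrier = S \<rightarrow>\<^sub>E (S \<rightarrow>\<^sub>E carrier A),
      mult = (\<lambda>X Y. \<lambda>i\<in>S. \<lambda>j\<in>S. \<Oplus>\<^bsub>A\<^esub>k\<in>S. X i k \<otimes>\<^bsub>A\<^esub> Y k j),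
      one = (\<lambda>i\<in>S. \<lambda>j\<in>S. if i = j then \<one>\<^bsub>A\<^esub> else \<zero>\<^bsub>A\<^esub>),
      zero = (\<lambda>i\<in>S. \<lambda>j\<in>S. \<zero>\<^bsub>A\<^esub>),
      add = (\<lambda>X Y. \<lambda>i\<in>S. \<lambda>j\<in>S. X i j \<oplus>\<^bsub>A\<^esub> Y i j),
      smult = (\<lambda>c X. \<lambda>i\<in>S. \<lambda>j\<in>S. c \<odot>\<^bsub>A\<^esub> X i j)\<rparr>"

definition map_mtx :: "'i set \<Rightarrow> ('a \<Rightarrow> 'b) \<Rightarrow> ('i, 'a) mtx \<Rightarrow> ('i, 'b) mtx" where
  "map_mtx S f X = (\<lambda>i\<in>S. \<lambda>j\<in>S. f (X i j))"

text \<open>The basis vector \<open>e\<^bsub>i1\<^esub> \<otimes> \<dots> \<otimes> e\<^bsub>im\<^esub>\<close> of \<open>(\<complex>\<^sup>n)\<^sup>\<otimes>\<^sup>m\<close> has index \<open>[i1, \<dots>, im]\<close>.\<close>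

definition tidx :: "nat \<Rightarrow> nat \<Rightarrow> nat list set" where
  "tidx n m = {I. length I = m \<and> set I \<subseteq> {1..n}}"

text \<open>
  \<open>tens n m A\<close> is \<open>(End \<complex>\<^sup>n)\<^sup>\<otimes>\<^sup>m \<otimes> A\<close>: the element
  \<open>e\<^bsub>i1 j1\<^esub> \<otimes> \<dots> \<otimes> e\<^bsub>im jm\<^esub> \<otimes> a\<close> is the matrix with entry \<open>a\<close> in row
  \<open>[i1, \<dots>, im]\<close> and column \<open>[j1, \<dots>, jm]\<close> and zeros elsewhere.
\<close>

definition tens :: "nat \<Rightarrow> nat \<Rightarrow> (complex, 'a) module \<Rightarrow> (complex, (nat list, 'a) mtx) module" where
  "tens n m A = mat_alg (tidx n m) A"

text \<open>\<open>X \<mapsto> X \<otimes> 1\<close>, from \<open>(End \<complex>\<^sup>n)\<^sup>\<otimes>\<^sup>m\<close> to \<open>(End \<complex>\<^sup>n)\<^sup>\<otimes>\<^sup>m \<otimes> A\<close>.\<close>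

definition base_change ::
  "(complex, 'a) module \<Rightarrow> nat \<Rightarrow> nat \<Rightarrow> (nat list, complex) mtx \<Rightarrow> (nat list, 'a) mtx" where
  "base_change A n m = map_mtx (tidx n m) (\<lambda>c. c \<odot>\<^bsub>A\<^esub> \<one>\<^bsub>A\<^esub>)"

text \<open>
  \<open>place A n m a X\<close> is \<open>X\<^sub>a\<close>, the \<open>n \<times> n\<close> matrix \<open>X\<close> over \<open>A\<close> put into the \<open>a\<close>-th of \<open>m\<close> tensor
  factors. Tensor factors are numbered from 1, list positions from 0.
\<close>

definition place ::
  "(complex, 'a) module \<Rightarrow> nat \<Rightarrow> nat \<Rightarrow> nat \<Rightarrow> (nat, 'a) mtx \<Rightarrow> (nat list, 'a) mtx" where
  "place A n m a X =
     (\<lambda>I\<in>tidx n m. \<lambda>J\<in>tidx n m.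
        if \<forall>b\<in>{1..m} - {a}. I ! (b - 1) = J ! (b - 1)
        then X (I ! (a - 1)) (J ! (a - 1)) else \<zero>\<^bsub>A\<^esub>)"

text \<open>An element of \<open>(End \<complex>\<^sup>n)\<^sup>\<otimes>\<^sup>2\<close> acting in the tensor factors \<open>k, k + 1\<close> of \<open>(\<complex>\<^sup>n)\<^sup>\<otimes>\<^sup>m\<close>.\<close>

definition place2 :: "nat \<Rightarrow> nat \<Rightarrow> nat \<Rightarrow> (nat list, complex) mtx \<Rightarrow> (nat list, complex) mtx" where
  "place2 n m k X =
     (\<lambda>I\<in>tidx n m. \<lambda>J\<in>tidx n m.
        if \<forall>b\<in>{1..m} - {k, k + 1}. I ! (b - 1) = J ! (b - 1)
        then X [I ! (k - 1), I ! k] [J ! (k - 1), J ! k] else 0)"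


section \<open>The R-matrix\<close>

definition mat_unit :: "nat \<Rightarrow> nat \<Rightarrow> (nat, complex) mtx" where
  "mat_unit i j = (\<lambda>a b. if a = i \<and> b = j then 1 else 0)"

definition tensor2 :: "(nat, complex) mtx \<Rightarrow> (nat, complex) mtx \<Rightarrow> (nat list, complex) mtx"
    (infixl \<open>\<boxtimes>\<close> 75) where
  "X \<boxtimes> Y = (\<lambda>I J. X (I ! 0) (J ! 0) * Y (I ! 1) (J ! 1))"

definition Pmat :: "nat \<Rightarrow> (nat list, complex) mtx" where
  "Pmat n = (\<lambda>I\<in>tidx n 2. \<lambda>J\<in>tidx n 2. \<Sum>i=1..n. \<Sum>j=1..n. (mat_unit i j \<boxtimes> mat_unit j i) I J)"

definition Rmat :: "nat \<Rightarrow> complex \<Rightarrow> (nat list, complex) mtx" where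
  "Rmat n q = (\<lambda>I\<in>tidx n 2. \<lambda>J\<in>tidx n 2.
     q * (\<Sum>i=1..n. (mat_unit i i \<boxtimes> mat_unit i i) I J)
     + (\<Sum>i=1..n. \<Sum>j\<in>{1..n} - {i}. (mat_unit i i \<boxtimes> mat_unit j j) I J)
     + (q - inverse q) * (\<Sum>i=1..n. \<Sum>j\<in>{i<..n}. (mat_unit i j \<boxtimes> mat_unit j i) I J))"

definition Rcheck :: "nat \<Rightarrow> complex \<Rightarrow> (nat list, complex) mtx" where
  "Rcheck n q = Pmat n \<otimes>\<^bsub>tens n 2 complex_alg\<^esub> Rmat n q"

text \<open>
  The matrix of \<open>PR\<close> acting in the tensor factors \<open>k, k + 1\<close>, and its inverse, first on
  \<open>(\<complex>\<^sup>n)\<^sup>\<otimes>\<^sup>m\<close> and then in \<open>(End \<complex>\<^sup>n)\<^sup>\<otimes>\<^sup>m \<otimes> A\<close>.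
\<close>

definition Rcheck_at :: "nat \<Rightarrow> complex \<Rightarrow> nat \<Rightarrow> nat \<Rightarrow> (nat list, complex) mtx" where
  "Rcheck_at n q m k = place2 n m k (Rcheck n q)"

definition Rk :: "(complex, 'a) module \<Rightarrow> nat \<Rightarrow> complex \<Rightarrow> nat \<Rightarrow> nat \<Rightarrow> (nat list, 'a) mtx" where
  "Rk A n q m k = base_change A n m (Rcheck_at n q m k)"

definition Rk_inv :: "(complex, 'a) module \<Rightarrow> nat \<Rightarrow> complex \<Rightarrow> nat \<Rightarrow> nat \<Rightarrow> (nat list, 'a) mtx" where
  "Rk_inv A n q m k = base_change A n m (inv\<^bsub>tens n m complex_alg\<^esub> Rcheck_at n q m k)"

text \<open>\<open>X\<close> with the overlined subscript \<open>k\<close>.\<close>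

definition overl ::
  "(complex, 'a) module \<Rightarrow> nat \<Rightarrow> complex \<Rightarrow> nat \<Rightarrow> nat \<Rightarrow> (nat, 'a) mtx \<Rightarrow> (nat list, 'a) mtx" where
  "overl A n q m k X =
     lprod (tens n m A)
       (map (Rk A n q m) (rev [1..<k]) @ [place A n m 1 X] @ map (Rk_inv A n q m) [1..<k])"


section \<open>The algebras \<open>U\<^sub>q(gl\<^sub>n)\<close> and \<open>U\<degree>\<^sub>q(gl\<^sub>n)\<close>\<close>

definition mtx_relation :: "'i set \<Rightarrow> ('i, 'g free_poly) mtx \<Rightarrow> ('i, 'g free_poly) mtx \<Rightarrow> 'g free_poly set" where
  "mtx_relation S X Y = {X i j - Y i j | i j. i \<in> S \<and> j \<in> S}"

datatype uq_gen = LP nat nat | LM nat nat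

definition uq_gens :: "nat \<Rightarrow> uq_gen set" where
  "uq_gens n = {LP i j | i j. 1 \<le> i \<and> i \<le> j \<and> j \<le> n} \<union> {LM i j | i j. 1 \<le> j \<and> j \<le> i \<and> i \<le> n}"

definition Lp_free :: "nat \<Rightarrow> (nat, uq_gen free_poly) mtx" where
  "Lp_free n = (\<lambda>i\<in>{1..n}. \<lambda>j\<in>{1..n}. if i \<le> j then gen (LP i j) else 0)"

definition Lm_free :: "nat \<Rightarrow> (nat, uq_gen free_poly) mtx" where
  "Lm_free n = (\<lambda>i\<in>{1..n}. \<lambda>j\<in>{1..n}. if j \<le> i then gen (LM i j) else 0)"

definition uq_rels :: "nat \<Rightarrow> complex \<Rightarrow> uq_gen free_poly set" where
  "uq_rels n q =
     (let F = free_alg (uq_gens n); T = tens n 2 F;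
          R = base_change F n 2 (Rmat n q);
          Lp1 = place F n 2 1 (Lp_free n); Lp2 = place F n 2 2 (Lp_free n);
          Lm1 = place F n 2 1 (Lm_free n); Lm2 = place F n 2 2 (Lm_free n)
      in {gen (LP i i) * gen (LM i i) - 1 | i. i \<in> {1..n}}
       \<union> {gen (LM i i) * gen (LP i i) - 1 | i. i \<in> {1..n}}
       \<union> mtx_relation (tidx n 2) (R \<otimes>\<^bsub>T\<^esub> Lp1 \<otimes>\<^bsub>T\<^esub> Lp2) (Lp2 \<otimes>\<^bsub>T\<^esub> Lp1 \<otimes>\<^bsub>T\<^esub> R)
       \<union> mtx_relation (tidx n 2) (R \<otimes>\<^bsub>T\<^esub> Lm1 \<otimes>\<^bsub>T\<^esub> Lm2) (Lm2 \<otimes>\<^bsub>T\<^esub> Lm1 \<otimes>\<^bsub>T\<^esub> R)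
       \<union> mtx_relation (tidx n 2) (R \<otimes>\<^bsub>T\<^esub> Lp1 \<otimes>\<^bsub>T\<^esub> Lm2) (Lm2 \<otimes>\<^bsub>T\<^esub> Lp1 \<otimes>\<^bsub>T\<^esub> R))"

definition Uq :: "nat \<Rightarrow> complex \<Rightarrow> (complex, uq_gen free_poly set) module" where
  "Uq n q = presented (uq_gens n) (uq_rels n q)"

definition Lp :: "nat \<Rightarrow> complex \<Rightarrow> (nat, uq_gen free_poly set) mtx" where
  "Lp n q = map_mtx {1..n} (presented_proj (uq_gens n) (uq_rels n q)) (Lp_free n)"

definition Lm :: "nat \<Rightarrow> complex \<Rightarrow> (nat, uq_gen free_poly set) mtx" where
  "Lm n q = map_mtx {1..n} (presented_proj (uq_gens n) (uq_rels n q)) (Lm_free n)"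

definition Lmat :: "nat \<Rightarrow> complex \<Rightarrow> (nat, uq_gen free_poly set) mtx" where
  "Lmat n q = Lp n q \<otimes>\<^bsub>mat_alg {1..n} (Uq n q)\<^esub> (inv\<^bsub>mat_alg {1..n} (Uq n q)\<^esub> Lm n q)"

definition Uq_circ :: "nat \<Rightarrow> complex \<Rightarrow> (complex, uq_gen free_poly set) module" where
  "Uq_circ n q = subalg (Uq n q) {Lmat n q i j | i j. i \<in> {1..n} \<and> j \<in> {1..n}}"

definition Kmat :: "nat \<Rightarrow> complex \<Rightarrow> (nat, uq_gen free_poly set) mtx" where
  "Kmat n q =
     (let T = mat_alg {1..n} (Uq_circ n q)
      in Lmat n q \<oplus>\<^bsub>T\<^esub> (1 / (q - inverse q)) \<odot>\<^bsub>T\<^esub> \<one>\<^bsub>T\<^esub>)"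


section \<open>The braided Weyl algebra\<close>

datatype weyl_gen = Mgen nat nat | Dgen nat nat

definition weyl_gens :: "nat \<Rightarrow> weyl_gen set" where
  "weyl_gens n =
     {Mgen i j | i j. i \<in> {1..n} \<and> j \<in> {1..n}} \<union> {Dgen i j | i j. i \<in> {1..n} \<and> j \<in> {1..n}}"

definition M_free :: "nat \<Rightarrow> (nat, weyl_gen free_poly) mtx" where
  "M_free n = (\<lambda>i\<in>{1..n}. \<lambda>j\<in>{1..n}. gen (Mgen i j))"

definition D_free :: "nat \<Rightarrow> (nat, weyl_gen free_poly) mtx" where
  "D_free n = (\<lambda>i\<in>{1..n}. \<lambda>j\<in>{1..n}. gen (Dgen i j))"

definition weyl_rels :: "nat \<Rightarrow> complex \<Rightarrow> weyl_gen free_poly set" where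
  "weyl_rels n q =
     (let F = free_alg (weyl_gens n); T = tens n 2 F;
          R = Rk F n q 2 1; R' = Rk_inv F n q 2 1;
          M1 = place F n 2 1 (M_free n); D1 = place F n 2 1 (D_free n)
      in mtx_relation (tidx n 2)
           (R \<otimes>\<^bsub>T\<^esub> M1 \<otimes>\<^bsub>T\<^esub> R \<otimes>\<^bsub>T\<^esub> M1) (M1 \<otimes>\<^bsub>T\<^esub> R \<otimes>\<^bsub>T\<^esub> M1 \<otimes>\<^bsub>T\<^esub> R)
       \<union> mtx_relation (tidx n 2)
           (R' \<otimes>\<^bsub>T\<^esub> D1 \<otimes>\<^bsub>T\<^esub> R' \<otimes>\<^bsub>T\<^esub> D1) (D1 \<otimes>\<^bsub>T\<^esub> R' \<otimes>\<^bsub>T\<^esub> D1 \<otimes>\<^bsub>T\<^esub> R')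
       \<union> mtx_relation (tidx n 2)
           (D1 \<otimes>\<^bsub>T\<^esub> R \<otimes>\<^bsub>T\<^esub> M1 \<otimes>\<^bsub>T\<^esub> R) (R \<otimes>\<^bsub>T\<^esub> M1 \<otimes>\<^bsub>T\<^esub> R' \<otimes>\<^bsub>T\<^esub> D1 \<oplus>\<^bsub>T\<^esub> R))"

definition Weyl :: "nat \<Rightarrow> complex \<Rightarrow> (complex, weyl_gen free_poly set) module" where
  "Weyl n q = presented (weyl_gens n) (weyl_rels n q)"

definition Mmat :: "nat \<Rightarrow> complex \<Rightarrow> (nat, weyl_gen free_poly set) mtx" where
  "Mmat n q = map_mtx {1..n} (presented_proj (weyl_gens n) (weyl_rels n q)) (M_free n)"

definition Dmat :: "nat \<Rightarrow> complex \<Rightarrow> (nat, weyl_gen free_poly set) mtx" where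
  "Dmat n q = map_mtx {1..n} (presented_proj (weyl_gens n) (weyl_rels n q)) (D_free n)"


section \<open>Young diagrams and standard tableaux\<close>

text \<open>A Young diagram is the set of its boxes \<open>(row, column)\<close>, numbered from 1.\<close>

definition young_diagram :: "(nat \<times> nat) set \<Rightarrow> bool" where
  "young_diagram \<mu> \<longleftrightarrow>
     finite \<mu> \<and> \<mu> \<subseteq> {1..} \<times> {1..} \<and>
     (\<forall>i j i' j'. (i, j) \<in> \<mu> \<and> 1 \<le> i' \<and> i' \<le> i \<and> 1 \<le> j' \<and> j' \<le> j \<longrightarrow> (i', j') \<in> \<mu>)"

definition standard_tableau :: "(nat \<times> nat) set \<Rightarrow> (nat \<times> nat \<Rightarrow> nat) \<Rightarrow> bool" where
  "standard_tableau \<mu> U \<longleftrightarrow>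
     bij_betw U \<mu> {1..card \<mu>} \<and>
     (\<forall>i j j'. (i, j) \<in> \<mu> \<and> (i, j') \<in> \<mu> \<and> j < j' \<longrightarrow> U (i, j) < U (i, j')) \<and>
     (\<forall>i i' j. (i, j) \<in> \<mu> \<and> (i', j) \<in> \<mu> \<and> i < i' \<longrightarrow> U (i, j) < U (i', j))"

definition content :: "nat \<times> nat \<Rightarrow> int" where
  "content \<alpha> = int (snd \<alpha>) - int (fst \<alpha>)"

definition content_at :: "(nat \<times> nat) set \<Rightarrow> (nat \<times> nat \<Rightarrow> nat) \<Rightarrow> nat \<Rightarrow> int" where
  "content_at \<mu> U k = content (inv_into \<mu> U k)"


section \<open>The Hecke algebra\<close>

definition hecke_rels :: "nat \<Rightarrow> complex \<Rightarrow> nat free_poly set" where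
  "hecke_rels m q =
     {(gen i - const q) * (gen i + const (inverse q)) | i. i \<in> {1..<m}}
   \<union> {gen i * gen (i + 1) * gen i - gen (i + 1) * gen i * gen (i + 1) | i.
        i \<in> {1..<m} \<and> i + 1 \<in> {1..<m}}
   \<union> {gen i * gen j - gen j * gen i | i j.
        i \<in> {1..<m} \<and> j \<in> {1..<m} \<and> \<bar>int i - int j\<bar> > 1}"

definition Hecke :: "nat \<Rightarrow> complex \<Rightarrow> (complex, nat free_poly set) module" where
  "Hecke m q = presented {1..<m} (hecke_rels m q)"

definition hecke_T :: "nat \<Rightarrow> complex \<Rightarrow> nat \<Rightarrow> nat free_poly set" where
  "hecke_T m q k = presented_proj {1..<m} (hecke_rels m q) (gen k)"

text \<open>\<open>y\<^sub>k = T\<^sub>k\<^sub>-\<^sub>1 \<dots> T\<^sub>1 T\<^sub>1 \<dots> T\<^sub>k\<^sub>-\<^sub>1\<close>, which is \<open>1\<close> for \<open>k = 1\<close>.\<close>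

definition jucys_murphy :: "nat \<Rightarrow> complex \<Rightarrow> nat \<Rightarrow> nat free_poly set" where
  "jucys_murphy m q k = lprod (Hecke m q) (map (hecke_T m q) (rev [1..<k] @ [1..<k]))"

text \<open>The property that determines the primitive idempotent of a standard tableau \<open>U\<close> of shape \<open>\<mu>\<close>.\<close>

definition tableau_idempotent ::
  "complex \<Rightarrow> (nat \<times> nat) set \<Rightarrow> (nat \<times> nat \<Rightarrow> nat) \<Rightarrow> nat free_poly set \<Rightarrow> bool" where
  "tableau_idempotent q \<mu> U e \<longleftrightarrow>
     (let m = card \<mu>; H = Hecke m q in
      e \<in> carrier H \<and> e \<noteq> \<zero>\<^bsub>H\<^esub> \<and> e \<otimes>\<^bsub>H\<^esub> e = e \<and>
      (\<forall>k\<in>{1..m}.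
         jucys_murphy m q k \<otimes>\<^bsub>H\<^esub> e = q powi (2 * content_at \<mu> U k) \<odot>\<^bsub>H\<^esub> e \<and>
         e \<otimes>\<^bsub>H\<^esub> jucys_murphy m q k = q powi (2 * content_at \<mu> U k) \<odot>\<^bsub>H\<^esub> e))"

text \<open>
  The action \<open>T\<^sub>k \<mapsto> Rcheck_at n q m k\<close> of the Hecke algebra on \<open>(\<complex>\<^sup>n)\<^sup>\<otimes>\<^sup>m\<close>: all representatives
  of a class have the same value, because these matrices satisfy the Hecke relations.
\<close>

definition hecke_action :: "nat \<Rightarrow> complex \<Rightarrow> nat \<Rightarrow> nat free_poly set \<Rightarrow> (nat list, complex) mtx" where
  "hecke_action n q m x =
     the_elem (free_eval (tens n m complex_alg) (Rcheck_at n q m) ` x)"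

end

theory Submission
  imports Defs
begin

text \<open>
  The tableau enters only through \<open>y\<^sub>k E = d\<^sub>k E\<close>, where \<open>d\<^sub>k = q\<^bsup>2c\<^esup>\<close> for the content \<open>c = c\<^sub>k(U)\<close>.
  Write \<open>M\<^sub>k, D\<^sub>k\<close> for the overlined matrices, \<open>S = D\<^sub>m\<^sub>-\<^sub>1 \<dots> D\<^sub>1\<close> and \<open>h = q - inverse q\<close>.
  Since \<open>y\<^sub>1, \<dots>, y\<^sub>m\<^sub>-\<^sub>1\<close> commute with \<open>M\<^sub>m D\<^sub>m\<close>, the last factor applied to \<open>E\<close> is again an eigenvector
  of them, so that induction on \<open>m\<close> reduces the theorem to the exchange identity
  \<open>S M\<^sub>m D\<^sub>m y\<^sub>m + (S - S y\<^sub>m) / h = M\<^sub>m D\<^sub>m S\<close>.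
  This in turn follows by induction on \<open>m\<close> from the relations between \<open>M\<^sub>m, D\<^sub>m\<^sub>-\<^sub>1\<close> and between
  \<open>D\<^sub>m, D\<^sub>m\<^sub>-\<^sub>1\<close>, which are braid conjugates of the defining relations of the Weyl algebra.
\<close>

section \<open>Algebras over the complex numbers\<close>

text \<open>The shift in each factor and the constant a_mu have one source. On a vector with y_m E =
  d E the exchange identity becomes M_m D_m S E = d S M_m D_m E + ((1 - d)/h) S E, and division by d
  gives S F_m E = (1/d) M_m D_m S E with F_m = M_m D_m + (1/d - 1)/h. So the scalar added in the
  m-th factor is exactly the one that lets S pass, at the price of 1/d = q^(-2c), and these prices
  multiply to a_mu. The vector F_m E no longer comes from the Hecke algebra, and nothing makes it an
  idempotent. Hence the induction is run for an arbitrary simultaneous eigenvector in the full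
  algebra, with arbitrary nonzero eigenvalues. The number N of tensor factors stays fixed while m
  grows up to N, so that the induction never changes the algebra. All of this takes place in an
  abstract algebra, from the relations alone (\<open>hecke_rep\<close>, \<open>weyl_rep\<close>).
  Matrix entries serve to verify that the concrete matrices satisfy these relations.\<close>

locale calg = ring B for B :: "(complex, 'b) module" (structure) +
  assumes smult_closed [simp]: "x \<in> carrier B \<Longrightarrow> c \<odot> x \<in> carrier B"
    and smult_add_left: "x \<in> carrier B \<Longrightarrow> (c + d) \<odot> x = c \<odot> x \<oplus> d \<odot> x"
    and smult_add_right: "x \<in> carrier B \<Longrightarrow> y \<in> carrier B \<Longrightarrow> c \<odot> (x \<oplus> y) = c \<odot> x \<oplus> c \<odot> y"
    and smult_smult: "x \<in> carrier B \<Longrightarrow> c \<odot> (d \<odot> x) = (c * d) \<odot> x"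
    and smult_one [simp]: "x \<in> carrier B \<Longrightarrow> 1 \<odot> x = x"
    and smult_mult_left: "x \<in> carrier B \<Longrightarrow> y \<in> carrier B \<Longrightarrow> (c \<odot> x) \<otimes> y = c \<odot> (x \<otimes> y)"
    and smult_mult_right: "x \<in> carrier B \<Longrightarrow> y \<in> carrier B \<Longrightarrow> x \<otimes> (c \<odot> y) = c \<odot> (x \<otimes> y)"
begin

lemma smult_zero_right [simp]: "c \<odot> \<zero> = \<zero>"
  using smult_add_right[of \<zero> \<zero> c] by simp

lemma smult_zero_left [simp]: "x \<in> carrier B \<Longrightarrow> 0 \<odot> x = \<zero>"
  using smult_add_left[of x 0 0] by simp

lemma smult_uminus: "x \<in> carrier B \<Longrightarrow> (- c) \<odot> x = \<ominus> (c \<odot> x)"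
  using smult_add_left[of x "- c" c] by (metis add.left_inverse smult_zero_left minus_equality smult_closed)

lemma smult_finsum:
  "f \<in> I \<rightarrow> carrier B \<Longrightarrow> c \<odot> (\<Oplus>i\<in>I. f i) = (\<Oplus>i\<in>I. c \<odot> f i)"
proof (induction I rule: infinite_finite_induct)
  case (insert i I)
  then have "f \<in> I \<rightarrow> carrier B" "(\<lambda>i. c \<odot> f i) \<in> I \<rightarrow> carrier B" "f i \<in> carrier B"
    by (auto simp: Pi_iff)
  with insert show ?case by (simp add: smult_add_right)
qed (simp_all add: finsum_infinite)

lemma lprod_closed [simp]: "set xs \<subseteq> carrier B \<Longrightarrow> lprod B xs \<in> carrier B"
  unfolding lprod_def by (induction xs) auto

lemma lprod_append:
  "set xs \<subseteq> carrier B \<Longrightarrow> set ys \<subseteq> carrier B \<Longrightarrow> lprod B (xs @ ys) = lprod B xs \<otimes> lprod B ys"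
proof (induction xs)
  case Nil
  with lprod_closed[of ys] show ?case by (simp add: lprod_def)
next
  case (Cons a xs)
  with lprod_closed[of ys] lprod_closed[of xs] show ?case by (simp add: lprod_def m_assoc)
qed

lemma finsum_swap:
  assumes "finite I" "finite J" "\<And>i j. i \<in> I \<Longrightarrow> j \<in> J \<Longrightarrow> f i j \<in> carrier B"
  shows "(\<Oplus>i\<in>I. \<Oplus>j\<in>J. f i j) = (\<Oplus>j\<in>J. \<Oplus>i\<in>I. f i j)"
  using assms
proof (induction I rule: finite_induct)
  case (insert a I)
  have 1: "(\<lambda>i. \<Oplus>j\<in>J. f i j) \<in> I \<rightarrow> carrier B" "(\<Oplus>j\<in>J. f a j) \<in> carrier B"
    using insert.prems by (auto intro!: finsum_closed)
  have 2: "(\<lambda>j. f a j) \<in> J \<rightarrow> carrier B" "(\<lambda>j. \<Oplus>i\<in>I. f i j) \<in> J \<rightarrow> carrier B"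
    using insert.prems by (auto intro!: finsum_closed)
  have "(\<Oplus>j\<in>J. \<Oplus>i\<in>insert a I. f i j) = (\<Oplus>j\<in>J. f a j \<oplus> (\<Oplus>i\<in>I. f i j))"
    using insert by (intro finsum_cong') (auto intro!: finsum_insert finsum_closed)
  also have "\<dots> = (\<Oplus>j\<in>J. f a j) \<oplus> (\<Oplus>j\<in>J. \<Oplus>i\<in>I. f i j)"
    using 2 by (rule finsum_addf)
  finally show ?case using insert 1 by simp
qed simp

lemma finsum_delta:
  assumes "finite I" "i \<in> I" "x \<in> carrier B" "\<And>j. j \<in> I \<Longrightarrow> j \<noteq> i \<Longrightarrow> f j = \<zero>" "f i = x"
  shows "(\<Oplus>j\<in>I. f j) = x"
proof -
  have "(\<Oplus>j\<in>I. f j) = (\<Oplus>j\<in>I. if i = j then x else \<zero>)"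
    using assms by (intro finsum_cong') auto
  also have "\<dots> = x"
    using finsum_singleton[of i I "\<lambda>_. x"] assms by simp
  finally show ?thesis .
qed

end

section \<open>Homomorphisms of algebras\<close>

lemma alg_homD:
  assumes "f \<in> alg_hom A B"
  shows "x \<in> carrier A \<Longrightarrow> f x \<in> carrier B"
    and "x \<in> carrier A \<Longrightarrow> y \<in> carrier A \<Longrightarrow> f (x \<otimes>\<^bsub>A\<^esub> y) = f x \<otimes>\<^bsub>B\<^esub> f y"
    and "x \<in> carrier A \<Longrightarrow> y \<in> carrier A \<Longrightarrow> f (x \<oplus>\<^bsub>A\<^esub> y) = f x \<oplus>\<^bsub>B\<^esub> f y"
    and "f \<one>\<^bsub>A\<^esub> = \<one>\<^bsub>B\<^esub>"
    and "x \<in> carrier A \<Longrightarrow> f (c \<odot>\<^bsub>A\<^esub> x) = c \<odot>\<^bsub>B\<^esub> f x"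
  using assms ring_hom_memE[of f A B] by (auto simp: alg_hom_def)

lemma alg_hom_zero:
  assumes "calg A" "calg B" "f \<in> alg_hom A B"
  shows "f \<zero>\<^bsub>A\<^esub> = \<zero>\<^bsub>B\<^esub>"
proof -
  interpret A: calg A by fact
  interpret B: calg B by fact
  show ?thesis
    using alg_homD(5)[OF assms(3), of "\<one>\<^bsub>A\<^esub>" 0] alg_homD(4)[OF assms(3)] by simp
qed

lemma alg_hom_finsum:
  assumes "calg A" "calg B" "f \<in> alg_hom A B" and g: "g \<in> I \<rightarrow> carrier A"
  shows "f (\<Oplus>\<^bsub>A\<^esub>i\<in>I. g i) = (\<Oplus>\<^bsub>B\<^esub>i\<in>I. f (g i))"
proof -
  interpret A: calg A by fact
  interpret B: calg B by fact
  note f = alg_homD[OF assms(3)] alg_hom_zero[OF assms(1-3)]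
  show ?thesis using g
  proof (induction I rule: infinite_finite_induct)
    case (insert i I)
    then have "g \<in> I \<rightarrow> carrier A" "(\<lambda>i. f (g i)) \<in> I \<rightarrow> carrier B" "g i \<in> carrier A"
      by (auto simp: f Pi_iff)
    with insert show ?case by (simp add: f)
  qed (simp_all add: A.finsum_infinite B.finsum_infinite f)
qed

lemma alg_hom_lprod:
  assumes "calg A" "f \<in> alg_hom A B" "set xs \<subseteq> carrier A"
  shows "f (lprod A xs) = lprod B (map f xs)"
proof -
  interpret A: calg A by fact
  note f = alg_homD[OF assms(2)]
  show ?thesis using assms(3)
  proof (induction xs)
    case (Cons a xs)
    with A.lprod_closed[of xs] show ?case by (simp add: lprod_def f)
  qed (simp add: lprod_def f)
qed

lemma alg_hom_smult_one:
  assumes "calg A" "f \<in> alg_hom A B"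
  shows "f (c \<odot>\<^bsub>A\<^esub> \<one>\<^bsub>A\<^esub>) = c \<odot>\<^bsub>B\<^esub> \<one>\<^bsub>B\<^esub>"
proof -
  interpret A: calg A by fact
  show ?thesis using alg_homD[OF assms(2)] by simp
qed

lemma alg_homI:
  assumes "\<And>x. x \<in> carrier A \<Longrightarrow> f x \<in> carrier B"
    and "\<And>x y. x \<in> carrier A \<Longrightarrow> y \<in> carrier A \<Longrightarrow> f (x \<otimes>\<^bsub>A\<^esub> y) = f x \<otimes>\<^bsub>B\<^esub> f y"
    and "\<And>x y. x \<in> carrier A \<Longrightarrow> y \<in> carrier A \<Longrightarrow> f (x \<oplus>\<^bsub>A\<^esub> y) = f x \<oplus>\<^bsub>B\<^esub> f y"
    and "f \<one>\<^bsub>A\<^esub> = \<one>\<^bsub>B\<^esub>"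
    and "\<And>c x. x \<in> carrier A \<Longrightarrow> f (c \<odot>\<^bsub>A\<^esub> x) = c \<odot>\<^bsub>B\<^esub> f x"
  shows "f \<in> alg_hom A B"
  using assms by (auto simp: alg_hom_def ring_hom_def)

section \<open>The complex numbers, free algebras and presentations\<close>

lemmas calgI = calg.intro[OF _ calg_axioms.intro]

text \<open>Free algebras and their quotients let a scalar act as multiplication by a central
  constant. The algebra axioms then follow from the ring axioms, because \<open>h\<close> respects
  sums, products and 1.\<close>

lemma calgI_central:
  fixes B :: "(complex, 'b) module" (structure)
  assumes "ring B"
    and h: "\<And>c. h c \<in> carrier B" "\<And>c d. h (c + d) = h c \<oplus> h d" "\<And>c d. h (c * d) = h c \<otimes> h d" "h 1 = \<one>"
    and central: "\<And>c x. x \<in> carrier B \<Longrightarrow> x \<otimes> h c = h c \<otimes> x"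
    and smult: "\<And>c x. x \<in> carrier B \<Longrightarrow> c \<odot> x = h c \<otimes> x"
  shows "calg B"
proof -
  interpret ring B by fact
  show ?thesis
  proof (rule calgI)
    fix c x y assume [simp]: "x \<in> carrier B" "y \<in> carrier B"
    show "x \<otimes> (c \<odot> y) = c \<odot> (x \<otimes> y)"
      using h(1)[of c] central[of x c] by (simp add: smult flip: m_assoc)
  qed (use h in \<open>simp_all add: ring_axioms smult l_distr r_distr m_assoc\<close>)
qed

lemma calg_complex_alg: "calg complex_alg"
proof (rule calgI)
  show "ring complex_alg"
    by (intro ringI abelian_groupI monoidI)
       (auto simp: complex_alg_def algebra_simps intro: exI[where x = "- x" for x])
qed (auto simp: complex_alg_def algebra_simps)

lemma complex_alg_simps [simp]:
  "carrier complex_alg = UNIV" "x \<otimes>\<^bsub>complex_alg\<^esub> y = x * y" "\<one>\<^bsub>complex_alg\<^esub> = 1"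
  "\<zero>\<^bsub>complex_alg\<^esub> = 0" "x \<oplus>\<^bsub>complex_alg\<^esub> y = x + y" "c \<odot>\<^bsub>complex_alg\<^esub> y = c * y"
  by (simp_all add: complex_alg_def)

lemma free_alg_simps [simp]:
  "x \<otimes>\<^bsub>free_alg X\<^esub> y = x * y" "\<one>\<^bsub>free_alg X\<^esub> = 1"
  "\<zero>\<^bsub>free_alg X\<^esub> = 0" "x \<oplus>\<^bsub>free_alg X\<^esub> y = x + y" "c \<odot>\<^bsub>free_alg X\<^esub> y = const c * y"
  by (simp_all add: free_alg_def)

lemma free_alg_carrier: "p \<in> carrier (free_alg X) \<longleftrightarrow> (\<forall>w \<in> Poly_Mapping.keys p. set (letters w) \<subseteq> X)"
  by (simp add: free_alg_def)

lemma letters_plus [simp]: "letters (u + v) = letters u @ letters v"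
  by (simp add: plus_free_word_def)

lemma letters_zero [simp]: "letters 0 = []"
  by (simp add: zero_free_word_def)

lemma free_alg_closed [simp]:
  "p \<in> carrier (free_alg X) \<Longrightarrow> r \<in> carrier (free_alg X) \<Longrightarrow> p * r \<in> carrier (free_alg X)"
  "p \<in> carrier (free_alg X) \<Longrightarrow> r \<in> carrier (free_alg X) \<Longrightarrow> p + r \<in> carrier (free_alg X)"
  "p \<in> carrier (free_alg X) \<Longrightarrow> r \<in> carrier (free_alg X) \<Longrightarrow> p - r \<in> carrier (free_alg X)"
  "p \<in> carrier (free_alg X) \<Longrightarrow> - p \<in> carrier (free_alg X)"
  "1 \<in> carrier (free_alg X)" "0 \<in> carrier (free_alg X)" "const c \<in> carrier (free_alg X)"
proof -
  show "p * r \<in> carrier (free_alg X)" if "p \<in> carrier (free_alg X)" "r \<in> carrier (free_alg X)"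
    unfolding free_alg_carrier
  proof
    fix w assume "w \<in> Poly_Mapping.keys (p * r)"
    then obtain u v where "w = u + v" "u \<in> Poly_Mapping.keys p" "v \<in> Poly_Mapping.keys r"
      using keys_mult[of p r] by blast
    then show "set (letters w) \<subseteq> X"
      using that by (simp add: free_alg_carrier)
  qed
  show "p + r \<in> carrier (free_alg X)" if "p \<in> carrier (free_alg X)" "r \<in> carrier (free_alg X)"
    using that keys_add[of p r] unfolding free_alg_carrier by blast
  show "p - r \<in> carrier (free_alg X)" if "p \<in> carrier (free_alg X)" "r \<in> carrier (free_alg X)"
    using that keys_diff[of p r] unfolding free_alg_carrier by blast
qed (auto simp: free_alg_carrier const_def)

lemma gen_in_free_alg [simp]: "gen g \<in> carrier (free_alg X) \<longleftrightarrow> g \<in> X"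
  by (simp add: free_alg_carrier gen_def)

lemma const_simps: "const (c + d) = const c + const d" "const (c * d) = const c * const d" "const 1 = 1"
  by (simp_all add: const_def single_add mult_single)

text \<open>Induction on the support, subtracting one coefficient at a time. A property that is
  stable under sums then needs to be checked on monomials only.\<close>

lemma poly_mapping_add_induct [case_names zero single add]:
  assumes "P 0" "\<And>k v. P (Poly_Mapping.single k v)" "\<And>p r. P p \<Longrightarrow> P r \<Longrightarrow> P (p + r)"
  shows "P (p :: 'a \<Rightarrow>\<^sub>0 'b :: ab_group_add)"
proof -
  have "P p" if "finite S" "Poly_Mapping.keys p = S" for S p
    using that
  proof (induction S arbitrary: p rule: finite_induct)
    case (insert k S)
    have "Poly_Mapping.keys (p - Poly_Mapping.single k (Poly_Mapping.lookup p k)) = S"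
      using insert.hyps insert.prems
      by (force simp: in_keys_iff lookup_minus lookup_single when_def split: if_splits)
    from assms(3)[OF insert.IH[OF this] assms(2), of k "Poly_Mapping.lookup p k"] show ?case by simp
  qed (simp add: assms)
  then show ?thesis using finite_keys by blast
qed

lemma const_central: "p * const c = const c * (p :: 'g free_poly)"
  by (induction p rule: poly_mapping_add_induct) (simp_all add: const_def mult_single distrib_left distrib_right mult.commute)

lemma calg_free_alg: "calg (free_alg X)"
proof (rule calgI_central[where h = const])
  show "ring (free_alg X)"
    by (intro ringI abelian_groupI monoidI)
       (auto simp: algebra_simps intro: bexI[where x = "- x" for x])
  show "x \<otimes>\<^bsub>free_alg X\<^esub> const c = const c \<otimes>\<^bsub>free_alg X\<^esub> x" for c x
    by (simp add: const_central[of x])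
qed (simp_all add: const_simps)

lemma free_alg_minus:
  assumes "p \<in> carrier (free_alg X)" "r \<in> carrier (free_alg X)"
  shows "p \<ominus>\<^bsub>free_alg X\<^esub> r = p - r"
proof -
  interpret calg "free_alg X" by (rule calg_free_alg)
  have "\<ominus>\<^bsub>free_alg X\<^esub> r = - r"
    using assms by (intro minus_equality) auto
  then show ?thesis by (simp add: a_minus_def)
qed

context
  fixes X :: "'g set" and rels :: "'g free_poly set"
  assumes rels: "rels \<subseteq> carrier (free_alg X)"
begin

interpretation F: calg "free_alg X" by (rule calg_free_alg)
interpretation I: ideal "Idl\<^bsub>free_alg X\<^esub> rels" "free_alg X"
  by (rule F.genideal_ideal[OF rels])

lemma presented_eq: "carrier (presented X rels) = carrier (free_alg X Quot (Idl\<^bsub>free_alg X\<^esub> rels))"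
    "mult (presented X rels) = mult (free_alg X Quot (Idl\<^bsub>free_alg X\<^esub> rels))"
    "one (presented X rels) = one (free_alg X Quot (Idl\<^bsub>free_alg X\<^esub> rels))"
    "zero (presented X rels) = zero (free_alg X Quot (Idl\<^bsub>free_alg X\<^esub> rels))"
    "add (presented X rels) = add (free_alg X Quot (Idl\<^bsub>free_alg X\<^esub> rels))"
    "c \<odot>\<^bsub>presented X rels\<^esub> x = presented_proj X rels (const c) \<otimes>\<^bsub>presented X rels\<^esub> x"
  by (simp_all add: presented_def Let_def)

lemma presented_carrierE:
  assumes "x \<in> carrier (presented X rels)"
  obtains p where "p \<in> carrier (free_alg X)" "x = presented_proj X rels p"
  using assms by (auto simp: presented_eq FactRing_def A_RCOSETS_def' presented_proj_def)

lemma presented_proj_ring_hom: "presented_proj X rels \<in> ring_hom (free_alg X) (presented X rels)"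
  using I.rcos_ring_hom
  by (simp add: ring_hom_def presented_eq presented_proj_def[abs_def])

lemma presented_proj_simps:
  "p \<in> carrier (free_alg X) \<Longrightarrow> presented_proj X rels p \<in> carrier (presented X rels)"
  "p \<in> carrier (free_alg X) \<Longrightarrow> r \<in> carrier (free_alg X) \<Longrightarrow>
    presented_proj X rels (p * r) = presented_proj X rels p \<otimes>\<^bsub>presented X rels\<^esub> presented_proj X rels r"
  "p \<in> carrier (free_alg X) \<Longrightarrow> r \<in> carrier (free_alg X) \<Longrightarrow>
    presented_proj X rels (p + r) = presented_proj X rels p \<oplus>\<^bsub>presented X rels\<^esub> presented_proj X rels r"
  "presented_proj X rels 1 = \<one>\<^bsub>presented X rels\<^esub>"
  using ring_hom_memE[OF presented_proj_ring_hom] by simp_all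

lemma ring_presented: "ring (presented X rels)"
proof -
  interpret Q: ring "free_alg X Quot (Idl\<^bsub>free_alg X\<^esub> rels)" by (rule I.quotient_is_ring)
  show ?thesis
    by (intro ringI abelian_groupI monoidI)
       (simp_all add: presented_eq(1-5) Q.m_assoc Q.a_assoc Q.l_distr Q.r_distr Q.a_ac Q.add.l_inv_ex)
qed

lemma calg_presented: "calg (presented X rels)"
proof (rule calgI_central[where h = "\<lambda>c. presented_proj X rels (const c)"])
  show "ring (presented X rels)" by (rule ring_presented)
  fix c x assume "x \<in> carrier (presented X rels)"
  then show "x \<otimes>\<^bsub>presented X rels\<^esub> presented_proj X rels (const c)
      = presented_proj X rels (const c) \<otimes>\<^bsub>presented X rels\<^esub> x"
    by (elim presented_carrierE) (simp flip: presented_proj_simps(2), subst const_central, rule refl)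
qed (simp_all add: const_simps presented_proj_simps presented_eq(6))

lemma presented_proj_hom: "presented_proj X rels \<in> alg_hom (free_alg X) (presented X rels)"
  by (rule alg_homI) (simp_all add: presented_proj_simps presented_eq(6))

lemma presented_proj_eqI:
  assumes "p - r \<in> rels" "p \<in> carrier (free_alg X)" "r \<in> carrier (free_alg X)"
  shows "presented_proj X rels p = presented_proj X rels r"
proof -
  have "p \<ominus>\<^bsub>free_alg X\<^esub> r \<in> Idl\<^bsub>free_alg X\<^esub> rels"
    using assms F.genideal_self[OF rels] by (auto simp: free_alg_minus)
  then show ?thesis
    using assms F.quotient_eq_iff_same_a_r_cos[OF I.is_ideal, of p r] by (simp add: presented_proj_def)
qed

end

text \<open>\<open>generate_ring\<close> is closed under the ring operations only. Stability under
  scalars comes from the multiples of 1 among the generators, since c x is the product of c 1 and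
  x.\<close>

lemma calg_subalg:
  assumes "calg A" "S \<subseteq> carrier A"
  shows "calg (subalg A S)"
proof -
  interpret calg A by fact
  let ?G = "range (\<lambda>c. c \<odot>\<^bsub>A\<^esub> \<one>\<^bsub>A\<^esub>) \<union> S"
  have G: "?G \<subseteq> carrier A" using assms by auto
  have *: "c \<odot>\<^bsub>A\<^esub> x \<in> generate_ring A ?G" if "x \<in> generate_ring A ?G" for c x
  proof -
    have "(c \<odot>\<^bsub>A\<^esub> \<one>\<^bsub>A\<^esub>) \<otimes>\<^bsub>A\<^esub> x \<in> generate_ring A ?G"
      using that by (intro generate_ring.eng_mult) (auto intro: generate_ring.incl)
    then show ?thesis
      using generate_ring_in_carrier[OF G that] by (simp add: smult_mult_left)
  qed
  have **: "x \<in> generate_ring A ?G \<Longrightarrow> x \<in> carrier A" for x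
    by (rule generate_ring_in_carrier[OF G])
  show ?thesis
    using generate_ring_is_ring[OF G]
    by (intro calgI)
       (simp_all add: subalg_def * ** smult_add_left smult_add_right smult_smult smult_mult_left smult_mult_right)
qed

lemma subalg_gen: "x \<in> S \<Longrightarrow> x \<in> carrier (subalg A S)"
  by (simp add: subalg_def generate_ring.incl)

section \<open>The braid argument\<close>

definition commutes :: "('a, 'c) monoid_scheme \<Rightarrow> 'a \<Rightarrow> 'a \<Rightarrow> bool" where
  "commutes G x y \<longleftrightarrow> x \<otimes>\<^bsub>G\<^esub> y = y \<otimes>\<^bsub>G\<^esub> x"

context monoid
begin

lemma commutes_mult:
  assumes "commutes G x y" "commutes G x z" "x \<in> carrier G" "y \<in> carrier G" "z \<in> carrier G"
  shows "commutes G x (y \<otimes> z)"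
  using assms unfolding commutes_def by (metis m_assoc)

lemma commutes_inverse:
  assumes "commutes G x y" "y \<otimes> y' = \<one>" "y' \<otimes> y = \<one>"
    and "x \<in> carrier G" "y \<in> carrier G" "y' \<in> carrier G"
  shows "commutes G x y'"
proof -
  have "x \<otimes> y' = (y' \<otimes> y) \<otimes> (x \<otimes> y')" using assms by simp
  also have "\<dots> = y' \<otimes> (y \<otimes> x) \<otimes> y'" using assms(4-6) by (simp only: m_assoc m_closed)
  also have "\<dots> = y' \<otimes> (x \<otimes> y) \<otimes> y'" using assms(1) by (simp add: commutes_def)
  also have "\<dots> = y' \<otimes> x" using assms by (simp add: m_assoc)
  finally show ?thesis by (simp add: commutes_def)
qed

lemma commutes_sym: "commutes G x y \<Longrightarrow> commutes G y x"
  by (simp add: commutes_def)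

end

section \<open>Hecke relations in an abstract algebra\<close>

locale hecke_rep = calg B for B :: "(complex, 'b) module" (structure) +
  fixes N :: nat and h :: complex and r r' :: "nat \<Rightarrow> 'b"
  assumes r_closed [simp]: "k \<in> {1..<N} \<Longrightarrow> r k \<in> carrier B" "k \<in> {1..<N} \<Longrightarrow> r' k \<in> carrier B"
    and r_inv [simp]: "k \<in> {1..<N} \<Longrightarrow> r k \<otimes> r' k = \<one>" "k \<in> {1..<N} \<Longrightarrow> r' k \<otimes> r k = \<one>"
    and r_square: "k \<in> {1..<N} \<Longrightarrow> r k \<otimes> r k = h \<odot> r k \<oplus> \<one>"
    and r_braid: "k \<in> {1..<N} \<Longrightarrow> k + 1 \<in> {1..<N} \<Longrightarrow>
      r k \<otimes> r (k + 1) \<otimes> r k = r (k + 1) \<otimes> r k \<otimes> r (k + 1)"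
    and r_far: "k \<in> {1..<N} \<Longrightarrow> l \<in> {1..<N} \<Longrightarrow> k + 1 < l \<Longrightarrow> commutes B (r k) (r l)"
begin

text \<open>The overlined subscripts as iterated conjugations. The value at 0 only makes the
  recursion total; \<open>ov_eq_lprod\<close> compares the values from 1 on with the list
  product.\<close>

fun ov :: "nat \<Rightarrow> 'b \<Rightarrow> 'b" where
  "ov 0 x = x"
| "ov (Suc 0) x = x"
| "ov (Suc (Suc k)) x = r (Suc k) \<otimes> ov (Suc k) x \<otimes> r' (Suc k)"

text \<open>The Jucys-Murphy elements, in the form y_(k+1) = T_k y_k T_k that the induction uses.
  The value at 0 is a filler.\<close>

fun jm :: "nat \<Rightarrow> 'b" where
  "jm 0 = \<one>"
| "jm (Suc 0) = \<one>"
| "jm (Suc (Suc k)) = r (Suc k) \<otimes> jm (Suc k) \<otimes> r (Suc k)"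

lemma ov_1 [simp]: "ov 1 x = x"
  by simp

lemma ov_Suc: "1 \<le> k \<Longrightarrow> ov (k + 1) x = r k \<otimes> ov k x \<otimes> r' k"
  by (cases k) auto

lemma jm_Suc: "1 \<le> k \<Longrightarrow> jm (k + 1) = r k \<otimes> jm k \<otimes> r k"
  by (cases k) auto

lemma ov_closed [simp]: "x \<in> carrier B \<Longrightarrow> k \<le> N \<Longrightarrow> ov k x \<in> carrier B"
  by (induction k x rule: ov.induct) auto

lemma jm_closed [simp]: "k \<le> N \<Longrightarrow> jm k \<in> carrier B"
  by (induction k rule: jm.induct) auto

lemma r_cancel:
  assumes "k \<in> {1..<N}" "x \<in> carrier B"
  shows "r k \<otimes> (r' k \<otimes> x) = x" "r' k \<otimes> (r k \<otimes> x) = x"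
  using assms by (simp_all flip: m_assoc)

lemma ov_mult:
  assumes "x \<in> carrier B" "y \<in> carrier B"
  shows "k \<le> N \<Longrightarrow> ov k (x \<otimes> y) = ov k x \<otimes> ov k y"
  by (induction k rule: jm.induct) (use assms in \<open>simp_all add: m_assoc r_cancel\<close>)

lemma commutes_smult_one [simp]: "x \<in> carrier B \<Longrightarrow> commutes B x (c \<odot> \<one>)"
  by (simp add: commutes_def smult_mult_left smult_mult_right)

lemma commutes_r':
  assumes "commutes B x (r k)" "x \<in> carrier B" "k \<in> {1..<N}"
  shows "commutes B x (r' k)"
  using assms by (intro commutes_inverse[of x "r k" "r' k"]) auto

lemma r_far':
  assumes "k \<in> {1..<N}" "l \<in> {1..<N}" "k + 1 < l \<or> l + 1 < k"
  shows "commutes B (r k) (r l)" "commutes B (r k) (r' l)"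
proof -
  show *: "commutes B (r k) (r l)" using assms r_far[of k l] r_far[of l k] by (auto intro: commutes_sym)
  show "commutes B (r k) (r' l)" using assms * by (intro commutes_r') auto
qed

text \<open>Putting \<open>r' k\<close>, \<open>r' (k + 1)\<close>, \<open>r (k + 1)\<close>,
  \<open>r k\<close>, whose product is 1, in front exposes one side of the braid relation; replacing
  it by the other side makes everything else cancel. In this form the relation passes through the
  right half of a conjugation.\<close>

lemma braid_inverse:
  assumes "1 \<le> k" "k + 1 < N"
  shows "r (k + 1) \<otimes> r' k \<otimes> r' (k + 1) = r' k \<otimes> r' (k + 1) \<otimes> r k"
proof -
  have c: "r k \<in> carrier B" "r (k+1) \<in> carrier B" "r' k \<in> carrier B" "r' (k+1) \<in> carrier B"
    using assms by auto
  have "r (k + 1) \<otimes> r' k \<otimes> r' (k + 1)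
      = r' k \<otimes> r' (k + 1) \<otimes> (r (k + 1) \<otimes> r k \<otimes> r (k + 1)) \<otimes> r' k \<otimes> r' (k + 1)"
    using assms c by (simp add: m_assoc r_cancel)
  also have "\<dots> = r' k \<otimes> r' (k + 1) \<otimes> (r k \<otimes> r (k + 1) \<otimes> r k) \<otimes> r' k \<otimes> r' (k + 1)"
    using assms r_braid[of k] by simp
  also have "\<dots> = r' k \<otimes> r' (k + 1) \<otimes> r k"
    using assms c by (simp add: m_assoc r_cancel)
  finally show ?thesis .
qed

text \<open>y_k is a word in \<open>r 1\<close>, ..., \<open>r (k - 1)\<close>.\<close>

lemma commutes_jm:
  assumes "x \<in> carrier B" "\<And>j. 1 \<le> j \<Longrightarrow> j < k \<Longrightarrow> commutes B x (r j)" "k \<le> N"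
  shows "commutes B x (jm k)"
  using assms(2,3)
proof (induction k rule: jm.induct)
  case (3 k)
  then show ?case using assms(1) by (auto intro!: commutes_mult)
qed (use assms(1) in \<open>auto simp: commutes_def\<close>)

section \<open>Overlined elements against the braid generators\<close>

context
  fixes x :: 'b
  assumes x [simp]: "x \<in> carrier B"
    and x_comm: "\<And>k. 2 \<le> k \<Longrightarrow> k < N \<Longrightarrow> commutes B (r k) x"
begin

text \<open>\<open>ov k x\<close> is built from \<open>x\<close> and the generators of index below
  k. All of these are at distance at least two from \<open>r j\<close>, and \<open>x\<close>
  commutes with every generator except possibly the first.\<close>

lemma ov_commute_above:
  assumes "1 \<le> k" "k < j" "j < N"
  shows "commutes B (r j) (ov k x)"
  using assms
proof (induction k rule: nat_induct_at_least)
  case base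
  then show ?case using x_comm[of j] by simp
next
  case (Suc k)
  then show ?case
    by (simp only: Suc_eq_plus1 ov_Suc) (auto intro!: commutes_mult r_far')
qed

text \<open>The content is the case k = j + 2. There the braid relation carries \<open>r j\<close>
  through the left half of the two outer conjugations, turning it into \<open>r (j + 1)\<close>.
  This commutes with \<open>ov j x\<close>, and \<open>braid_inverse\<close> turns it back into
  \<open>r j\<close> on the right. Every further conjugation is by a generator far from
  \<open>r j\<close>.\<close>

lemma ov_commute_below:
  assumes "j + 2 \<le> k" "1 \<le> j" "k \<le> N"
  shows "commutes B (r j) (ov k x)"
  using assms
proof (induction k rule: nat_induct_at_least)
  case base
  define X where "X = ov j x"
  define a b a' b' where ab: "a = r j" "b = r (j + 1)" "a' = r' j" "b' = r' (j + 1)"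
  have c: "X \<in> carrier B" "a \<in> carrier B" "b \<in> carrier B" "a' \<in> carrier B" "b' \<in> carrier B"
    using base by (auto simp: X_def ab)
  have bX: "b \<otimes> X = X \<otimes> b"
    using ov_commute_above[of j "j + 1"] base by (simp add: X_def ab commutes_def)
  have br: "a \<otimes> b \<otimes> a = b \<otimes> a \<otimes> b" using base r_braid[of j] by (simp add: ab)
  have bri: "b \<otimes> a' \<otimes> b' = a' \<otimes> b' \<otimes> a"
    using braid_inverse[of j] base by (simp add: ab)
  define Z where "Z = ov (j + 2) x"
  have eq: "Z = b \<otimes> (a \<otimes> X \<otimes> a') \<otimes> b'"
    using base ov_Suc[of j x] ov_Suc[of "j + 1" x] by (simp add: X_def ab Z_def)
  have "a \<otimes> Z = (a \<otimes> b \<otimes> a) \<otimes> X \<otimes> a' \<otimes> b'"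
    using c by (simp add: eq m_assoc)
  also have "\<dots> = b \<otimes> a \<otimes> (b \<otimes> X) \<otimes> a' \<otimes> b'"
    unfolding br using c by (simp add: m_assoc)
  also have "\<dots> = b \<otimes> a \<otimes> X \<otimes> (b \<otimes> a' \<otimes> b')"
    unfolding bX using c by (simp add: m_assoc)
  also have "\<dots> = Z \<otimes> a"
    unfolding bri using c by (simp add: eq m_assoc)
  finally show ?case by (simp add: commutes_def ab Z_def)
next
  case (Suc k)
  then show ?case
    by (simp only: Suc_eq_plus1 ov_Suc) (auto intro!: commutes_mult r_far')
qed

text \<open>The generators in y_k have index at most k - 1, hence at most l - 2, so that
  \<open>ov_commute_below\<close> applies to each of them. This is why F_m keeps the eigenvectors of
  the earlier Jucys-Murphy elements.\<close>

lemma jm_ov_commute: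
  assumes "k < l" "l \<le> N"
  shows "commutes B (ov l x) (jm k)"
  using assms by (intro commutes_jm commutes_sym[OF ov_commute_below]) auto

end

text \<open>Conjugation by \<open>r k\<close> times \<open>r (k + 1)\<close>. This inner
  automorphism sends \<open>r k\<close> to \<open>r (k + 1)\<close> and raises the overlined
  subscripts k and k + 1 by one, so it carries a relation between neighbouring subscripts to the
  next pair.\<close>

definition shift :: "nat \<Rightarrow> 'b \<Rightarrow> 'b" where
  "shift k x = r k \<otimes> r (k + 1) \<otimes> x \<otimes> r' (k + 1) \<otimes> r' k"

context
  fixes k :: nat
  assumes k: "1 \<le> k" "k + 1 < N"
begin

lemma k_range [simp]: "k \<in> {1..<N}" "k + 1 \<in> {1..<N}"
  using k by auto

lemma shift_simps:
  "x \<in> carrier B \<Longrightarrow> shift k x \<in> carrier B"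
  "x \<in> carrier B \<Longrightarrow> y \<in> carrier B \<Longrightarrow> shift k (x \<otimes> y) = shift k x \<otimes> shift k y"
  "x \<in> carrier B \<Longrightarrow> y \<in> carrier B \<Longrightarrow> shift k (x \<oplus> y) = shift k x \<oplus> shift k y"
  "shift k \<one> = \<one>"
  using r_closed[OF k_range(1)] r_closed[OF k_range(2)]
  by (simp_all only: shift_def m_closed one_closed a_closed l_one r_one m_assoc r_cancel[OF k_range(1)] r_cancel[OF k_range(2)] l_distr r_distr r_inv k_range)

lemma shift_r: "shift k (r k) = r (k + 1)"
proof -
  note c [simp] = r_closed[OF k_range(1)] r_closed[OF k_range(2)]
  have "shift k (r k) = (r k \<otimes> r (k + 1) \<otimes> r k) \<otimes> r' (k + 1) \<otimes> r' k"
    by (simp only: shift_def)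
  also have "\<dots> = r (k + 1)"
    unfolding r_braid[OF k_range] using c
    by (simp only: shift_def m_closed one_closed l_one r_one m_assoc r_inv k_range)
  finally show ?thesis .
qed

lemma shift_r': "shift k (r' k) = r' (k + 1)"
proof -
  note c = r_closed[OF k_range(1)] r_closed[OF k_range(2)] shift_simps(1)[OF r_closed(2)[OF k_range(1)]]
  have "r (k + 1) \<otimes> shift k (r' k) = \<one>"
    unfolding shift_r[symmetric] using c shift_simps(2)[of "r k" "r' k", symmetric] r_inv(1)[OF k_range(1)] shift_simps(4) by simp
  then have "r' (k + 1) \<otimes> (r (k + 1) \<otimes> shift k (r' k)) = r' (k + 1) \<otimes> \<one>" by (rule arg_cong)
  then show ?thesis
    using c r_cancel(2)[OF k_range(2), of "shift k (r' k)"] by (simp only: r_one)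
qed

text \<open>For subscript k the inner conjugation by \<open>r (k + 1)\<close> is trivial by
  \<open>ov_commute_above\<close>, and the outer one raises the subscript. For subscript k + 1 the
  inner conjugation raises it, and the outer one is trivial by
  \<open>ov_commute_below\<close>.\<close>

lemma shift_ov:
  assumes "x \<in> carrier B" "\<And>k. 2 \<le> k \<Longrightarrow> k < N \<Longrightarrow> commutes B (r k) x"
  shows "shift k (ov k x) = ov (k + 1) x" "shift k (ov (k + 1) x) = ov (k + 2) x"
proof -
  have kN: "k \<le> N" "k + 1 \<le> N" "k + 2 \<le> N" using k by auto
  note c = r_closed[OF k_range(1)] r_closed[OF k_range(2)] ov_closed[OF assms(1) kN(1)] ov_closed[OF assms(1) kN(2)]
     ov_closed[OF assms(1) kN(3)]
  have 1: "r (k + 1) \<otimes> ov k x = ov k x \<otimes> r (k + 1)"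
    using ov_commute_above[OF assms, of k "k + 1"] k by (simp add: commutes_def)
  have 2: "r k \<otimes> ov (k + 2) x = ov (k + 2) x \<otimes> r k"
    using ov_commute_below[OF assms, of k "k + 2"] k by (simp add: commutes_def)
  have "shift k (ov k x) = r k \<otimes> (r (k + 1) \<otimes> ov k x) \<otimes> r' (k + 1) \<otimes> r' k"
    using c by (simp only: shift_def m_assoc m_closed)
  also have "\<dots> = r k \<otimes> ov k x \<otimes> r' k"
    unfolding 1 using c by (simp only: m_assoc m_closed r_cancel k_range)
  finally show "shift k (ov k x) = ov (k + 1) x" using ov_Suc[of k x] k by simp
  have "shift k (ov (k + 1) x) = r k \<otimes> (r (k + 1) \<otimes> ov (k + 1) x \<otimes> r' (k + 1)) \<otimes> r' k"
    using c by (simp only: shift_def m_assoc m_closed)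
  also have "\<dots> = r k \<otimes> ov (k + 2) x \<otimes> r' k"
    using ov_Suc[of "k + 1" x] k by simp
  also have "\<dots> = ov (k + 2) x" unfolding 2 using c by (simp only: m_assoc r_inv k_range r_one)
  finally show "shift k (ov (k + 1) x) = ov (k + 2) x" .
qed

end

end

text \<open>\<open>X\<close> and \<open>D\<close> model M and the matrix of derivatives placed in
  the first tensor factor. Their relations involve \<open>r 1\<close>, which acts in two factors,
  hence the guard on N: with a single factor there is nothing to require.\<close>

locale weyl_rep = hecke_rep B N h r r'
  for B :: "(complex, 'b) module" (structure) and N h r r' +
  fixes X D :: 'b
  assumes XD_closed [simp]: "X \<in> carrier B" "D \<in> carrier B"
    and X_comm: "2 \<le> k \<Longrightarrow> k < N \<Longrightarrow> commutes B (r k) X"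
    and D_comm: "2 \<le> k \<Longrightarrow> k < N \<Longrightarrow> commutes B (r k) D"
    and DD: "2 \<le> N \<Longrightarrow> r' 1 \<otimes> D \<otimes> r' 1 \<otimes> D = D \<otimes> r' 1 \<otimes> D \<otimes> r' 1"
    and DX: "2 \<le> N \<Longrightarrow> D \<otimes> r 1 \<otimes> X \<otimes> r 1 = r 1 \<otimes> X \<otimes> r' 1 \<otimes> D \<oplus> r 1"
begin

text \<open>For k = 1 this is the defining relation multiplied by \<open>r' 1\<close> on the right.
  Applying \<open>shift k\<close> to the relation for k gives the one for k + 1.\<close>

lemma DX_ov:
  assumes "1 \<le> k" "k < N"
  shows "ov k D \<otimes> ov (k + 1) X \<otimes> r k = ov (k + 1) X \<otimes> ov k D \<otimes> r' k \<oplus> \<one>"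
  using assms
proof (induction k rule: nat_induct_at_least)
  case base
  then have k: "1 \<in> {1..<N}" by simp
  have N2: "2 \<le> N" using base by simp
  note c = r_closed[OF k]
  note [simp del] = One_nat_def
  have "ov 1 D \<otimes> ov (1 + 1) X \<otimes> r 1 = D \<otimes> r 1 \<otimes> X"
    using c ov_Suc[of 1 X] r_inv(2)[OF k] by (simp add: m_assoc)
  also have "\<dots> = (D \<otimes> r 1 \<otimes> X \<otimes> r 1) \<otimes> r' 1"
    using c r_inv(1)[OF k] by (simp add: m_assoc)
  also have "\<dots> = (r 1 \<otimes> X \<otimes> r' 1) \<otimes> D \<otimes> r' 1 \<oplus> \<one>"
    unfolding DX[OF N2]
    using c r_inv(1)[OF k] by (simp add: m_assoc l_distr)
  finally show ?case using ov_Suc[of 1 X] by simp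
next
  case (Suc k)
  then have k: "1 \<le> k" "k + 1 < N" by auto
  note kk = k_range[OF k]
  have kN: "k \<le> N" "k + 1 \<le> N" "k + 2 \<le> N" using k by auto
  note c = r_closed[OF kk(1)] r_closed[OF kk(2)] ov_closed[OF XD_closed(1) kN(2)]
     ov_closed[OF XD_closed(2) kN(1)]
  have "shift k (ov k D \<otimes> ov (k + 1) X \<otimes> r k) = shift k (ov (k + 1) X \<otimes> ov k D \<otimes> r' k \<oplus> \<one>)"
    using Suc k by simp
  then show ?case
    using c by (simp add: shift_simps[OF k] shift_ov[OF k _ X_comm, simplified] shift_ov[OF k _ D_comm, simplified]
      shift_r[OF k, simplified] shift_r'[OF k, simplified])
qed

text \<open>For k = 1, pulling out \<open>r 1\<close> on the left exposes one side of the defining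
  relation, and exchanging it for the other side cancels the final \<open>r 1\<close>. The rest is
  \<open>shift k\<close> again.\<close>

lemma DD_ov:
  assumes "1 \<le> k" "k < N"
  shows "ov k D \<otimes> r' k \<otimes> ov k D \<otimes> r k = ov (k + 1) D \<otimes> ov k D"
  using assms
proof (induction k rule: nat_induct_at_least)
  case base
  then have k: "1 \<in> {1..<N}" by simp
  have N2: "2 \<le> N" using base by simp
  note c = r_closed[OF k]
  note [simp del] = One_nat_def
  have "ov 1 D \<otimes> r' 1 \<otimes> ov 1 D \<otimes> r 1 = r 1 \<otimes> (r' 1 \<otimes> D \<otimes> r' 1 \<otimes> D) \<otimes> r 1"
    using c by (simp add: m_assoc r_cancel[OF k])
  also have "\<dots> = r 1 \<otimes> D \<otimes> r' 1 \<otimes> D"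
    unfolding DD[OF N2]
    using c r_inv(2)[OF k] by (simp add: m_assoc)
  finally show ?case using ov_Suc[of 1 D] by simp
next
  case (Suc k)
  then have k: "1 \<le> k" "k + 1 < N" by auto
  note kk = k_range[OF k]
  have kN: "k \<le> N" "k + 1 \<le> N" "k + 2 \<le> N" using k by auto
  note c = r_closed[OF kk(1)] r_closed[OF kk(2)] ov_closed[OF XD_closed(2) kN(2)]
     ov_closed[OF XD_closed(2) kN(1)]
  have "shift k (ov k D \<otimes> r' k \<otimes> ov k D \<otimes> r k) = shift k (ov (k + 1) D \<otimes> ov k D)"
    using Suc k by simp
  then show ?case
    using c by (simp add: shift_simps[OF k] shift_ov[OF k _ D_comm, simplified]
      shift_r[OF k, simplified] shift_r'[OF k, simplified])
qed

text \<open>The decreasing product of the overlined derivatives; S of the overview is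
  \<open>Dprod (m - 1)\<close>.\<close>

fun Dprod :: "nat \<Rightarrow> 'b" where
  "Dprod 0 = \<one>"
| "Dprod (Suc k) = ov (Suc k) D \<otimes> Dprod k"

lemma Dprod_closed [simp]: "k \<le> N \<Longrightarrow> Dprod k \<in> carrier B"
  by (induction k) auto

lemma r_Dprod_commute:
  assumes "k < l" "l < N"
  shows "commutes B (r l) (Dprod k)"
  using assms
proof (induction k)
  case (Suc k)
  then show ?case
    using ov_commute_above[OF XD_closed(2) D_comm, of "Suc k" l]
    by (auto intro!: commutes_mult)
qed (auto simp: commutes_def)

text \<open>For k = 1 the correction vanishes, as y_1 = 1. In the step from l to l + 1 put a =
  \<open>r l\<close>, D1 = \<open>ov l D\<close>, and let S be \<open>Dprod (l - 1)\<close>. The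
  identity for l is multiplied by D1 a on the left and by a on the right. Since a commutes with S,
  the leading term becomes the one for l + 1. On the other side, moving D1 past the overlined X
  leaves the surplus D1 S a. The correction term produces the same surplus through a a = h a + 1,
  and the coefficient 1/h is the one that makes the two cancel.\<close>

lemma Dprod_exchange:
  assumes "h \<noteq> 0" "1 \<le> k" "k \<le> N"
  shows "Dprod (k - 1) \<otimes> ov k X \<otimes> ov k D \<otimes> jm k \<oplus> (1 / h) \<odot> (Dprod (k - 1) \<ominus> Dprod (k - 1) \<otimes> jm k)
    = ov k X \<otimes> ov k D \<otimes> Dprod (k - 1)"
  using assms(2,3)
proof (induction k rule: nat_induct_at_least)
  case base
  then show ?case by (simp add: a_minus_def r_neg)
next
  case (Suc l)
  define g where "g = 1 / h"
  obtain k where l: "l = Suc k" using Suc.hyps by (cases l) auto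
  define S where "S = Dprod k"
  define a a' Y where a: "a = r l" "a' = r' l" "Y = jm l"
  define W where "W = jm (l + 1)"
  define X1 X2 D1 D2 where X: "X1 = ov l X" "X2 = ov (l + 1) X" "D1 = ov l D" "D2 = ov (l + 1) D"
  have l1: "1 \<le> l" "l \<in> {1..<N}" using Suc by auto
  have c [simp]: "S \<in> carrier B" "a \<in> carrier B" "a' \<in> carrier B" "Y \<in> carrier B"
     "X1 \<in> carrier B" "X2 \<in> carrier B" "D1 \<in> carrier B" "D2 \<in> carrier B"
    using Suc l by (auto simp: S_def a X simp del: ov.simps)
  have i [simp]: "a \<otimes> a' = \<one>" "a' \<otimes> a = \<one>" using l1 by (auto simp: a)
  have i2: "a \<otimes> (a' \<otimes> x) = x" "a' \<otimes> (a \<otimes> x) = x" if "x \<in> carrier B" for x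
    using r_cancel[OF l1(2) that] by (auto simp: a)
  have ovs: "X2 = a \<otimes> X1 \<otimes> a'" "D2 = a \<otimes> D1 \<otimes> a'" "W = a \<otimes> Y \<otimes> a"
    using ov_Suc[OF l1(1)] jm_Suc[OF l1(1)] by (simp_all add: X a W_def)
  have W [simp]: "W \<in> carrier B" by (simp add: ovs)
  have sq: "a \<otimes> a = h \<odot> a \<oplus> \<one>" using r_square[OF l1(2)] by (simp add: a)
  have Sa: "a \<otimes> S = S \<otimes> a"
    using r_Dprod_commute[of k l] Suc l by (simp add: S_def a commutes_def)
  have dx: "D1 \<otimes> X2 \<otimes> a = X2 \<otimes> D1 \<otimes> a' \<oplus> \<one>" using DX_ov[of l] l1 by (simp add: X a)
  have dd: "D1 \<otimes> a' \<otimes> D1 \<otimes> a = D2 \<otimes> D1" using DD_ov[of l] l1 by (simp add: X a)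
  define Z where "Z = S \<otimes> X1 \<otimes> D1 \<otimes> Y"
  have Z [simp]: "Z \<in> carrier B" by (simp add: Z_def)
  have IH: "Z \<oplus> g \<odot> (S \<ominus> S \<otimes> Y) = X1 \<otimes> D1 \<otimes> S"
    using Suc.IH Suc.prems l by (simp add: X S_def a g_def Z_def)
  have DP: "Dprod l = D1 \<otimes> S" by (simp add: l S_def X del: ov.simps)
  have "Dprod l \<otimes> X2 \<otimes> D2 \<otimes> W = D1 \<otimes> S \<otimes> (a \<otimes> X1 \<otimes> a') \<otimes> (a \<otimes> D1 \<otimes> a') \<otimes> (a \<otimes> Y \<otimes> a)"
    by (simp only: ovs DP)
  also have "\<dots> = D1 \<otimes> (S \<otimes> a) \<otimes> X1 \<otimes> D1 \<otimes> Y \<otimes> a"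
    by (simp add: m_assoc i2)
  also have "\<dots> = D1 \<otimes> a \<otimes> Z \<otimes> a"
    unfolding Sa[symmetric] Z_def by (simp add: m_assoc)
  finally have 1: "Dprod l \<otimes> X2 \<otimes> D2 \<otimes> W = D1 \<otimes> a \<otimes> Z \<otimes> a" .
  \<comment> \<open>Here \<open>dx\<close> gives the surplus D1 S a from its summand 1, and
    \<open>dd\<close> assembles D2 D1 out of the remaining product.\<close>
  have "D1 \<otimes> a \<otimes> (X1 \<otimes> D1 \<otimes> S) \<otimes> a = D1 \<otimes> (a \<otimes> X1 \<otimes> a') \<otimes> a \<otimes> D1 \<otimes> S \<otimes> a"
    by (simp add: m_assoc i2)
  also have "\<dots> = (D1 \<otimes> X2 \<otimes> a) \<otimes> D1 \<otimes> S \<otimes> a" by (simp add: ovs)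
  also have "\<dots> = X2 \<otimes> (D1 \<otimes> a' \<otimes> D1) \<otimes> (S \<otimes> a) \<oplus> D1 \<otimes> S \<otimes> a"
    unfolding dx by (simp add: m_assoc l_distr)
  also have "\<dots> = X2 \<otimes> (D1 \<otimes> a' \<otimes> D1 \<otimes> a) \<otimes> S \<oplus> D1 \<otimes> S \<otimes> a"
    unfolding Sa[symmetric] by (simp add: m_assoc)
  also have "\<dots> = X2 \<otimes> D2 \<otimes> (D1 \<otimes> S) \<oplus> D1 \<otimes> S \<otimes> a"
    unfolding dd by (simp add: m_assoc)
  finally have 2: "D1 \<otimes> a \<otimes> (X1 \<otimes> D1 \<otimes> S) \<otimes> a = X2 \<otimes> D2 \<otimes> (D1 \<otimes> S) \<oplus> D1 \<otimes> S \<otimes> a" .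
  \<comment> \<open>Since a passes S, the term without Y contains a a, whose linear part h a is
    scaled by 1/h to the second copy of the surplus.\<close>
  have "D1 \<otimes> a \<otimes> (g \<odot> (S \<ominus> S \<otimes> Y)) \<otimes> a = g \<odot> (D1 \<otimes> (a \<otimes> S) \<otimes> a \<ominus> D1 \<otimes> (a \<otimes> S) \<otimes> Y \<otimes> a)"
    by (simp add: smult_mult_left smult_mult_right m_assoc a_minus_def l_distr r_distr l_minus r_minus)
  also have "\<dots> = g \<odot> (D1 \<otimes> S \<otimes> (a \<otimes> a) \<ominus> D1 \<otimes> S \<otimes> W)"
    unfolding Sa by (simp add: m_assoc ovs(3))
  also have "\<dots> = g \<odot> (h \<odot> (D1 \<otimes> S \<otimes> a) \<oplus> (D1 \<otimes> S \<ominus> D1 \<otimes> S \<otimes> W))"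
    unfolding sq by (simp add: r_distr smult_mult_left smult_mult_right a_minus_def a_assoc)
  also have "\<dots> = D1 \<otimes> S \<otimes> a \<oplus> g \<odot> (D1 \<otimes> S \<ominus> D1 \<otimes> S \<otimes> W)"
    using assms(1) by (simp add: smult_add_right smult_smult g_def)
  finally have 3: "D1 \<otimes> a \<otimes> (g \<odot> (S \<ominus> S \<otimes> Y)) \<otimes> a
    = D1 \<otimes> S \<otimes> a \<oplus> g \<odot> (D1 \<otimes> S \<ominus> D1 \<otimes> S \<otimes> W)" .
  have "D1 \<otimes> a \<otimes> Z \<otimes> a \<oplus> (D1 \<otimes> S \<otimes> a \<oplus> g \<odot> (D1 \<otimes> S \<ominus> D1 \<otimes> S \<otimes> W))
      = X2 \<otimes> D2 \<otimes> (D1 \<otimes> S) \<oplus> D1 \<otimes> S \<otimes> a"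
    unfolding 3[symmetric] 2[symmetric] IH[symmetric] by (simp add: l_distr r_distr)
  \<comment> \<open>The surplus is moved to the front on both sides, where it cancels.\<close>
  then have "D1 \<otimes> S \<otimes> a \<oplus> (D1 \<otimes> a \<otimes> Z \<otimes> a \<oplus> g \<odot> (D1 \<otimes> S \<ominus> D1 \<otimes> S \<otimes> W))
      = D1 \<otimes> S \<otimes> a \<oplus> X2 \<otimes> D2 \<otimes> (D1 \<otimes> S)"
    by (simp add: a_ac)
  then have "D1 \<otimes> a \<otimes> Z \<otimes> a \<oplus> g \<odot> (D1 \<otimes> S \<ominus> D1 \<otimes> S \<otimes> W) = X2 \<otimes> D2 \<otimes> (D1 \<otimes> S)"
    by simp
  then show ?case
    unfolding 1[symmetric] by (simp add: X S_def l g_def W_def del: ov.simps jm.simps)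
qed

lemma lprod_map_Suc:
  "(\<And>k. k \<in> {1..Suc m} \<Longrightarrow> f k \<in> carrier B) \<Longrightarrow>
    lprod B (map f [1..<Suc m + 1]) = lprod B (map f [1..<m + 1]) \<otimes> f (Suc m)"
  using lprod_append[of "map f [1..<m + 1]" "[f (Suc m)]"]
  by (auto simp: image_subset_iff lprod_def)

text \<open>The induction hypothesis is applied not to E but to the last factor times E, which turns
  the first m factors into M_1 ... M_m D_m ... D_1. The exchange identity then moves D_m ... D_1
  across the last factor. For this E has to be an arbitrary element of the algebra.\<close>

theorem capelli:
  assumes "h \<noteq> 0" "m \<le> N" "E \<in> carrier B"
    and c: "\<And>k. k \<in> {1..m} \<Longrightarrow> c k \<noteq> 0"
    and E: "\<And>k. k \<in> {1..m} \<Longrightarrow> jm k \<otimes> E = c k \<odot> E"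
  shows "lprod B (map (\<lambda>k. ov k (X \<otimes> D) \<oplus> ((inverse (c k) - 1) / h) \<odot> \<one>) [1..<m + 1]) \<otimes> E
    = (\<Prod>k=1..m. inverse (c k)) \<odot> (lprod B (map (\<lambda>k. ov k X) [1..<m + 1])
        \<otimes> Dprod m \<otimes> E)"
  using assms(2,3) c E
proof (induction m arbitrary: E)
  case 0
  then show ?case by (simp add: lprod_def)
next
  case (Suc m)
  define l where "l = Suc m"
  define F where "F = (\<lambda>k. ov k (X \<otimes> D) \<oplus> ((inverse (c k) - 1) / h) \<odot> \<one>)"
  define d where "d = c l"
  have d: "d \<noteq> 0" using Suc.prems by (simp add: d_def l_def)
  have Fc: "F k \<in> carrier B" if "k \<le> l" for k
    using that Suc.prems by (simp add: F_def l_def)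
  have lN: "1 \<le> l" "l \<le> N" "m \<le> N" using Suc.prems by (auto simp: l_def)
  have E [simp]: "E \<in> carrier B" by fact
  note c [simp] = ov_closed[OF _ lN(2)] jm_closed[OF lN(2)] Dprod_closed[OF lN(3)]
  \<comment> \<open>Both overlined matrices in \<open>F l\<close> commute with y_k for k < l, and
    the shift is a scalar.\<close>
  have comm: "jm k \<otimes> F l = F l \<otimes> jm k" if "k \<in> {1..m}" for k
  proof -
    have "commutes B (ov l X) (jm k)" "commutes B (ov l D) (jm k)"
      using that lN by (auto intro!: jm_ov_commute X_comm D_comm simp: l_def)
    then have "commutes B (jm k) (ov l (X \<otimes> D))"
      unfolding ov_mult[OF XD_closed lN(2)]
      using that lN by (intro commutes_mult) (auto intro: commutes_sym)
    moreover have "commutes B (jm k) (((inverse (c l) - 1) / h) \<odot> \<one>)"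
      using that lN by simp
    ultimately show ?thesis
      using that lN by (simp add: F_def commutes_def l_distr r_distr)
  qed
  \<comment> \<open>By \<open>comm\<close> the vector \<open>F l\<close> times E has the eigenvalues
    of E for y_1, ..., y_m.\<close>
  have IH: "lprod B (map F [1..<m + 1]) \<otimes> (F l \<otimes> E)
    = (\<Prod>k=1..m. inverse (c k)) \<odot> (lprod B (map (\<lambda>k. ov k X) [1..<m + 1]) \<otimes> Dprod m \<otimes> (F l \<otimes> E))"
    unfolding F_def
  proof (rule Suc.IH)
    fix k assume k: "k \<in> {1..m}"
    have "jm k \<otimes> (F l \<otimes> E) = F l \<otimes> (jm k \<otimes> E)"
      using k lN comm[OF k] Fc[of l] by (simp flip: m_assoc)
    also have "\<dots> = c k \<odot> (F l \<otimes> E)"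
      using k lN Suc.prems(4)[of k] Fc[of l] by (simp add: smult_mult_right)
    finally show "jm k \<otimes> ((ov l (X \<otimes> D) \<oplus> ((inverse (c l) - 1) / h) \<odot> \<one>) \<otimes> E)
        = c k \<odot> ((ov l (X \<otimes> D) \<oplus> ((inverse (c l) - 1) / h) \<odot> \<one>) \<otimes> E)"
      by (simp add: F_def)
  qed (use Suc.prems in \<open>auto simp: l_def\<close>)
  have jE: "jm l \<otimes> E = d \<odot> E" using Suc.prems by (simp add: d_def l_def)
  define P where "P = Dprod m \<otimes> ov l X \<otimes> ov l D"
  have P [simp]: "P \<in> carrier B" by (simp add: P_def)
  have "ov l X \<otimes> ov l D \<otimes> Dprod m \<otimes> E
      = (P \<otimes> jm l \<oplus> (1 / h) \<odot> (Dprod m \<ominus> Dprod m \<otimes> jm l)) \<otimes> E"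
    using Dprod_exchange[OF assms(1) lN(1,2)] by (simp add: l_def P_def)
  also have "\<dots> = P \<otimes> (jm l \<otimes> E) \<oplus> (1 / h) \<odot> (Dprod m \<otimes> E \<ominus> Dprod m \<otimes> (jm l \<otimes> E))"
    by (simp add: m_assoc l_distr smult_mult_left a_minus_def l_minus)
  also have "\<dots> = d \<odot> (P \<otimes> E) \<oplus> (1 / h) \<odot> ((1 - d) \<odot> (Dprod m \<otimes> E))"
    unfolding jE using smult_add_left[of "Dprod m \<otimes> E" 1 "- d"]
    by (simp add: smult_mult_right a_minus_def smult_uminus)
  finally have *: "ov l X \<otimes> ov l D \<otimes> Dprod m \<otimes> E
      = d \<odot> (P \<otimes> E) \<oplus> (1 / h) \<odot> ((1 - d) \<odot> (Dprod m \<otimes> E))" .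
  \<comment> \<open>Division by d turns (1 - d)/h into (1/d - 1)/h, the scalar contained in
    \<open>F l\<close>.\<close>
  have "inverse d \<odot> (ov l X \<otimes> ov l D \<otimes> Dprod m \<otimes> E)
      = P \<otimes> E \<oplus> ((inverse d - 1) / h) \<odot> (Dprod m \<otimes> E)"
  proof -
    have "inverse d * (1 / h * (1 - d)) = (inverse d - 1) / h" using d by (simp add: field_simps)
    then show ?thesis
      unfolding * using d by (simp add: smult_add_right smult_smult del: times_divide_eq_right times_divide_eq_left mult_1)
  qed
  also have "\<dots> = Dprod m \<otimes> (F l \<otimes> E)"
    using lN by (simp add: F_def d_def P_def ov_mult r_distr l_distr m_assoc smult_mult_left smult_mult_right)
  finally have key: "Dprod m \<otimes> (F l \<otimes> E) = inverse d \<odot> (ov l X \<otimes> (ov l D \<otimes> (Dprod m \<otimes> E)))"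
    by (simp add: m_assoc)
  define M where "M = lprod B (map (\<lambda>k. ov k X) [1..<m + 1])"
  have M [simp]: "M \<in> carrier B" using lN unfolding M_def by (intro lprod_closed) auto
  have FF: "lprod B (map F [1..<m + 1]) \<in> carrier B" using Fc by (auto intro!: lprod_closed simp: l_def)
  have "lprod B (map F [1..<l + 1]) \<otimes> E = lprod B (map F [1..<m + 1]) \<otimes> (F l \<otimes> E)"
    using lprod_map_Suc[of m F] Fc FF by (simp add: l_def m_assoc)
  also have "\<dots> = (\<Prod>k=1..m. inverse (c k)) \<odot> (M \<otimes> (Dprod m \<otimes> (F l \<otimes> E)))"
    unfolding IH M_def[symmetric] using Fc[of l] by (simp add: m_assoc)
  also have "\<dots> = (\<Prod>k=1..l. inverse (c k)) \<odot> (M \<otimes> ov l X \<otimes> (ov l D \<otimes> Dprod m) \<otimes> E)"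
    unfolding key using lN by (simp add: smult_mult_right smult_smult l_def[symmetric] m_assoc)
       (simp add: l_def d_def mult.commute)
  also have "M \<otimes> ov l X = lprod B (map (\<lambda>k. ov k X) [1..<l + 1])"
    using lprod_map_Suc[of m "\<lambda>k. ov k X"] lN by (simp only: M_def l_def) auto
  finally show ?case
    by (simp add: l_def F_def)
qed

end

section \<open>Matrix algebras\<close>

lemma mat_alg_simps:
  "i \<in> S \<Longrightarrow> j \<in> S \<Longrightarrow> (X \<otimes>\<^bsub>mat_alg S A\<^esub> Y) i j = (\<Oplus>\<^bsub>A\<^esub>k\<in>S. X i k \<otimes>\<^bsub>A\<^esub> Y k j)"
  "i \<in> S \<Longrightarrow> j \<in> S \<Longrightarrow> \<one>\<^bsub>mat_alg S A\<^esub> i j = (if i = j then \<one>\<^bsub>A\<^esub> else \<zero>\<^bsub>A\<^esub>)"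
  "i \<in> S \<Longrightarrow> j \<in> S \<Longrightarrow> \<zero>\<^bsub>mat_alg S A\<^esub> i j = \<zero>\<^bsub>A\<^esub>"
  "i \<in> S \<Longrightarrow> j \<in> S \<Longrightarrow> (X \<oplus>\<^bsub>mat_alg S A\<^esub> Y) i j = X i j \<oplus>\<^bsub>A\<^esub> Y i j"
  "i \<in> S \<Longrightarrow> j \<in> S \<Longrightarrow> (c \<odot>\<^bsub>mat_alg S A\<^esub> X) i j = c \<odot>\<^bsub>A\<^esub> X i j"
  by (simp_all add: mat_alg_def)

lemma mat_alg_entry: "X \<in> carrier (mat_alg S A) \<Longrightarrow> i \<in> S \<Longrightarrow> j \<in> S \<Longrightarrow> X i j \<in> carrier A"
  by (auto simp: mat_alg_def)

lemma mat_alg_eqI: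
  assumes "X \<in> carrier (mat_alg S A)" "Y \<in> carrier (mat_alg S A)"
    and "\<And>i j. i \<in> S \<Longrightarrow> j \<in> S \<Longrightarrow> X i j = Y i j"
  shows "X = Y"
proof (rule PiE_ext)
  show "X \<in> S \<rightarrow>\<^sub>E (S \<rightarrow>\<^sub>E carrier A)" "Y \<in> S \<rightarrow>\<^sub>E (S \<rightarrow>\<^sub>E carrier A)"
    using assms by (simp_all add: mat_alg_def)
  then show "X i = Y i" if "i \<in> S" for i
    using assms(3) that by (intro PiE_ext[of "X i" S "\<lambda>_. carrier A" "Y i"]) auto
qed

lemma mat_alg_restrictI:
  "(\<And>i j. i \<in> S \<Longrightarrow> j \<in> S \<Longrightarrow> f i j \<in> carrier A) \<Longrightarrow> (\<lambda>i\<in>S. \<lambda>j\<in>S. f i j) \<in> carrier (mat_alg S A)"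
  by (auto simp: mat_alg_def)

lemma calg_mat_alg:
  assumes "calg A" "finite S"
  shows "calg (mat_alg S A)"
proof -
  interpret calg A by fact
  note m = mat_alg_simps mat_alg_entry
  let ?M = "mat_alg S A"
  have cl: "X \<otimes>\<^bsub>?M\<^esub> Y \<in> carrier ?M" "X \<oplus>\<^bsub>?M\<^esub> Y \<in> carrier ?M" "c \<odot>\<^bsub>?M\<^esub> X \<in> carrier ?M"
    if "X \<in> carrier ?M" "Y \<in> carrier ?M" for X Y c
    using mat_alg_entry[OF that(1)] mat_alg_entry[OF that(2)]
    by (auto simp: mat_alg_def intro!: finsum_closed)
  have cl1: "\<one>\<^bsub>?M\<^esub> \<in> carrier ?M" "\<zero>\<^bsub>?M\<^esub> \<in> carrier ?M"
    by (auto simp: mat_alg_def)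
  have ring: "ring ?M"
  proof (intro ringI abelian_groupI monoidI)
    fix X Y Z assume X: "X \<in> carrier ?M" and Y: "Y \<in> carrier ?M" and Z: "Z \<in> carrier ?M"
    note XYZ = mat_alg_entry[OF X] mat_alg_entry[OF Y] mat_alg_entry[OF Z]
    show "X \<otimes>\<^bsub>?M\<^esub> Y \<otimes>\<^bsub>?M\<^esub> Z = X \<otimes>\<^bsub>?M\<^esub> (Y \<otimes>\<^bsub>?M\<^esub> Z)"
    proof (rule mat_alg_eqI[of _ S A])
      fix i j assume ij: "i \<in> S" "j \<in> S"
      have "(X \<otimes>\<^bsub>?M\<^esub> Y \<otimes>\<^bsub>?M\<^esub> Z) i j
          = (\<Oplus>\<^bsub>A\<^esub>l\<in>S. (\<Oplus>\<^bsub>A\<^esub>k\<in>S. X i k \<otimes>\<^bsub>A\<^esub> Y k l \<otimes>\<^bsub>A\<^esub> Z l j))"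
        using ij XYZ assms by (auto simp: m intro!: finsum_cong' finsum_ldistr finsum_closed)
      also have "\<dots> = (\<Oplus>\<^bsub>A\<^esub>k\<in>S. (\<Oplus>\<^bsub>A\<^esub>l\<in>S. X i k \<otimes>\<^bsub>A\<^esub> Y k l \<otimes>\<^bsub>A\<^esub> Z l j))"
        using ij XYZ assms by (intro finsum_swap) auto
      also have "\<dots> = (\<Oplus>\<^bsub>A\<^esub>k\<in>S. X i k \<otimes>\<^bsub>A\<^esub> (\<Oplus>\<^bsub>A\<^esub>l\<in>S. Y k l \<otimes>\<^bsub>A\<^esub> Z l j))"
      proof (intro finsum_cong')
        fix k assume "k \<in> S"
        then have "X i k \<otimes>\<^bsub>A\<^esub> (\<Oplus>\<^bsub>A\<^esub>l\<in>S. Y k l \<otimes>\<^bsub>A\<^esub> Z l j)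
          = (\<Oplus>\<^bsub>A\<^esub>l\<in>S. X i k \<otimes>\<^bsub>A\<^esub> (Y k l \<otimes>\<^bsub>A\<^esub> Z l j))"
          using ij XYZ assms by (intro finsum_rdistr) auto
        also have "\<dots> = (\<Oplus>\<^bsub>A\<^esub>l\<in>S. X i k \<otimes>\<^bsub>A\<^esub> Y k l \<otimes>\<^bsub>A\<^esub> Z l j)"
          using ij XYZ \<open>k \<in> S\<close> by (intro finsum_cong') (auto simp: m_assoc)
        finally show "(\<Oplus>\<^bsub>A\<^esub>l\<in>S. X i k \<otimes>\<^bsub>A\<^esub> Y k l \<otimes>\<^bsub>A\<^esub> Z l j) = X i k \<otimes>\<^bsub>A\<^esub> (\<Oplus>\<^bsub>A\<^esub>l\<in>S. Y k l \<otimes>\<^bsub>A\<^esub> Z l j)"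
          by simp
      qed (use ij XYZ in \<open>auto intro!: finsum_closed\<close>)
      also have "\<dots> = (X \<otimes>\<^bsub>?M\<^esub> (Y \<otimes>\<^bsub>?M\<^esub> Z)) i j"
        using ij XYZ by (auto simp: m intro!: finsum_cong' finsum_closed)
      finally show "(X \<otimes>\<^bsub>?M\<^esub> Y \<otimes>\<^bsub>?M\<^esub> Z) i j = (X \<otimes>\<^bsub>?M\<^esub> (Y \<otimes>\<^bsub>?M\<^esub> Z)) i j" .
    qed (use X Y Z in \<open>auto intro!: cl\<close>)
    show "(X \<oplus>\<^bsub>?M\<^esub> Y) \<otimes>\<^bsub>?M\<^esub> Z = X \<otimes>\<^bsub>?M\<^esub> Z \<oplus>\<^bsub>?M\<^esub> Y \<otimes>\<^bsub>?M\<^esub> Z"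
    proof (rule mat_alg_eqI[of _ S A])
      fix i j assume ij: "i \<in> S" "j \<in> S"
      have "((X \<oplus>\<^bsub>?M\<^esub> Y) \<otimes>\<^bsub>?M\<^esub> Z) i j = (\<Oplus>\<^bsub>A\<^esub>k\<in>S. X i k \<otimes>\<^bsub>A\<^esub> Z k j \<oplus>\<^bsub>A\<^esub> Y i k \<otimes>\<^bsub>A\<^esub> Z k j)"
        unfolding mat_alg_simps(1)[OF ij] using ij XYZ by (intro finsum_cong') (auto simp: m l_distr)
      also have "\<dots> = (\<Oplus>\<^bsub>A\<^esub>k\<in>S. X i k \<otimes>\<^bsub>A\<^esub> Z k j) \<oplus>\<^bsub>A\<^esub> (\<Oplus>\<^bsub>A\<^esub>k\<in>S. Y i k \<otimes>\<^bsub>A\<^esub> Z k j)"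
        using ij XYZ by (intro finsum_addf) auto
      finally show "((X \<oplus>\<^bsub>?M\<^esub> Y) \<otimes>\<^bsub>?M\<^esub> Z) i j = (X \<otimes>\<^bsub>?M\<^esub> Z \<oplus>\<^bsub>?M\<^esub> Y \<otimes>\<^bsub>?M\<^esub> Z) i j"
        using ij by (simp add: m)
    qed (use X Y Z in \<open>auto intro!: cl\<close>)
    show "Z \<otimes>\<^bsub>?M\<^esub> (X \<oplus>\<^bsub>?M\<^esub> Y) = Z \<otimes>\<^bsub>?M\<^esub> X \<oplus>\<^bsub>?M\<^esub> Z \<otimes>\<^bsub>?M\<^esub> Y"
    proof (rule mat_alg_eqI[of _ S A])
      fix i j assume ij: "i \<in> S" "j \<in> S"
      have "(Z \<otimes>\<^bsub>?M\<^esub> (X \<oplus>\<^bsub>?M\<^esub> Y)) i j = (\<Oplus>\<^bsub>A\<^esub>k\<in>S. Z i k \<otimes>\<^bsub>A\<^esub> X k j \<oplus>\<^bsub>A\<^esub> Z i k \<otimes>\<^bsub>A\<^esub> Y k j)"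
        unfolding mat_alg_simps(1)[OF ij] using ij XYZ by (intro finsum_cong') (auto simp: m r_distr)
      also have "\<dots> = (\<Oplus>\<^bsub>A\<^esub>k\<in>S. Z i k \<otimes>\<^bsub>A\<^esub> X k j) \<oplus>\<^bsub>A\<^esub> (\<Oplus>\<^bsub>A\<^esub>k\<in>S. Z i k \<otimes>\<^bsub>A\<^esub> Y k j)"
        using ij XYZ by (intro finsum_addf) auto
      finally show "(Z \<otimes>\<^bsub>?M\<^esub> (X \<oplus>\<^bsub>?M\<^esub> Y)) i j = (Z \<otimes>\<^bsub>?M\<^esub> X \<oplus>\<^bsub>?M\<^esub> Z \<otimes>\<^bsub>?M\<^esub> Y) i j"
        using ij by (simp add: m)
    qed (use X Y Z in \<open>auto intro!: cl\<close>)
    show "X \<oplus>\<^bsub>?M\<^esub> Y \<oplus>\<^bsub>?M\<^esub> Z = X \<oplus>\<^bsub>?M\<^esub> (Y \<oplus>\<^bsub>?M\<^esub> Z)"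
      by (rule mat_alg_eqI[of _ S A]) (use X Y Z in \<open>auto intro!: cl simp: m a_assoc\<close>)
    show "X \<oplus>\<^bsub>?M\<^esub> Y = Y \<oplus>\<^bsub>?M\<^esub> X"
      by (rule mat_alg_eqI[of _ S A]) (use X Y Z in \<open>auto intro!: cl simp: m a_comm\<close>)
    show "\<zero>\<^bsub>?M\<^esub> \<oplus>\<^bsub>?M\<^esub> X = X"
      by (rule mat_alg_eqI[of _ S A]) (use X Y Z in \<open>auto intro!: cl cl1 simp: m\<close>)
    show "\<exists>Y\<in>carrier ?M. Y \<oplus>\<^bsub>?M\<^esub> X = \<zero>\<^bsub>?M\<^esub>"
    proof
      \<comment> \<open>The scalar -1 supplies additive inverses without leaving the operations of
        the matrix record.\<close>
      have *: "(- 1) \<odot>\<^bsub>?M\<^esub> X \<in> carrier ?M" using X by (intro cl)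
      show "(- 1) \<odot>\<^bsub>?M\<^esub> X \<oplus>\<^bsub>?M\<^esub> X = \<zero>\<^bsub>?M\<^esub>"
        by (rule mat_alg_eqI[of _ S A])
           (use X * in \<open>auto intro!: cl cl1 simp: m smult_uminus l_neg\<close>)
      show "(- 1) \<odot>\<^bsub>?M\<^esub> X \<in> carrier ?M" by fact
    qed
    show "\<one>\<^bsub>?M\<^esub> \<otimes>\<^bsub>?M\<^esub> X = X"
    proof (rule mat_alg_eqI[of _ S A])
      fix i j assume "i \<in> S" "j \<in> S"
      then show "(\<one>\<^bsub>?M\<^esub> \<otimes>\<^bsub>?M\<^esub> X) i j = X i j"
        unfolding mat_alg_simps(1)[OF \<open>i \<in> S\<close> \<open>j \<in> S\<close>]
        by (intro finsum_delta[where i = i]) (use assms XYZ in \<open>auto simp: m\<close>)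
    qed (use X in \<open>auto intro!: cl cl1\<close>)
    show "X \<otimes>\<^bsub>?M\<^esub> \<one>\<^bsub>?M\<^esub> = X"
    proof (rule mat_alg_eqI[of _ S A])
      fix i j assume "i \<in> S" "j \<in> S"
      then show "(X \<otimes>\<^bsub>?M\<^esub> \<one>\<^bsub>?M\<^esub>) i j = X i j"
        unfolding mat_alg_simps(1)[OF \<open>i \<in> S\<close> \<open>j \<in> S\<close>]
        by (intro finsum_delta[where i = j]) (use assms XYZ in \<open>auto simp: m\<close>)
    qed (use X in \<open>auto intro!: cl cl1\<close>)
  qed (auto intro!: cl cl1)
  show ?thesis
  proof (rule calgI[OF ring])
    fix X Y c assume X: "X \<in> carrier ?M" and Y: "Y \<in> carrier ?M"
    note XY = mat_alg_entry[OF X] mat_alg_entry[OF Y]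
    show "(c \<odot>\<^bsub>?M\<^esub> X) \<otimes>\<^bsub>?M\<^esub> Y = c \<odot>\<^bsub>?M\<^esub> (X \<otimes>\<^bsub>?M\<^esub> Y)"
      by (rule mat_alg_eqI[of _ S A])
         (use X Y XY in \<open>auto intro!: cl finsum_cong' simp: m smult_finsum smult_mult_left Pi_iff\<close>)
    show "X \<otimes>\<^bsub>?M\<^esub> (c \<odot>\<^bsub>?M\<^esub> Y) = c \<odot>\<^bsub>?M\<^esub> (X \<otimes>\<^bsub>?M\<^esub> Y)"
      by (rule mat_alg_eqI[of _ S A])
         (use X Y XY in \<open>auto intro!: cl finsum_cong' simp: m smult_finsum smult_mult_right Pi_iff\<close>)
    show "c \<odot>\<^bsub>?M\<^esub> (X \<oplus>\<^bsub>?M\<^esub> Y) = c \<odot>\<^bsub>?M\<^esub> X \<oplus>\<^bsub>?M\<^esub> c \<odot>\<^bsub>?M\<^esub> Y"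
      by (rule mat_alg_eqI[of _ S A]) (use X Y in \<open>auto intro!: cl simp: m smult_add_right\<close>)
    fix d
    show "(c + d) \<odot>\<^bsub>?M\<^esub> X = c \<odot>\<^bsub>?M\<^esub> X \<oplus>\<^bsub>?M\<^esub> d \<odot>\<^bsub>?M\<^esub> X"
      by (rule mat_alg_eqI[of _ S A]) (use X in \<open>auto intro!: cl simp: m smult_add_left\<close>)
    show "c \<odot>\<^bsub>?M\<^esub> (d \<odot>\<^bsub>?M\<^esub> X) = (c * d) \<odot>\<^bsub>?M\<^esub> X"
      by (rule mat_alg_eqI[of _ S A]) (use X in \<open>auto intro!: cl simp: m smult_smult\<close>)
    show "1 \<odot>\<^bsub>?M\<^esub> X = X"
      by (rule mat_alg_eqI[of _ S A]) (use X in \<open>auto intro!: cl simp: m\<close>)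
  qed (auto intro!: cl)
qed

lemma map_mtx_entry [simp]: "i \<in> S \<Longrightarrow> j \<in> S \<Longrightarrow> map_mtx S f X i j = f (X i j)"
  by (simp add: map_mtx_def)

lemma map_mtx_hom:
  assumes "calg A" "calg B" "f \<in> alg_hom A B" "finite S"
  shows "map_mtx S f \<in> alg_hom (mat_alg S A) (mat_alg S B)"
proof -
  interpret A: calg A by fact
  interpret B: calg B by fact
  interpret MA: calg "mat_alg S A" by (rule calg_mat_alg) fact+
  interpret MB: calg "mat_alg S B" by (rule calg_mat_alg) fact+
  note f = alg_homD[OF assms(3)]
  note m = mat_alg_simps mat_alg_entry
  have cl: "map_mtx S f X \<in> carrier (mat_alg S B)" if "X \<in> carrier (mat_alg S A)" for X
    unfolding map_mtx_def by (intro mat_alg_restrictI f mat_alg_entry[OF that])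
  show ?thesis
  proof (rule alg_homI)
    fix X Y assume X: "X \<in> carrier (mat_alg S A)" and Y: "Y \<in> carrier (mat_alg S A)"
    note XY = mat_alg_entry[OF X] mat_alg_entry[OF Y]
    show "map_mtx S f (X \<otimes>\<^bsub>mat_alg S A\<^esub> Y) = map_mtx S f X \<otimes>\<^bsub>mat_alg S B\<^esub> map_mtx S f Y"
    proof (rule mat_alg_eqI[of _ S B])
      fix i j assume ij: "i \<in> S" "j \<in> S"
      then have "map_mtx S f (X \<otimes>\<^bsub>mat_alg S A\<^esub> Y) i j = (\<Oplus>\<^bsub>B\<^esub>k\<in>S. f (X i k \<otimes>\<^bsub>A\<^esub> Y k j))"
        using XY by (simp add: m) (intro alg_hom_finsum[OF assms(1-3)]; auto)
      also have "\<dots> = (map_mtx S f X \<otimes>\<^bsub>mat_alg S B\<^esub> map_mtx S f Y) i j"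
        using XY ij by (auto simp: m f intro!: B.finsum_cong')
      finally show "map_mtx S f (X \<otimes>\<^bsub>mat_alg S A\<^esub> Y) i j = (map_mtx S f X \<otimes>\<^bsub>mat_alg S B\<^esub> map_mtx S f Y) i j" .
    qed (use X Y in \<open>auto intro!: cl\<close>)
    show "map_mtx S f (X \<oplus>\<^bsub>mat_alg S A\<^esub> Y) = map_mtx S f X \<oplus>\<^bsub>mat_alg S B\<^esub> map_mtx S f Y"
      by (rule mat_alg_eqI[of _ S B]) (use X Y XY in \<open>auto intro!: cl MB.a_closed simp: m f\<close>)
    show "map_mtx S f (c \<odot>\<^bsub>mat_alg S A\<^esub> X) = c \<odot>\<^bsub>mat_alg S B\<^esub> map_mtx S f X" for c
      by (rule mat_alg_eqI[of _ S B]) (use X XY in \<open>auto intro!: cl MB.smult_closed simp: m f\<close>)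
  next
    show "map_mtx S f \<one>\<^bsub>mat_alg S A\<^esub> = \<one>\<^bsub>mat_alg S B\<^esub>"
      by (rule mat_alg_eqI[of _ S B])
         (use alg_hom_zero[OF assms(1-3)] in \<open>auto intro!: cl simp: m f\<close>)
  qed (auto intro: cl)
qed

text \<open>Each fibre of \<open>\<rho>\<close> is a copy of \<open>S\<^sub>0\<close> via \<open>\<pi>\<close>, so matrices over \<open>S\<^sub>0\<close> act fibrewise: this is
  \<open>X \<mapsto> X \<otimes> 1\<close> for all the embeddings of tensor factors that occur.\<close>

definition emb_mtx :: "(complex, 'a) module \<Rightarrow> 'i set \<Rightarrow> ('i \<Rightarrow> 'k) \<Rightarrow> ('i \<Rightarrow> 'l) \<Rightarrow> ('k, 'a) mtx \<Rightarrow> ('i, 'a) mtx" where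
  "emb_mtx A S \<pi> \<rho> X = (\<lambda>I\<in>S. \<lambda>J\<in>S. if \<rho> I = \<rho> J then X (\<pi> I) (\<pi> J) else \<zero>\<^bsub>A\<^esub>)"

lemma emb_mtx_entry [simp]:
  "I \<in> S \<Longrightarrow> J \<in> S \<Longrightarrow> emb_mtx A S \<pi> \<rho> X I J = (if \<rho> I = \<rho> J then X (\<pi> I) (\<pi> J) else \<zero>\<^bsub>A\<^esub>)"
  by (simp add: emb_mtx_def)

text \<open>In a product entry with \<open>\<rho> I = \<rho> J\<close> only the indices K of the
  same fibre contribute, and \<open>\<pi>\<close> turns the sum over that fibre into the sum over
  \<open>S\<^sub>0\<close>. For I and J in different fibres no K lies in both, and every term
  vanishes.\<close>

lemma emb_mtx_hom:
  assumes "calg A" "finite S" "finite S\<^sub>0"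
    and bij: "\<And>I. I \<in> S \<Longrightarrow> bij_betw \<pi> {K \<in> S. \<rho> I = \<rho> K} S\<^sub>0"
  shows "emb_mtx A S \<pi> \<rho> \<in> alg_hom (mat_alg S\<^sub>0 A) (mat_alg S A)"
proof -
  interpret A: calg A by fact
  interpret M0: calg "mat_alg S\<^sub>0 A" by (rule calg_mat_alg) fact+
  interpret M: calg "mat_alg S A" by (rule calg_mat_alg) fact+
  note m = mat_alg_simps mat_alg_entry
  have \<pi>: "\<pi> I \<in> S\<^sub>0" if "I \<in> S" for I
    using bij[OF that] that by (auto simp: bij_betw_def)
  have inj: "\<pi> I = \<pi> J \<longleftrightarrow> I = J" if "I \<in> S" "J \<in> S" "\<rho> I = \<rho> J" for I J
    using bij[OF that(1)] that by (auto simp: bij_betw_def inj_on_def)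
  have cl: "emb_mtx A S \<pi> \<rho> X \<in> carrier (mat_alg S A)" if "X \<in> carrier (mat_alg S\<^sub>0 A)" for X
    unfolding emb_mtx_def using mat_alg_entry[OF that] \<pi> by (intro mat_alg_restrictI) auto
  show ?thesis
  proof (rule alg_homI)
    fix X Y assume X: "X \<in> carrier (mat_alg S\<^sub>0 A)" and Y: "Y \<in> carrier (mat_alg S\<^sub>0 A)"
    note XY = mat_alg_entry[OF X] mat_alg_entry[OF Y]
    show "emb_mtx A S \<pi> \<rho> (X \<otimes>\<^bsub>mat_alg S\<^sub>0 A\<^esub> Y) = emb_mtx A S \<pi> \<rho> X \<otimes>\<^bsub>mat_alg S A\<^esub> emb_mtx A S \<pi> \<rho> Y"
    proof (rule mat_alg_eqI[of _ S A])
      fix I J assume ij: "I \<in> S" "J \<in> S"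
      let ?e = "emb_mtx A S \<pi> \<rho>"
      show "?e (X \<otimes>\<^bsub>mat_alg S\<^sub>0 A\<^esub> Y) I J = (?e X \<otimes>\<^bsub>mat_alg S A\<^esub> ?e Y) I J"
      proof (cases "\<rho> I = \<rho> J")
        case True
        have "(?e X \<otimes>\<^bsub>mat_alg S A\<^esub> ?e Y) I J = (\<Oplus>\<^bsub>A\<^esub>K\<in>S. ?e X I K \<otimes>\<^bsub>A\<^esub> ?e Y K J)"
          using ij by (simp add: m)
        also have "\<dots> = (\<Oplus>\<^bsub>A\<^esub>K\<in>{K \<in> S. \<rho> I = \<rho> K}. X (\<pi> I) (\<pi> K) \<otimes>\<^bsub>A\<^esub> Y (\<pi> K) (\<pi> J))"
          using ij True XY \<pi> assms(2) mat_alg_entry[OF cl[OF X]] mat_alg_entry[OF cl[OF Y]]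
          by (intro A.add.finprod_mono_neutral_cong_right) auto
        also have "\<dots> = (\<Oplus>\<^bsub>A\<^esub>k\<in>\<pi> ` {K \<in> S. \<rho> I = \<rho> K}. X (\<pi> I) k \<otimes>\<^bsub>A\<^esub> Y k (\<pi> J))"
          using bij[OF ij(1)] \<pi> ij XY
          by (intro A.finsum_reindex[symmetric]) (auto simp: bij_betw_def)
        also have "\<pi> ` {K \<in> S. \<rho> I = \<rho> K} = S\<^sub>0" using bij[OF ij(1)] by (simp add: bij_betw_def)
        finally show ?thesis using True ij \<pi> by (simp add: m)
      next
        case False
        then have "(?e X \<otimes>\<^bsub>mat_alg S A\<^esub> ?e Y) I J = (\<Oplus>\<^bsub>A\<^esub>K\<in>S. \<zero>\<^bsub>A\<^esub>)"
          using ij XY \<pi> unfolding mat_alg_simps(1)[OF ij] by (intro A.finsum_cong') (auto simp: m)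
        with False ij show ?thesis by simp
      qed
    qed (use X Y in \<open>auto intro!: cl\<close>)
    show "emb_mtx A S \<pi> \<rho> (X \<oplus>\<^bsub>mat_alg S\<^sub>0 A\<^esub> Y) = emb_mtx A S \<pi> \<rho> X \<oplus>\<^bsub>mat_alg S A\<^esub> emb_mtx A S \<pi> \<rho> Y"
      by (rule mat_alg_eqI[of _ S A]) (use X Y XY \<pi> in \<open>auto intro!: cl M.a_closed simp: m\<close>)
    show "emb_mtx A S \<pi> \<rho> (c \<odot>\<^bsub>mat_alg S\<^sub>0 A\<^esub> X) = c \<odot>\<^bsub>mat_alg S A\<^esub> emb_mtx A S \<pi> \<rho> X" for c
      by (rule mat_alg_eqI[of _ S A]) (use X XY \<pi> in \<open>auto intro!: cl M.smult_closed simp: m\<close>)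
  next
    show "emb_mtx A S \<pi> \<rho> \<one>\<^bsub>mat_alg S\<^sub>0 A\<^esub> = \<one>\<^bsub>mat_alg S A\<^esub>"
      by (rule mat_alg_eqI[of _ S A]) (use \<pi> inj in \<open>auto intro!: cl simp: m\<close>)
  qed (auto intro: cl)
qed

text \<open>Forward substitution, which needs only invertible diagonal entries and works without
  commutativity. The shape and the diagonal of the solution are recorded so that the lemma can be
  applied to the solution itself.\<close>

lemma lower_triangular_right_inverse:
  fixes n :: nat
  assumes "calg A" and L: "L \<in> carrier (mat_alg {1..n} A)"
    and low: "\<And>i j. i \<in> {1..n} \<Longrightarrow> j \<in> {1..n} \<Longrightarrow> i < j \<Longrightarrow> L i j = \<zero>\<^bsub>A\<^esub>"
    and diag: "\<And>i. i \<in> {1..n} \<Longrightarrow> u i \<in> carrier A \<and> L i i \<otimes>\<^bsub>A\<^esub> u i = \<one>\<^bsub>A\<^esub> \<and> u i \<otimes>\<^bsub>A\<^esub> L i i = \<one>\<^bsub>A\<^esub>"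
  shows "\<exists>V \<in> carrier (mat_alg {1..n} A). L \<otimes>\<^bsub>mat_alg {1..n} A\<^esub> V = \<one>\<^bsub>mat_alg {1..n} A\<^esub>
    \<and> (\<forall>i\<in>{1..n}. \<forall>j\<in>{1..n}. i < j \<longrightarrow> V i j = \<zero>\<^bsub>A\<^esub>) \<and> (\<forall>i\<in>{1..n}. V i i = u i)"
proof -
  interpret A: calg A by fact
  let ?S = "{1..n}"
  \<comment> \<open>Row i of L V = 1 solved for the entry of V in row i and column j, with
    \<open>u i\<close> undoing the diagonal entry from the left.\<close>
  define step where "step = (\<lambda>v i j. u i \<otimes>\<^bsub>A\<^esub> ((if i = j then \<one>\<^bsub>A\<^esub> else \<zero>\<^bsub>A\<^esub>) \<ominus>\<^bsub>A\<^esub> (\<Oplus>\<^bsub>A\<^esub>k\<in>{1..<i}. L i k \<otimes>\<^bsub>A\<^esub> v k j)))"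
  \<comment> \<open>As \<open>step\<close> reads earlier rows only, a fixed point can be built row
    by row.\<close>
  have "\<exists>v. (\<forall>i\<in>{1..l}. \<forall>j\<in>?S. v i j \<in> carrier A \<and> v i j = step v i j)" if "l \<le> n" for l
    using that
  proof (induction l)
    case (Suc l)
    then obtain v where v: "\<And>i j. i \<in> {1..l} \<Longrightarrow> j \<in> ?S \<Longrightarrow> v i j \<in> carrier A \<and> v i j = step v i j" by (meson Suc_leD)
    have vc: "\<And>i j. i \<in> {1..l} \<Longrightarrow> j \<in> ?S \<Longrightarrow> v i j \<in> carrier A" using v by blast
    define w where "w = (\<lambda>i j. if i \<le> l then v i j else step v i j)"
    have "step w i j = step v i j" if "i \<in> {1..Suc l}" "j \<in> ?S" for i j
      using that vc mat_alg_entry[OF L] Suc.prems unfolding step_def w_def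
      by (intro arg_cong[where f = "\<lambda>x. u i \<otimes>\<^bsub>A\<^esub> (_ \<ominus>\<^bsub>A\<^esub> x)"] A.finsum_cong') auto
    moreover have "step v (Suc l) j \<in> carrier A" if "j \<in> ?S" for j
      using that vc mat_alg_entry[OF L] Suc.prems diag
      by (auto simp: step_def intro!: A.minus_closed A.m_closed A.finsum_closed)
    ultimately have "w i j \<in> carrier A \<and> w i j = step w i j" if "i \<in> {1..Suc l}" "j \<in> ?S" for i j
      using that v[of i j] by (cases "i = Suc l") (auto simp: w_def)
    then show ?case by blast
  qed simp
  from this[of n] obtain v where "\<forall>i\<in>?S. \<forall>j\<in>?S. v i j \<in> carrier A \<and> v i j = step v i j"
    by blast
  then have v: "\<And>i j. i \<in> ?S \<Longrightarrow> j \<in> ?S \<Longrightarrow> v i j \<in> carrier A"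
      "\<And>i j. i \<in> ?S \<Longrightarrow> j \<in> ?S \<Longrightarrow> v i j = step v i j"
    by blast+
  have low': "v i j = \<zero>\<^bsub>A\<^esub>" if "i \<in> ?S" "j \<in> ?S" "i < j" for i j
    using that
  proof (induction i rule: less_induct)
    case (less i)
    have "(\<Oplus>\<^bsub>A\<^esub>k\<in>{1..<i}. L i k \<otimes>\<^bsub>A\<^esub> v k j) = (\<Oplus>\<^bsub>A\<^esub>k\<in>{1..<i}. \<zero>\<^bsub>A\<^esub>)"
      using less mat_alg_entry[OF L] by (intro A.finsum_cong') auto
    then show ?case using less v(2)[of i j] diag[of i] by (simp add: step_def a_minus_def)
  qed
  have diag': "v i i = u i" if "i \<in> ?S" for i
  proof -
    have "(\<Oplus>\<^bsub>A\<^esub>k\<in>{1..<i}. L i k \<otimes>\<^bsub>A\<^esub> v k i) = (\<Oplus>\<^bsub>A\<^esub>k\<in>{1..<i}. \<zero>\<^bsub>A\<^esub>)"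
      using that mat_alg_entry[OF L] by (intro A.finsum_cong') (auto simp: low')
    then show ?thesis using that v(2)[of i i] diag[of i] by (simp add: step_def a_minus_def)
  qed
  have prod: "(\<Oplus>\<^bsub>A\<^esub>k\<in>?S. L i k \<otimes>\<^bsub>A\<^esub> v k j) = (if i = j then \<one>\<^bsub>A\<^esub> else \<zero>\<^bsub>A\<^esub>)" if ij: "i \<in> ?S" "j \<in> ?S" for i j
  proof -
    define s where "s = (\<Oplus>\<^bsub>A\<^esub>k\<in>{1..<i}. L i k \<otimes>\<^bsub>A\<^esub> v k j)"
    define d where "d = (if i = j then \<one>\<^bsub>A\<^esub> else \<zero>\<^bsub>A\<^esub>)"
    have s: "s \<in> carrier A" "d \<in> carrier A" using ij v mat_alg_entry[OF L] by (auto simp: s_def d_def intro!: A.finsum_closed)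
    have Lu: "u i \<in> carrier A" "L i i \<in> carrier A" "L i i \<otimes>\<^bsub>A\<^esub> u i = \<one>\<^bsub>A\<^esub>" using diag ij mat_alg_entry[OF L] by auto
    \<comment> \<open>The terms with k > i vanish because L is lower triangular; the diagonal term
      is split off, and \<open>step\<close> was chosen to make it compensate the others.\<close>
    have "(\<Oplus>\<^bsub>A\<^esub>k\<in>?S. L i k \<otimes>\<^bsub>A\<^esub> v k j) = (\<Oplus>\<^bsub>A\<^esub>k\<in>insert i {1..<i}. L i k \<otimes>\<^bsub>A\<^esub> v k j)"
      using ij v mat_alg_entry[OF L] low
      by (intro A.add.finprod_mono_neutral_cong_right) auto
    also have "\<dots> = L i i \<otimes>\<^bsub>A\<^esub> v i j \<oplus>\<^bsub>A\<^esub> s"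
      using ij v mat_alg_entry[OF L] unfolding s_def by (intro A.finsum_insert) auto
    also have "v i j = u i \<otimes>\<^bsub>A\<^esub> (d \<ominus>\<^bsub>A\<^esub> s)"
      using v(2)[OF ij] by (simp add: step_def s_def d_def)
    also have "L i i \<otimes>\<^bsub>A\<^esub> (u i \<otimes>\<^bsub>A\<^esub> (d \<ominus>\<^bsub>A\<^esub> s)) = d \<ominus>\<^bsub>A\<^esub> s"
      using Lu s by (simp flip: A.m_assoc)
    also have "d \<ominus>\<^bsub>A\<^esub> s \<oplus>\<^bsub>A\<^esub> s = d"
      using s by (simp add: a_minus_def A.a_assoc A.l_neg)
    finally show ?thesis by (simp add: d_def)
  qed
  let ?V = "\<lambda>i\<in>?S. \<lambda>j\<in>?S. v i j"
  interpret M: calg "mat_alg ?S A" by (rule calg_mat_alg) (use assms in auto)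
  have V: "?V \<in> carrier (mat_alg ?S A)" using v by (intro mat_alg_restrictI) auto
  have "L \<otimes>\<^bsub>mat_alg ?S A\<^esub> ?V = \<one>\<^bsub>mat_alg ?S A\<^esub>"
  proof (rule mat_alg_eqI[of _ ?S A])
    fix i j assume ij: "i \<in> ?S" "j \<in> ?S"
    then have "(L \<otimes>\<^bsub>mat_alg ?S A\<^esub> ?V) i j = (\<Oplus>\<^bsub>A\<^esub>k\<in>?S. L i k \<otimes>\<^bsub>A\<^esub> v k j)"
      unfolding mat_alg_simps(1)[OF ij] using v mat_alg_entry[OF L] by (intro A.finsum_cong') auto
    then show "(L \<otimes>\<^bsub>mat_alg ?S A\<^esub> ?V) i j = \<one>\<^bsub>mat_alg ?S A\<^esub> i j"
      unfolding mat_alg_simps(2)[OF ij] prod[OF ij] .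
  qed (intro M.m_closed M.one_closed L V)+
  with V low' diag' show ?thesis by (intro bexI[of _ ?V]) auto
qed

text \<open>The right inverse V of L is again lower triangular with invertible diagonal, so it has a
  right inverse Z. Associativity gives Z = L, and V is a two-sided inverse.\<close>

lemma lower_triangular_unit:
  fixes n :: nat
  assumes "calg A" and L: "L \<in> carrier (mat_alg {1..n} A)"
    and low: "\<And>i j. i \<in> {1..n} \<Longrightarrow> j \<in> {1..n} \<Longrightarrow> i < j \<Longrightarrow> L i j = \<zero>\<^bsub>A\<^esub>"
    and diag: "\<And>i. i \<in> {1..n} \<Longrightarrow> u i \<in> carrier A \<and> L i i \<otimes>\<^bsub>A\<^esub> u i = \<one>\<^bsub>A\<^esub> \<and> u i \<otimes>\<^bsub>A\<^esub> L i i = \<one>\<^bsub>A\<^esub>"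
  shows "L \<in> Units (mat_alg {1..n} A)"
proof -
  note [simp del] = One_nat_def
  let ?M = "mat_alg {1..n} A"
  interpret M: calg ?M by (rule calg_mat_alg) (use assms in auto)
  obtain V where V: "V \<in> carrier ?M" "L \<otimes>\<^bsub>?M\<^esub> V = \<one>\<^bsub>?M\<^esub>"
      "\<And>i j. i \<in> {1..n} \<Longrightarrow> j \<in> {1..n} \<Longrightarrow> i < j \<Longrightarrow> V i j = \<zero>\<^bsub>A\<^esub>" "\<And>i. i \<in> {1..n} \<Longrightarrow> V i i = u i"
    using lower_triangular_right_inverse[OF assms] by blast
  have "\<exists>Z \<in> carrier ?M. V \<otimes>\<^bsub>?M\<^esub> Z = \<one>\<^bsub>?M\<^esub>"
    using lower_triangular_right_inverse[OF assms(1) V(1,3), of "\<lambda>i. L i i"] diag V(4) mat_alg_entry[OF L]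
    by auto
  then obtain Z where Z: "Z \<in> carrier ?M" "V \<otimes>\<^bsub>?M\<^esub> Z = \<one>\<^bsub>?M\<^esub>" by blast
  have "Z = (L \<otimes>\<^bsub>?M\<^esub> V) \<otimes>\<^bsub>?M\<^esub> Z" using V Z by simp
  also have "\<dots> = L" using V(1) Z L by (simp add: M.m_assoc del: V(2))
  finally show ?thesis using V Z L by (auto simp: Units_def)
qed

section \<open>The R-matrix on tensor powers\<close>

lemma finite_tidx [simp]: "finite (tidx n m)"
  using finite_lists_length_eq[of "{1..n}" m] by (simp add: tidx_def conj_commute)

lemma calg_tens: "calg A \<Longrightarrow> calg (tens n m A)"
  unfolding tens_def by (rule calg_mat_alg) simp_all

lemmas tens_simps = mat_alg_simps[where S = "tidx n m" for n m, folded tens_def]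
lemmas tens_entry = mat_alg_entry[where S = "tidx n m" for n m, folded tens_def]
lemmas tens_eqI = mat_alg_eqI[where S = "tidx n m" for n m, folded tens_def]
lemmas tens_map_hom = map_mtx_hom[where S = "tidx n m" for n m, folded tens_def, OF _ _ _ finite_tidx]

lemma tidx_nth: "I \<in> tidx n m \<Longrightarrow> i < m \<Longrightarrow> I ! i \<in> {1..n}"
  unfolding tidx_def using nth_mem[of i I] by blast

lemma tidx_update: "I \<in> tidx n m \<Longrightarrow> x \<in> {1..n} \<Longrightarrow> I[i := x] \<in> tidx n m"
  using set_update_subset_insert[of I i x] by (auto simp: tidx_def)

lemma base_change_hom:
  assumes "calg A"
  shows "base_change A n m \<in> alg_hom (tens n m complex_alg) (tens n m A)"
proof -
  interpret A: calg A by fact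
  have "(\<lambda>c. c \<odot>\<^bsub>A\<^esub> \<one>\<^bsub>A\<^esub>) \<in> alg_hom complex_alg A"
    by (rule alg_homI) (simp_all add: A.smult_mult_left A.smult_smult A.smult_add_left)
  then show ?thesis
    unfolding base_change_def by (intro tens_map_hom calg_complex_alg assms)
qed

lemma map_base_change:
  assumes "calg A" "f \<in> alg_hom A B"
  shows "map_mtx (tidx n m) f (base_change A n m X) = base_change B n m X"
  unfolding base_change_def map_mtx_def
  by (intro restrict_ext) (simp add: alg_hom_smult_one[OF assms])

lemma map_place:
  assumes "f \<zero>\<^bsub>A\<^esub> = \<zero>\<^bsub>B\<^esub>" "1 \<le> a" "a \<le> m"
  shows "map_mtx (tidx n m) f (place A n m a X) = place B n m a (map_mtx {1..n} f X)"
proof -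
  have "I ! (a - 1) \<in> {1..n}" if "I \<in> tidx n m" for I
    using assms that by (intro tidx_nth[of I n m]) auto
  then show ?thesis
    unfolding place_def map_mtx_def[of "tidx n m"]
    by (intro restrict_ext) (simp add: assms del: atLeastAtMost_iff)
qed

text \<open>Puts the first-factor placement into the form to which \<open>emb_mtx_hom\<close>
  applies: the head of an index is the matrix index, the tail labels the fibre.\<close>

lemma place_first:
  "place A n m 1 X = emb_mtx A (tidx n m) (\<lambda>I. I ! 0) tl X"
proof -
  have eq: "(\<forall>b\<in>{1..m} - {1}. I ! (b - 1) = J ! (b - 1)) \<longleftrightarrow> tl I = tl J"
    if "I \<in> tidx n m" "J \<in> tidx n m" for I J
  proof -
    have "tl I = tl J \<longleftrightarrow> (\<forall>i<m - 1. I ! Suc i = J ! Suc i)"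
      using that by (auto simp: list_eq_iff_nth_eq tidx_def nth_tl)
    also have "\<dots> \<longleftrightarrow> (\<forall>b\<in>{1..m} - {1}. I ! (b - 1) = J ! (b - 1))" (is "?l \<longleftrightarrow> ?r")
    proof
      assume ?l
      show ?r
      proof
        fix b assume "b \<in> {1..m} - {1}"
        then have "b - 2 < m - 1" "b - 1 = Suc (b - 2)" by auto
        with \<open>?l\<close> show "I ! (b - 1) = J ! (b - 1)" by auto
      qed
    next
      assume ?r
      show ?l
      proof (intro allI impI)
        fix i assume "i < m - 1"
        with \<open>?r\<close>[rule_format, of "Suc (Suc i)"] show "I ! Suc i = J ! Suc i" by auto
      qed
    qed
    finally show ?thesis by blast
  qed
  show ?thesis
    unfolding place_def emb_mtx_def by (intro restrict_ext) (simp only: eq diff_self_eq_0)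
qed

lemma place_hom:
  assumes "calg A" "1 \<le> m"
  shows "place A n m 1 \<in> alg_hom (mat_alg {1..n} A) (tens n m A)"
proof -
  have "place A n m 1 = emb_mtx A (tidx n m) (\<lambda>I. I ! 0) tl"
    using place_first by blast
  moreover have "emb_mtx A (tidx n m) (\<lambda>I. I ! 0) tl \<in> alg_hom (mat_alg {1..n} A) (tens n m A)"
    unfolding tens_def
  proof (rule emb_mtx_hom)
    fix I assume I: "I \<in> tidx n m"
    show "bij_betw (\<lambda>I. I ! 0) {K \<in> tidx n m. tl I = tl K} {1..n}"
    proof (rule bij_betwI[where g = "\<lambda>x. x # tl I"])
      show "(\<lambda>x. x # tl I) \<in> {1..n} \<rightarrow> {K \<in> tidx n m. tl I = tl K}"
        using I assms(2) by (cases I) (auto simp: tidx_def)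
    qed (use assms(2) in \<open>auto simp: tidx_def neq_Nil_conv Suc_le_length_iff\<close>)
  qed (use assms in auto)
  ultimately show ?thesis by simp
qed

section \<open>Entries of the braided R-matrix\<close>

definition swap_at :: "nat \<Rightarrow> nat list \<Rightarrow> nat list" where
  "swap_at k I = I[k - 1 := I ! k, k := I ! (k - 1)]"

text \<open>Diagonal coefficient of PR: row [a, b] of PR is supported on the columns [a, b] and
  [b, a], with coefficients \<open>Ra q a b\<close> and \<open>Rb a b\<close>.\<close>

definition Ra :: "complex \<Rightarrow> nat \<Rightarrow> nat \<Rightarrow> complex" where
  "Ra q a b = (if a = b then q else if b < a then q - inverse q else 0)"

text \<open>Zero for a = b, where both columns coincide and the diagonal coefficient already is the
  whole entry.\<close>

definition Rb :: "nat \<Rightarrow> nat \<Rightarrow> complex" where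
  "Rb a b = (if a = b then 0 else 1)"

lemma tidx_2: "[a, b] \<in> tidx n 2 \<longleftrightarrow> a \<in> {1..n} \<and> b \<in> {1..n}"
  by (auto simp: tidx_def)

lemma tidx_2E:
  assumes "K \<in> tidx n 2"
  obtains a b where "K = [a, b]" "a \<in> {1..n}" "b \<in> {1..n}"
  using assms by (auto simp: tidx_def numeral_2_eq_2 length_Suc_conv)

lemma Pmat_entry:
  assumes "a \<in> {1..n}" "b \<in> {1..n}" "c \<in> {1..n}" "d \<in> {1..n}"
  shows "Pmat n [a, b] [c, d] = (if a = d \<and> b = c then 1 else 0)"
proof -
  have "Pmat n [a, b] [c, d] = (\<Sum>i=1..n. \<Sum>j=1..n. (if a = i \<and> c = j then 1 else 0) * (if b = j \<and> d = i then 1 else 0))"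
    using assms by (simp add: Pmat_def tidx_2 mat_unit_def tensor2_def)
  also have "\<dots> = (\<Sum>i=1..n. \<Sum>j=1..n. if j = c then (if i = a then (if b = c \<and> d = a then 1 else 0) else 0) else 0)"
    by (intro sum.cong refl) auto
  also have "\<dots> = (if a = d \<and> b = c then 1 else 0)"
    using assms by (auto simp: sum.delta)
  finally show ?thesis .
qed

lemma Rmat_entry:
  assumes "a \<in> {1..n}" "b \<in> {1..n}" "c \<in> {1..n}" "d \<in> {1..n}"
  shows "Rmat n q [a, b] [c, d] = (if a = c \<and> b = d then (if a = b then q else 1) else 0)
    + (if a = d \<and> b = c \<and> a < b then q - inverse q else 0)"
proof -
  have 1: "(\<Sum>i=1..n. (mat_unit i i \<boxtimes> mat_unit i i) [a, b] [c, d]) = (if a = b \<and> b = c \<and> c = d then 1 else 0)"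
  proof -
    have "(\<Sum>i=1..n. (mat_unit i i \<boxtimes> mat_unit i i) [a, b] [c, d])
        = (\<Sum>i=1..n. if i = a then (if a = b \<and> b = c \<and> c = d then 1 else 0) else 0)"
      by (intro sum.cong refl) (auto simp: mat_unit_def tensor2_def)
    then show ?thesis using assms by simp
  qed
  have 2: "(\<Sum>i=1..n. \<Sum>j\<in>{1..n} - {i}. (mat_unit i i \<boxtimes> mat_unit j j) [a, b] [c, d]) = (if a = c \<and> b = d \<and> a \<noteq> b then 1 else 0)"
  proof -
    have "(\<Sum>i=1..n. \<Sum>j\<in>{1..n} - {i}. (mat_unit i i \<boxtimes> mat_unit j j) [a, b] [c, d])
        = (\<Sum>i=1..n. \<Sum>j\<in>{1..n} - {i}. if j = b then (if i = a then (if a = c \<and> b = d then 1 else 0) else 0) else 0)"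
      by (intro sum.cong refl) (auto simp: mat_unit_def tensor2_def)
    also have "\<dots> = (\<Sum>i=1..n. if i = a then (if a = c \<and> b = d \<and> a \<noteq> b then 1 else 0) else 0)"
      using assms by (intro sum.cong refl) (auto simp: sum.delta)
    finally show ?thesis using assms by simp
  qed
  have 3: "(\<Sum>i=1..n. \<Sum>j\<in>{i<..n}. (mat_unit i j \<boxtimes> mat_unit j i) [a, b] [c, d]) = (if a = d \<and> b = c \<and> a < b then 1 else 0)"
  proof -
    have "(\<Sum>i=1..n. \<Sum>j\<in>{i<..n}. (mat_unit i j \<boxtimes> mat_unit j i) [a, b] [c, d])
        = (\<Sum>i=1..n. \<Sum>j\<in>{i<..n}. if j = b then (if i = a then (if a = d \<and> b = c then 1 else 0) else 0) else 0)"
      by (intro sum.cong refl) (auto simp: mat_unit_def tensor2_def)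
    also have "\<dots> = (\<Sum>i=1..n. if i = a then (if a = d \<and> b = c \<and> a < b then 1 else 0) else 0)"
      using assms by (intro sum.cong refl) (auto simp: sum.delta)
    finally show ?thesis using assms by simp
  qed
  have "[a, b] \<in> tidx n 2" "[c, d] \<in> tidx n 2" using assms by (simp_all add: tidx_2)
  then have "Rmat n q [a, b] [c, d] = q * (if a = b \<and> b = c \<and> c = d then 1 else 0)
      + (if a = c \<and> b = d \<and> a \<noteq> b then 1 else 0) + (q - inverse q) * (if a = d \<and> b = c \<and> a < b then 1 else 0)"
    by (simp only: Rmat_def restrict_apply if_True 1 2 3)
  then show ?thesis
    using [[linarith_neq_limit = 0]] by (auto split: if_splits)
qed

lemma finsum_complex_alg: "(\<Oplus>\<^bsub>complex_alg\<^esub>i\<in>I. f i) = sum f I"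
proof -
  interpret calg complex_alg by (rule calg_complex_alg)
  show ?thesis
    by (induction I rule: infinite_finite_induct) (simp_all add: finsum_infinite)
qed

lemma Rcheck_entry:
  assumes "a \<in> {1..n}" "b \<in> {1..n}" "c \<in> {1..n}" "d \<in> {1..n}"
  shows "Rcheck n q [a, b] [c, d] = (if c = a \<and> d = b then Ra q a b else 0) + (if c = b \<and> d = a then Rb a b else 0)"
proof -
  have "Rcheck n q [a, b] [c, d] = (\<Sum>K\<in>tidx n 2. Pmat n [a, b] K * Rmat n q K [c, d])"
    using assms by (simp add: Rcheck_def tens_simps tidx_2 finsum_complex_alg)
  \<comment> \<open>Row [a, b] of the permutation matrix has its single nonzero entry in column
    [b, a].\<close>
  also have "\<dots> = (\<Sum>K\<in>tidx n 2. if K = [b, a] then Rmat n q [b, a] [c, d] else 0)"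
    using assms by (intro sum.cong refl) (auto elim!: tidx_2E simp: Pmat_entry split: if_splits)
  also have "\<dots> = Rmat n q [b, a] [c, d]"
    using assms by (simp add: tidx_2)
  finally have eq: "Rcheck n q [a, b] [c, d] = Rmat n q [b, a] [c, d]" .
  show ?thesis
    unfolding eq Rmat_entry[OF assms(2,1,3,4)] Ra_def Rb_def
    by (rule linorder_cases[of a b]; cases "c = a"; cases "c = b"; cases "d = a"; cases "d = b"; simp)
qed

lemma nth_eq_except:
  assumes "length I = m" "length J = m" "1 \<le> k" "k < m"
  shows "I = J \<longleftrightarrow> (\<forall>b\<in>{1..m} - {k, k + 1}. I ! (b - 1) = J ! (b - 1)) \<and> I ! (k - 1) = J ! (k - 1) \<and> I ! k = J ! k"
proof
  assume *: "(\<forall>b\<in>{1..m} - {k, k + 1}. I ! (b - 1) = J ! (b - 1)) \<and> I ! (k - 1) = J ! (k - 1) \<and> I ! k = J ! k"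
  show "I = J"
  proof (rule nth_equalityI)
    fix i assume "i < length I"
    moreover have "I ! i = J ! i" if "i \<noteq> k - 1" "i \<noteq> k"
      using *[THEN conjunct1, rule_format, of "Suc i"] that \<open>i < length I\<close> assms by auto
    ultimately show "I ! i = J ! i" using * by metis
  qed (use assms in simp)
qed auto

lemma tidx_length: "I \<in> tidx n m \<Longrightarrow> length I = m"
  by (simp add: tidx_def)

lemma swap_at_tidx: "I \<in> tidx n m \<Longrightarrow> 1 \<le> k \<Longrightarrow> k < m \<Longrightarrow> swap_at k I \<in> tidx n m"
  unfolding swap_at_def by (intro tidx_update tidx_nth[of I n m]) auto

text \<open>Agreement away from the positions k - 1 and k, combined with the values at these two,
  pins J down to I or its swap. Each row thus has at most two nonzero entries, and all relations of
  these operators are checked in this sparse form.\<close>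

lemma Rcheck_at_entry:
  assumes "1 \<le> k" "k < m" "I \<in> tidx n m" "J \<in> tidx n m"
  shows "Rcheck_at n q m k I J = (if J = I then Ra q (I ! (k - 1)) (I ! k) else 0)
    + (if J = swap_at k I then Rb (I ! (k - 1)) (I ! k) else 0)"
proof -
  let ?c = "\<forall>b\<in>{1..m} - {k, k + 1}. I ! (b - 1) = J ! (b - 1)"
  have eq: "J = I \<longleftrightarrow> ?c \<and> J ! (k - 1) = I ! (k - 1) \<and> J ! k = I ! k"
    using nth_eq_except[of J m I k] assms by (auto simp: tidx_length)
  have 1: "length (swap_at k I) = m" "swap_at k I ! (k - 1) = I ! k" "swap_at k I ! k = I ! (k - 1)"
      "\<And>b. b \<in> {1..m} - {k, k + 1} \<Longrightarrow> swap_at k I ! (b - 1) = I ! (b - 1)"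
    using assms by (auto simp: swap_at_def tidx_length nth_list_update)
  have eq': "J = swap_at k I \<longleftrightarrow> ?c \<and> J ! (k - 1) = I ! k \<and> J ! k = I ! (k - 1)"
  proof -
    have "(\<forall>b\<in>{1..m} - {k, k + 1}. J ! (b - 1) = swap_at k I ! (b - 1)) \<longleftrightarrow> ?c"
      using 1(4) by metis
    then show ?thesis
      unfolding nth_eq_except[OF tidx_length[OF assms(4)] 1(1) assms(1,2)] 1(2,3) by blast
  qed
  have "I ! (k - 1) \<in> {1..n}" "I ! k \<in> {1..n}" "J ! (k - 1) \<in> {1..n}" "J ! k \<in> {1..n}"
    using assms by (intro tidx_nth[OF assms(3)] tidx_nth[OF assms(4)]; simp)+
  note R = Rcheck_entry[OF this]
  define c where "c = ?c"
  have "Rcheck_at n q m k I J = (if ?c then Rcheck n q [I ! (k - 1), I ! k] [J ! (k - 1), J ! k] else 0)"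
    by (simp only: Rcheck_at_def place2_def restrict_apply assms(3,4) if_True)
  then show ?thesis
    unfolding R eq eq' c_def[symmetric] by (cases c) (simp_all only: simp_thms if_True if_False add_0)
qed

lemma swap_at_swap_at: "1 \<le> k \<Longrightarrow> k < length I \<Longrightarrow> swap_at k (swap_at k I) = I"
  by (auto simp: swap_at_def nth_list_update list_eq_iff_nth_eq)

lemma swap_at_nth:
  assumes "1 \<le> k" "k < length I"
  shows "swap_at k I ! (k - 1) = I ! k" "swap_at k I ! k = I ! (k - 1)"
    "i \<noteq> k - 1 \<Longrightarrow> i \<noteq> k \<Longrightarrow> swap_at k I ! i = I ! i" "length (swap_at k I) = length I"
  using assms by (auto simp: swap_at_def nth_list_update)

text \<open>The swap is an involution and \<open>Rb\<close> is symmetric. Symmetry allows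
  multiplication on the right to be computed from rows as well, as in \<open>Rk_col\<close>.\<close>

lemma Rcheck_at_sym:
  assumes "1 \<le> k" "k < m" "I \<in> tidx n m" "J \<in> tidx n m"
  shows "Rcheck_at n q m k I J = Rcheck_at n q m k J I"
proof -
  have len: "k < length I" "k < length J" using assms by (simp_all add: tidx_length)
  show ?thesis
  proof (cases "J = swap_at k I \<and> J \<noteq> I")
    case True
    then have "I = swap_at k J" using swap_at_swap_at[of k I] assms len by simp
    then show ?thesis
      unfolding Rcheck_at_entry[OF assms] Rcheck_at_entry[OF assms(1,2,4,3)]
      using True swap_at_nth[OF assms(1) len(1)] by (auto simp: Rb_def)
  next
    case False
    then have "I = swap_at k J \<longrightarrow> I = J" using swap_at_swap_at[of k J] assms len by auto
    then show ?thesis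
      unfolding Rcheck_at_entry[OF assms] Rcheck_at_entry[OF assms(1,2,4,3)]
      using False by auto
  qed
qed

lemma Rcheck_at_closed: "Rcheck_at n q m k \<in> carrier (tens n m complex_alg)"
  unfolding Rcheck_at_def place2_def tens_def by (rule mat_alg_restrictI) simp

lemma Rk_closed: "calg A \<Longrightarrow> Rk A n q m k \<in> carrier (tens n m A)"
  unfolding Rk_def by (intro alg_homD(1)[OF base_change_hom] Rcheck_at_closed)

section \<open>Multiplication by the R-matrix on either side\<close>

context calg
begin

text \<open>The coefficient is a sum of two conditionals, so that the formula stays correct when i =
  j. This happens for an index fixed by the swap.\<close>

lemma finsum_two_delta:
  assumes "finite S" "i \<in> S" "j \<in> S" "\<And>k. k \<in> S \<Longrightarrow> f k \<in> carrier B"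
  shows "(\<Oplus>k\<in>S. ((if k = i then c else 0) + (if k = j then d else 0)) \<odot> f k) = c \<odot> f i \<oplus> d \<odot> f j"
proof -
  have "(\<Oplus>k\<in>S. ((if k = i then c else 0) + (if k = j then d else 0)) \<odot> f k)
     = (\<Oplus>k\<in>S. (if k = i then c else 0) \<odot> f k \<oplus> (if k = j then d else 0) \<odot> f k)"
    using assms by (intro finsum_cong') (auto simp only: smult_add_left a_closed smult_closed Pi_iff)
  also have "\<dots> = (\<Oplus>k\<in>S. (if k = i then c else 0) \<odot> f k) \<oplus> (\<Oplus>k\<in>S. (if k = j then d else 0) \<odot> f k)"
    using assms by (intro finsum_addf) auto
  also have "(\<Oplus>k\<in>S. (if k = i then c else 0) \<odot> f k) = c \<odot> f i"
    using assms by (intro finsum_delta[of S i]) auto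
  also have "(\<Oplus>k\<in>S. (if k = j then d else 0) \<odot> f k) = d \<odot> f j"
    using assms by (intro finsum_delta[of S j]) auto
  finally show ?thesis .
qed

lemma Rk_row:
  assumes "1 \<le> k" "k < m" "I \<in> tidx n m" "J \<in> tidx n m" "Y \<in> carrier (tens n m B)"
  shows "(Rk B n q m k \<otimes>\<^bsub>tens n m B\<^esub> Y) I J =
    Ra q (I ! (k - 1)) (I ! k) \<odot> Y I J \<oplus> Rb (I ! (k - 1)) (I ! k) \<odot> Y (swap_at k I) J"
proof -
  note Y = tens_entry[OF assms(5)]
  have "(Rk B n q m k \<otimes>\<^bsub>tens n m B\<^esub> Y) I J = (\<Oplus>K\<in>tidx n m. Rcheck_at n q m k I K \<odot> Y K J)"
    unfolding tens_simps(1)[OF assms(3,4)] using assms Y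
    by (intro finsum_cong') (auto simp: Rk_def base_change_def smult_mult_left)
  also have "\<dots> = (\<Oplus>K\<in>tidx n m. ((if K = I then Ra q (I ! (k - 1)) (I ! k) else 0)
    + (if K = swap_at k I then Rb (I ! (k - 1)) (I ! k) else 0)) \<odot> Y K J)"
    using assms Y by (intro finsum_cong') (auto simp: Rcheck_at_entry)
  also have "\<dots> = Ra q (I ! (k - 1)) (I ! k) \<odot> Y I J \<oplus> Rb (I ! (k - 1)) (I ! k) \<odot> Y (swap_at k I) J"
    using assms Y by (intro finsum_two_delta) (auto intro: swap_at_tidx)
  finally show ?thesis .
qed

lemma Rk_col:
  assumes "1 \<le> k" "k < m" "I \<in> tidx n m" "J \<in> tidx n m" "Y \<in> carrier (tens n m B)"
  shows "(Y \<otimes>\<^bsub>tens n m B\<^esub> Rk B n q m k) I J =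
    Ra q (J ! (k - 1)) (J ! k) \<odot> Y I J \<oplus> Rb (J ! (k - 1)) (J ! k) \<odot> Y I (swap_at k J)"
proof -
  note Y = tens_entry[OF assms(5)]
  have "(Y \<otimes>\<^bsub>tens n m B\<^esub> Rk B n q m k) I J = (\<Oplus>K\<in>tidx n m. Rcheck_at n q m k J K \<odot> Y I K)"
    unfolding tens_simps(1)[OF assms(3,4)] using assms Y
    by (intro finsum_cong') (auto simp: Rk_def base_change_def smult_mult_right Rcheck_at_sym[of k m J])
  also have "\<dots> = (\<Oplus>K\<in>tidx n m. ((if K = J then Ra q (J ! (k - 1)) (J ! k) else 0)
    + (if K = swap_at k J then Rb (J ! (k - 1)) (J ! k) else 0)) \<odot> Y I K)"
    using assms Y by (intro finsum_cong') (auto simp: Rcheck_at_entry)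
  also have "\<dots> = Ra q (J ! (k - 1)) (J ! k) \<odot> Y I J \<oplus> Rb (J ! (k - 1)) (J ! k) \<odot> Y I (swap_at k J)"
    using assms Y by (intro finsum_two_delta) (auto intro: swap_at_tidx)
  finally show ?thesis .
qed

end

text \<open>The two matrices act in disjoint tensor factors. In entries: where the placed X is not
  forced to be zero, I and J agree beyond the first position, so the diagonal coefficients for I and
  for J coincide. For the other term, swapping the row index and swapping the column index lead to
  the same entry of X.\<close>

lemma Rk_place_commute:
  assumes "calg A" "X \<in> carrier (mat_alg {1..n} A)" "2 \<le> k" "k < m"
  shows "commutes (tens n m A) (Rk A n q m k) (place A n m 1 X)"
proof -
  interpret A: calg A by fact
  interpret T: calg "tens n m A" by (intro calg_tens assms)
  let ?X = "place A n m 1 X"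
  have k: "1 \<le> k" using assms by simp
  have X: "?X \<in> carrier (tens n m A)"
    using assms by (intro alg_homD(1)[OF place_hom]) auto
  note R = Rk_closed[OF assms(1)]
  have "(Rk A n q m k \<otimes>\<^bsub>tens n m A\<^esub> ?X) I J = (?X \<otimes>\<^bsub>tens n m A\<^esub> Rk A n q m k) I J"
    if I: "I \<in> tidx n m" and J: "J \<in> tidx n m" for I J
  proof -
    let ?c = "\<lambda>I J. \<forall>b\<in>{1..m} - {1}. I ! (b - 1) = J ! (b - 1)"
    have sI: "swap_at k I \<in> tidx n m" and sJ: "swap_at k J \<in> tidx n m"
      using I J k assms swap_at_tidx by auto
    have len: "k < length I" "k < length J" using I J assms by (auto simp: tidx_length)
    have n1: "I ! 0 = swap_at k I ! 0" "J ! 0 = swap_at k J ! 0"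
      using swap_at_nth(3)[of k I 0] swap_at_nth(3)[of k J 0] len assms by auto
    have imp: "?c I (swap_at k J)" if "?c (swap_at k I) J" "I \<in> tidx n m" "J \<in> tidx n m" for I J
    proof
      fix b assume b: "b \<in> {1..m} - {1}"
      have len: "k < length I" "k < length J" using that assms by (auto simp: tidx_length)
      note s = swap_at_nth[OF k len(1)] swap_at_nth[OF k len(2)]
      consider "b = k" | "b = k + 1" | "b - 1 \<noteq> k - 1" "b - 1 \<noteq> k" using b by force
      then show "I ! (b - 1) = swap_at k J ! (b - 1)"
      proof cases
        case 1
        then show ?thesis using that(1)[rule_format, of "k + 1"] assms s by auto
      next
        case 2
        then show ?thesis using that(1)[rule_format, of k] assms s by auto
      next
        case 3
        then show ?thesis using that(1)[rule_format, of b] b s by metis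
      qed
    qed
    have c: "?c (swap_at k I) J \<longleftrightarrow> ?c I (swap_at k J)"
    proof
      assume "?c (swap_at k I) J"
      then show "?c I (swap_at k J)" using imp[of I J] I J by blast
    next
      assume "?c I (swap_at k J)"
      then have "?c (swap_at k J) I" by metis
      then have "?c J (swap_at k I)" using imp[of J I] I J by blast
      then show "?c (swap_at k I) J" by metis
    qed
    have d: "I ! (k - 1) = J ! (k - 1)" "I ! k = J ! k" if "?c I J"
      using that[rule_format, of k] that[rule_format, of "k + 1"] assms by auto
    have d': "Rb (I ! (k - 1)) (I ! k) = Rb (J ! (k - 1)) (J ! k)" if "?c (swap_at k I) J"
      using that[rule_format, of k] that[rule_format, of "k + 1"] assms
        swap_at_nth[OF k len(1)] by (auto simp: Rb_def)
    have e: "?X I J = (if ?c I J then X (I ! 0) (J ! 0) else \<zero>\<^bsub>A\<^esub>)" if "I \<in> tidx n m" "J \<in> tidx n m" for I J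
      using that by (simp add: place_def)
    have t1: "Ra q (I ! (k - 1)) (I ! k) \<odot>\<^bsub>A\<^esub> ?X I J = Ra q (J ! (k - 1)) (J ! k) \<odot>\<^bsub>A\<^esub> ?X I J"
      unfolding e[OF I J] using d by auto
    have t2: "Rb (I ! (k - 1)) (I ! k) \<odot>\<^bsub>A\<^esub> ?X (swap_at k I) J = Rb (J ! (k - 1)) (J ! k) \<odot>\<^bsub>A\<^esub> ?X I (swap_at k J)"
      unfolding e[OF sI J] e[OF I sJ] c[symmetric] n1[symmetric] using d' by auto
    show ?thesis
      by (simp only: A.Rk_row[OF k assms(4) I J X] A.Rk_col[OF k assms(4) I J X] t1 t2)
  qed
  then show ?thesis
    unfolding commutes_def
    by (intro tens_eqI[of _ n m A] T.m_closed R X)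
qed

section \<open>Hecke relations for the scalar matrices\<close>

lemma Rk_complex: "Rk complex_alg n q m k = Rcheck_at n q m k"
  unfolding Rk_def base_change_def
  by (rule tens_eqI[OF _ Rcheck_at_closed]) (auto simp: map_mtx_def tens_def intro!: mat_alg_restrictI)

lemma Rcheck_at_row:
  assumes "1 \<le> k" "k < m" "I \<in> tidx n m" "J \<in> tidx n m" "Y \<in> carrier (tens n m complex_alg)"
  shows "(Rcheck_at n q m k \<otimes>\<^bsub>tens n m complex_alg\<^esub> Y) I J =
    Ra q (I ! (k - 1)) (I ! k) * Y I J + Rb (I ! (k - 1)) (I ! k) * Y (swap_at k I) J"
  using calg.Rk_row[OF calg_complex_alg assms, of q] by (simp add: Rk_complex)

text \<open>The quadratic relation split into its coefficients at the index itself and at its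
  swap.\<close>

lemma Ra_Rb:
  assumes "q \<noteq> 0"
  shows "Ra q a b * Ra q a b + Rb a b * Rb b a = (q - inverse q) * Ra q a b + 1"
    "Rb a b * (Ra q a b + Ra q b a) = (q - inverse q) * Rb a b"
  using assms by (auto simp: Ra_def Rb_def field_simps)

text \<open>With the conditions as factors 0 or 1, products of entries can be rearranged by ring
  laws without case distinctions.\<close>

lemma Rcheck_at_entry':
  assumes "1 \<le> k" "k < m" "I \<in> tidx n m" "J \<in> tidx n m"
  shows "Rcheck_at n q m k I J = Ra q (I ! (k - 1)) (I ! k) * (if J = I then 1 else 0)
    + Rb (I ! (k - 1)) (I ! k) * (if J = swap_at k I then 1 else 0)"
  unfolding Rcheck_at_entry[OF assms] by simp

lemma Rcheck_at_square:
  assumes "q \<noteq> 0" "1 \<le> k" "k < m"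
  shows "Rcheck_at n q m k \<otimes>\<^bsub>tens n m complex_alg\<^esub> Rcheck_at n q m k
    = (q - inverse q) \<odot>\<^bsub>tens n m complex_alg\<^esub> Rcheck_at n q m k \<oplus>\<^bsub>tens n m complex_alg\<^esub> \<one>\<^bsub>tens n m complex_alg\<^esub>"
proof -
  interpret T: calg "tens n m complex_alg" by (intro calg_tens calg_complex_alg)
  note R = Rcheck_at_closed[of n q m k]
  show ?thesis
  proof (rule tens_eqI[of _ n m complex_alg])
    fix I J assume I: "I \<in> tidx n m" and J: "J \<in> tidx n m"
    have sI: "swap_at k I \<in> tidx n m" using I assms swap_at_tidx by auto
    have len: "k < length I" using I assms by (simp add: tidx_length)
    note s = swap_at_nth[OF assms(2) len] swap_at_swap_at[OF assms(2) len]
    define a b where "a = I ! (k - 1)" "b = I ! k"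
    have "(Rcheck_at n q m k \<otimes>\<^bsub>tens n m complex_alg\<^esub> Rcheck_at n q m k) I J =
      (Ra q a b * Ra q a b + Rb a b * Rb b a) * (if J = I then 1 else 0)
      + (Rb a b * (Ra q a b + Ra q b a)) * (if J = swap_at k I then 1 else 0)"
      unfolding Rcheck_at_row[OF assms(2,3) I J R] Rcheck_at_entry'[OF assms(2,3) I J] Rcheck_at_entry'[OF assms(2,3) sI J] s
        a_b_def[symmetric]
      by (simp add: algebra_simps)
    also have "\<dots> = ((q - inverse q) \<odot>\<^bsub>tens n m complex_alg\<^esub> Rcheck_at n q m k \<oplus>\<^bsub>tens n m complex_alg\<^esub> \<one>\<^bsub>tens n m complex_alg\<^esub>) I J"
      unfolding Ra_Rb[OF assms(1)]
      using I J by (simp add: tens_simps Rcheck_at_entry'[OF assms(2,3) I J] a_b_def algebra_simps)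
    finally show "(Rcheck_at n q m k \<otimes>\<^bsub>tens n m complex_alg\<^esub> Rcheck_at n q m k) I J
      = ((q - inverse q) \<odot>\<^bsub>tens n m complex_alg\<^esub> Rcheck_at n q m k \<oplus>\<^bsub>tens n m complex_alg\<^esub> \<one>\<^bsub>tens n m complex_alg\<^esub>) I J" .
  qed (use R in auto)
qed

text \<open>The swaps at k and l move disjoint positions, so they commute, and neither changes the
  coefficients of the other.\<close>

lemma Rcheck_at_far:
  assumes "1 \<le> k" "k + 1 < l" "l < m"
  shows "commutes (tens n m complex_alg) (Rcheck_at n q m k) (Rcheck_at n q m l)"
proof -
  interpret T: calg "tens n m complex_alg" by (intro calg_tens calg_complex_alg)
  have kl: "k < m" "1 \<le> l" using assms by auto
  have "(Rcheck_at n q m k \<otimes>\<^bsub>tens n m complex_alg\<^esub> Rcheck_at n q m l) I J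
      = (Rcheck_at n q m l \<otimes>\<^bsub>tens n m complex_alg\<^esub> Rcheck_at n q m k) I J"
    if I: "I \<in> tidx n m" and J: "J \<in> tidx n m" for I J
  proof -
    have sI: "swap_at k I \<in> tidx n m" "swap_at l I \<in> tidx n m" using I assms swap_at_tidx by auto
    have len: "k < length I" "l < length I" using I assms by (simp_all add: tidx_length)
    have ss: "swap_at l (swap_at k I) = swap_at k (swap_at l I)"
      using assms len by (intro nth_equalityI) (auto simp: swap_at_def nth_list_update)
    have s: "swap_at k I ! l = I ! l" "swap_at k I ! (l - 1) = I ! (l - 1)"
      "swap_at l I ! k = I ! k" "swap_at l I ! (k - 1) = I ! (k - 1)"
      using assms len by (auto simp: swap_at_def nth_list_update)
    show ?thesis
      unfolding Rcheck_at_row[OF assms(1) kl(1) I J Rcheck_at_closed] Rcheck_at_row[OF kl(2) assms(3) I J Rcheck_at_closed]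
        Rcheck_at_entry'[OF assms(1) kl(1) I J] Rcheck_at_entry'[OF kl(2) assms(3) I J]
        Rcheck_at_entry'[OF assms(1) kl(1) sI(2) J] Rcheck_at_entry'[OF kl(2) assms(3) sI(1) J] s ss
      by (simp only: distrib_left mult_ac add_ac)
  qed
  then show ?thesis
    unfolding commutes_def
    by (intro tens_eqI[of _ n m complex_alg] T.m_closed Rcheck_at_closed)
qed

text \<open>The braid relation on three tensor factors, expanded by the two-term row formula;
  \<open>g\<close> holds the entries of an arbitrary vector at the permutations of (a, b, d). The
  coefficients depend only on the relative order of a, b, d, which leaves finitely many
  cases.\<close>

lemma Ra_Rb_braid:
  fixes g :: "nat \<Rightarrow> nat \<Rightarrow> nat \<Rightarrow> complex"
  assumes "q \<noteq> 0"
  shows "Ra q a b * (Ra q b d * (Ra q a b * g a b d + Rb a b * g b a d) + Rb b d * (Ra q a d * g a d b + Rb a d * g d a b))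
      + Rb a b * (Ra q a d * (Ra q b a * g b a d + Rb b a * g a b d) + Rb a d * (Ra q b d * g b d a + Rb b d * g d b a))
    = Ra q b d * (Ra q a b * (Ra q b d * g a b d + Rb b d * g a d b) + Rb a b * (Ra q a d * g b a d + Rb a d * g b d a))
      + Rb b d * (Ra q a d * (Ra q d b * g a d b + Rb d b * g a b d) + Rb a d * (Ra q a b * g d a b + Rb a b * g d b a))"
proof -
  define h where "h = q - inverse q"
  \<comment> \<open>With \<open>h\<close> kept as an opaque symbol, this relation replaces all
    calculation with the inverse of q; \<open>qqx\<close> is the same rule inside a longer
    product.\<close>
  have qq: "q * q = h * q + 1" using assms by (simp add: h_def field_simps)
  have qqx: "q * (q * x) = h * (q * x) + x" for x
    using arg_cong[OF qq, of "\<lambda>y. y * x"] by (simp add: algebra_simps)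
  show ?thesis
    by (rule linorder_cases[of a b]; rule linorder_cases[of b d]; rule linorder_cases[of a d];
        simp add: Ra_def Rb_def h_def[symmetric] algebra_simps qq qqx)
qed

lemma Rcheck_at_braid:
  fixes n m k :: nat and q :: complex
  assumes "q \<noteq> 0" "1 \<le> k" "k + 1 < m"
  defines "T \<equiv> tens n m complex_alg"
  shows "Rcheck_at n q m k \<otimes>\<^bsub>T\<^esub> Rcheck_at n q m (k + 1) \<otimes>\<^bsub>T\<^esub> Rcheck_at n q m k
    = Rcheck_at n q m (k + 1) \<otimes>\<^bsub>T\<^esub> Rcheck_at n q m k \<otimes>\<^bsub>T\<^esub> Rcheck_at n q m (k + 1)"
proof -
  interpret T: calg T unfolding T_def by (intro calg_tens calg_complex_alg)
  let ?r = "Rcheck_at n q m k" and ?s = "Rcheck_at n q m (k + 1)"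
  have c: "?r \<in> carrier T" "?s \<in> carrier T" unfolding T_def by (rule Rcheck_at_closed)+
  note [simp del] = One_nat_def
  have km: "k < m" "1 \<le> k + 1" using assms by auto
  \<comment> \<open>The identity matrix at the end gives each product the shape operator times
    matrix, so the row formula can be used three times.\<close>
  have "(?r \<otimes>\<^bsub>T\<^esub> (?s \<otimes>\<^bsub>T\<^esub> (?r \<otimes>\<^bsub>T\<^esub> \<one>\<^bsub>T\<^esub>))) I J = (?s \<otimes>\<^bsub>T\<^esub> (?r \<otimes>\<^bsub>T\<^esub> (?s \<otimes>\<^bsub>T\<^esub> \<one>\<^bsub>T\<^esub>))) I J"
    if I: "I \<in> tidx n m" and J: "J \<in> tidx n m" for I J
  proof -
    have len: "length I = m" using I by (simp add: tidx_length)
    \<comment> \<open>Both operators move only the three positions k - 1, k, k + 1 of an index.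
      Their rows therefore stay among the indices \<open>up x y z\<close>.\<close>
    define up where "up = (\<lambda>x y z. I[k - 1 := x, k := y, k + 1 := z])"
    define a b d where abd: "a = I ! (k - 1)" "b = I ! k" "d = I ! (k + 1)"
    have abd_in: "a \<in> {1..n}" "b \<in> {1..n}" "d \<in> {1..n}"
      unfolding abd using assms by (auto intro!: tidx_nth[OF I] simp del: atLeastAtMost_iff)
    have upI: "up a b d = I" by (simp add: up_def abd)
    have up_nth: "up x y z ! (k - 1) = x" "up x y z ! k = y" "up x y z ! (k + 1) = z"
      "up x y z ! (k + 1 - 1) = y" for x y z
      using assms len by (auto simp: up_def nth_list_update)
    have up_swap: "swap_at k (up x y z) = up y x z" "swap_at (k + 1) (up x y z) = up x z y" for x y z
      using assms len by (auto simp: swap_at_def up_def nth_list_update list_eq_iff_nth_eq)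
    have up_in: "up x y z \<in> tidx n m" if "x \<in> {1..n}" "y \<in> {1..n}" "z \<in> {1..n}" for x y z
      unfolding up_def using I that by (intro tidx_update)
    have row: "(?r \<otimes>\<^bsub>T\<^esub> Y) (up x y z) J = Ra q x y * Y (up x y z) J + Rb x y * Y (up y x z) J"
      "(?s \<otimes>\<^bsub>T\<^esub> Y) (up x y z) J = Ra q y z * Y (up x y z) J + Rb y z * Y (up x z y) J"
      if "x \<in> {1..n}" "y \<in> {1..n}" "z \<in> {1..n}" "Y \<in> carrier T" for x y z Y
      using Rcheck_at_row[OF assms(2) km(1) up_in[OF that(1-3)] J, of Y q]
        Rcheck_at_row[OF km(2) assms(3) up_in[OF that(1-3)] J, of Y q] that(4)
      unfolding T_def up_nth up_swap by auto
    have "(?r \<otimes>\<^bsub>T\<^esub> (?s \<otimes>\<^bsub>T\<^esub> (?r \<otimes>\<^bsub>T\<^esub> \<one>\<^bsub>T\<^esub>))) (up a b d) J = (?s \<otimes>\<^bsub>T\<^esub> (?r \<otimes>\<^bsub>T\<^esub> (?s \<otimes>\<^bsub>T\<^esub> \<one>\<^bsub>T\<^esub>))) (up a b d) J"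
      using abd_in c T.m_closed T.one_closed
      by (simp only: row) (rule Ra_Rb_braid[OF assms(1), of _ _ _ "\<lambda>x y z. \<one>\<^bsub>T\<^esub> (up x y z) J"])
    then show ?thesis unfolding upI .
  qed
  then have "?r \<otimes>\<^bsub>T\<^esub> (?s \<otimes>\<^bsub>T\<^esub> (?r \<otimes>\<^bsub>T\<^esub> \<one>\<^bsub>T\<^esub>)) = ?s \<otimes>\<^bsub>T\<^esub> (?r \<otimes>\<^bsub>T\<^esub> (?s \<otimes>\<^bsub>T\<^esub> \<one>\<^bsub>T\<^esub>))"
    unfolding T_def
    by (rule tens_eqI[rotated 2]) (use c T.m_closed T.one_closed in \<open>auto simp: T_def\<close>)
  then show ?thesis using c by (simp add: T.m_assoc)
qed

section \<open>The relations of the Weyl algebra on tensor powers\<close>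

text \<open>R R = h R + 1 rearranges to R (R - h) = 1, which exhibits the inverse.\<close>

lemma Rcheck_at_unit:
  assumes "q \<noteq> 0" "1 \<le> k" "k < m"
  shows "Rcheck_at n q m k \<in> Units (tens n m complex_alg)"
proof -
  let ?T = "tens n m complex_alg"
  interpret T: calg ?T by (intro calg_tens calg_complex_alg)
  define R where "R = Rcheck_at n q m k"
  define h where "h = q - inverse q"
  have R [simp]: "R \<in> carrier ?T" unfolding R_def by (rule Rcheck_at_closed)
  have sq: "R \<otimes>\<^bsub>?T\<^esub> R = \<one>\<^bsub>?T\<^esub> \<oplus>\<^bsub>?T\<^esub> h \<odot>\<^bsub>?T\<^esub> R"
    using Rcheck_at_square[OF assms, of n] by (simp add: T.a_comm R_def h_def Rcheck_at_closed)
  let ?S = "R \<ominus>\<^bsub>?T\<^esub> h \<odot>\<^bsub>?T\<^esub> \<one>\<^bsub>?T\<^esub>"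
  have "R \<otimes>\<^bsub>?T\<^esub> ?S = \<one>\<^bsub>?T\<^esub>" "?S \<otimes>\<^bsub>?T\<^esub> R = \<one>\<^bsub>?T\<^esub>"
    by (simp_all add: a_minus_def T.r_distr T.l_distr T.r_minus T.l_minus sq T.smult_mult_left
        T.smult_mult_right T.a_assoc T.r_neg)
  then show ?thesis
    unfolding R_def[symmetric] Units_def by (auto intro!: exI[of _ ?S])
qed

lemma Rk_inv:
  assumes "calg A" "q \<noteq> 0" "1 \<le> k" "k < m"
  shows "Rk_inv A n q m k \<in> carrier (tens n m A)"
    "Rk A n q m k \<otimes>\<^bsub>tens n m A\<^esub> Rk_inv A n q m k = \<one>\<^bsub>tens n m A\<^esub>"
    "Rk_inv A n q m k \<otimes>\<^bsub>tens n m A\<^esub> Rk A n q m k = \<one>\<^bsub>tens n m A\<^esub>"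
proof -
  let ?T = "tens n m complex_alg"
  interpret T: calg ?T by (intro calg_tens calg_complex_alg)
  note u = Rcheck_at_unit[OF assms(2-4), of n]
  note h = alg_homD[OF base_change_hom[OF assms(1), of n m]]
  show "Rk_inv A n q m k \<in> carrier (tens n m A)"
    "Rk A n q m k \<otimes>\<^bsub>tens n m A\<^esub> Rk_inv A n q m k = \<one>\<^bsub>tens n m A\<^esub>"
    "Rk_inv A n q m k \<otimes>\<^bsub>tens n m A\<^esub> Rk A n q m k = \<one>\<^bsub>tens n m A\<^esub>"
    using u T.Units_closed[OF u] unfolding Rk_def Rk_inv_def by (simp_all flip: h(2,4) add: h(1))
qed

text \<open>The relations are known for complex matrices, and \<open>base_change\<close> is an
  algebra homomorphism that carries them to any coefficient algebra.\<close>

lemma hecke_rep_Rk: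
  assumes "calg A" "q \<noteq> 0"
  shows "hecke_rep (tens n m A) m (q - inverse q) (Rk A n q m) (Rk_inv A n q m)"
proof -
  let ?C = "tens n m complex_alg" and ?T = "tens n m A"
  interpret C: calg ?C by (intro calg_tens calg_complex_alg)
  interpret T: calg ?T by (intro calg_tens assms)
  note c = Rcheck_at_closed[of n q m]
  note h = alg_homD[OF base_change_hom[OF assms(1), of n m]]
  show ?thesis
  proof (intro hecke_rep.intro hecke_rep_axioms.intro)
    show "calg ?T" by (rule T.calg_axioms)
  next
    fix k assume "k \<in> {1..<m}"
    then show "Rk A n q m k \<otimes>\<^bsub>?T\<^esub> Rk A n q m k = (q - inverse q) \<odot>\<^bsub>?T\<^esub> Rk A n q m k \<oplus>\<^bsub>?T\<^esub> \<one>\<^bsub>?T\<^esub>"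
      using Rcheck_at_square[OF assms(2), of k m n] c C.smult_closed[OF c]
      unfolding Rk_def by (simp flip: h(2-5))
  next
    fix k assume "k \<in> {1..<m}" "k + 1 \<in> {1..<m}"
    then show "Rk A n q m k \<otimes>\<^bsub>?T\<^esub> Rk A n q m (k + 1) \<otimes>\<^bsub>?T\<^esub> Rk A n q m k
      = Rk A n q m (k + 1) \<otimes>\<^bsub>?T\<^esub> Rk A n q m k \<otimes>\<^bsub>?T\<^esub> Rk A n q m (k + 1)"
      using Rcheck_at_braid[OF assms(2), of k m n] c C.m_closed[OF c c]
      unfolding Rk_def by (simp flip: h(2-5))
  next
    fix k l assume "k \<in> {1..<m}" "l \<in> {1..<m}" "k + 1 < l"
    then show "commutes ?T (Rk A n q m k) (Rk A n q m l)"
      using Rcheck_at_far[of k l m n q] c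
      unfolding Rk_def commutes_def by (simp flip: h(2-5))
  qed (use Rk_inv[OF assms] Rk_closed[OF assms(1)] in auto)
qed

section \<open>Recursive definitions compared with list products\<close>

lemma (in hecke_rep) ov_eq_lprod:
  assumes "x \<in> carrier B"
  shows "1 \<le> k \<Longrightarrow> k \<le> N \<Longrightarrow> ov k x = lprod B (map r (rev [1..<k]) @ [x] @ map r' [1..<k])"
proof (induction k rule: nat_induct_at_least)
  case base
  then show ?case using assms by (simp add: lprod_def)
next
  case (Suc k)
  let ?xs = "map r (rev [1..<k]) @ [x] @ map r' [1..<k]"
  have c: "set ?xs \<subseteq> carrier B" using Suc assms by auto
  have rk: "r k \<in> carrier B" "r' k \<in> carrier B" using Suc by auto
  have eq: "map r (rev [1..<Suc k]) @ [x] @ map r' [1..<Suc k] = [r k] @ ?xs @ [r' k]"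
    using Suc.hyps by simp
  have "lprod B ([r k] @ ?xs @ [r' k]) = r k \<otimes> (lprod B ?xs \<otimes> r' k)"
  proof -
    have "lprod B ([r k] @ ?xs @ [r' k]) = lprod B [r k] \<otimes> lprod B (?xs @ [r' k])"
      using c rk by (intro lprod_append) auto
    also have "lprod B (?xs @ [r' k]) = lprod B ?xs \<otimes> lprod B [r' k]"
      using c rk by (intro lprod_append) auto
    finally show ?thesis using rk by (simp add: lprod_def)
  qed
  then show ?case
    using Suc c rk ov_Suc[of k x] lprod_closed[OF c] unfolding eq by (simp add: m_assoc)
qed

lemma (in hecke_rep) jm_eq_lprod:
  "1 \<le> k \<Longrightarrow> k \<le> N \<Longrightarrow> jm k = lprod B (map r (rev [1..<k] @ [1..<k]))"
proof (induction k rule: nat_induct_at_least)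
  case base
  then show ?case by (simp add: lprod_def)
next
  case (Suc k)
  let ?xs = "map r (rev [1..<k] @ [1..<k])"
  have c: "set ?xs \<subseteq> carrier B" using Suc by auto
  have rk: "r k \<in> carrier B" using Suc by auto
  have eq: "map r (rev [1..<Suc k] @ [1..<Suc k]) = [r k] @ ?xs @ [r k]"
    using Suc.hyps by simp
  have "lprod B ([r k] @ ?xs @ [r k]) = r k \<otimes> (lprod B ?xs \<otimes> r k)"
  proof -
    have "lprod B ([r k] @ ?xs @ [r k]) = lprod B [r k] \<otimes> lprod B (?xs @ [r k])"
      using c rk by (intro lprod_append) auto
    also have "lprod B (?xs @ [r k]) = lprod B ?xs \<otimes> lprod B [r k]"
      using c rk by (intro lprod_append) auto
    finally show ?thesis using rk by (simp add: lprod_def)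
  qed
  then show ?case
    using Suc c rk jm_Suc[of k] lprod_closed[OF c] unfolding eq by (simp add: m_assoc)
qed

lemma (in weyl_rep) Dprod_eq_lprod:
  "m \<le> N \<Longrightarrow> Dprod m = lprod B (map (\<lambda>k. ov k D) (rev [1..<m + 1]))"
  by (induction m) (simp_all add: lprod_def)

lemma overl_eq_ov:
  assumes "calg A" "q \<noteq> 0" "X \<in> carrier (mat_alg {1..n} A)" "1 \<le> k" "k \<le> m"
  shows "overl A n q m k X = hecke_rep.ov (tens n m A) (Rk A n q m) (Rk_inv A n q m) k (place A n m 1 X)"
proof -
  have "place A n m 1 X \<in> carrier (tens n m A)"
    using assms by (intro alg_homD(1)[OF place_hom]) auto
  from hecke_rep.ov_eq_lprod[OF hecke_rep_Rk[OF assms(1,2)] this assms(4,5)] show ?thesis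
    by (simp add: overl_def)
qed

section \<open>From two tensor factors to m\<close>

lemma tidx_ge2E:
  assumes "I \<in> tidx n m" "2 \<le> m"
  obtains a b I' where "I = a # b # I'"
proof (cases I)
  case (Cons a I1)
  then show ?thesis using assms that by (cases I1) (auto simp: tidx_def)
qed (use assms in \<open>auto simp: tidx_def\<close>)

text \<open>X goes to X tensored with the identity in the factors 3, ..., m. The Weyl algebra is
  defined by relations in two tensor factors, and this map makes them available in m
  factors.\<close>

definition emb2 :: "(complex, 'a) module \<Rightarrow> nat \<Rightarrow> nat \<Rightarrow> (nat list, 'a) mtx \<Rightarrow> (nat list, 'a) mtx" where
  "emb2 A n m = emb_mtx A (tidx n m) (take 2) (drop 2)"

lemma emb2_hom:
  assumes "calg A" "2 \<le> m"
  shows "emb2 A n m \<in> alg_hom (tens n 2 A) (tens n m A)"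
  unfolding emb2_def tens_def
proof (rule emb_mtx_hom)
  fix I assume I: "I \<in> tidx n m"
  show "bij_betw (take 2) {K \<in> tidx n m. drop 2 I = drop 2 K} (tidx n 2)"
  proof (rule bij_betwI[where g = "\<lambda>J. J @ drop 2 I"])
    show "(\<lambda>J. J @ drop 2 I) \<in> tidx n 2 \<rightarrow> {K \<in> tidx n m. drop 2 I = drop 2 K}"
    proof
      fix J assume "J \<in> tidx n 2"
      moreover have "set (drop 2 I) \<subseteq> {1..n}"
        using I set_drop_subset[of 2 I] unfolding tidx_def by blast
      ultimately show "J @ drop 2 I \<in> {K \<in> tidx n m. drop 2 I = drop 2 K}"
        using I assms(2) by (auto simp: tidx_def)
    qed
    show "take 2 \<in> {K \<in> tidx n m. drop 2 I = drop 2 K} \<rightarrow> tidx n 2"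
      using assms(2) by (auto simp: tidx_def dest: in_set_takeD)
  qed (auto simp: tidx_def)
qed (use assms in auto)

lemma emb2_place:
  assumes "2 \<le> m"
  shows "emb2 A n m (place A n 2 1 X) = place A n m 1 X"
  unfolding place_first emb2_def emb_mtx_def[of _ "tidx n m"]
proof (intro restrict_ext)
  fix I J assume I: "I \<in> tidx n m" and J: "J \<in> tidx n m"
  then obtain a b I' c d J' where eq: "I = a # b # I'" "J = c # d # J'"
    using assms by (elim tidx_ge2E)
  have "[a, b] \<in> tidx n 2" "[c, d] \<in> tidx n 2" using I J by (auto simp: tidx_def eq)
  then show "(if drop 2 I = drop 2 J then emb_mtx A (tidx n 2) (\<lambda>I. I ! 0) tl X (take 2 I) (take 2 J) else \<zero>\<^bsub>A\<^esub>)
      = (if tl I = tl J then X (I ! 0) (J ! 0) else \<zero>\<^bsub>A\<^esub>)"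
    by (cases "b = d"; cases "I' = J'"; simp add: eq)
qed

lemma emb2_Rk:
  assumes "calg A" "2 \<le> m"
  shows "emb2 A n m (Rk A n q 2 1) = Rk A n q m 1"
  unfolding emb2_def Rk_def base_change_def emb_mtx_def map_mtx_def[of "tidx n m"]
proof (intro restrict_ext)
  interpret calg A by fact
  fix I J assume I: "I \<in> tidx n m" and J: "J \<in> tidx n m"
  then obtain a b I' c d J' where eq: "I = a # b # I'" "J = c # d # J'"
    using assms by (elim tidx_ge2E)
  have 2: "[a, b] \<in> tidx n 2" "[c, d] \<in> tidx n 2" using I J by (auto simp: tidx_def eq)
  have "Rcheck_at n q m 1 I J = (if I' = J' then Rcheck_at n q 2 1 [a, b] [c, d] else 0)"
  proof -
    have m: "1 < m" "1 < (2::nat)" "1 \<le> (1::nat)" using assms(2) by auto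
    have s: "swap_at 1 I = b # a # I'" "swap_at 1 [a, b] = [b, a]" "I ! (1 - 1) = a" "I ! 1 = b"
      "[a, b] ! (1 - 1) = a" "[a, b] ! 1 = b"
      by (simp_all add: swap_at_def eq)
    have l: "J = I \<longleftrightarrow> I' = J' \<and> [c, d] = [a, b]" "J = b # a # I' \<longleftrightarrow> I' = J' \<and> [c, d] = [b, a]"
      by (auto simp: eq)
    show ?thesis
      unfolding Rcheck_at_entry[OF m(3,1) I J] Rcheck_at_entry[OF m(3,2) 2] s l
      by (cases "I' = J'") (simp_all only: simp_thms if_True if_False add_0)
  qed
  then show "(if drop 2 I = drop 2 J then map_mtx (tidx n 2) (\<lambda>c. c \<odot>\<^bsub>A\<^esub> \<one>\<^bsub>A\<^esub>) (Rcheck_at n q 2 1) (take 2 I) (take 2 J) else \<zero>\<^bsub>A\<^esub>)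
      = Rcheck_at n q m 1 I J \<odot>\<^bsub>A\<^esub> \<one>\<^bsub>A\<^esub>"
    using 2 by (simp add: eq)
qed

text \<open>The entries of the inverse need not be known: a unital homomorphism maps inverses to
  inverses, and inverses are unique.\<close>

lemma emb2_Rk_inv:
  assumes "calg A" "2 \<le> m" "q \<noteq> 0"
  shows "emb2 A n m (Rk_inv A n q 2 1) = Rk_inv A n q m 1"
proof -
  let ?T = "tens n m A"
  interpret T: calg ?T by (intro calg_tens assms)
  note h = alg_homD[OF emb2_hom[OF assms(1,2), of n]]
  have m: "1 < m" "1 \<le> (1::nat)" "1 < (2::nat)" using assms(2) by auto
  note i2 = Rk_inv[OF assms(1,3) m(2,3), of n]
  note im = Rk_inv[OF assms(1,3) m(2,1), of n]
  note c = Rk_closed[OF assms(1), of n q 2 1] Rk_closed[OF assms(1), of n q m 1]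
  show ?thesis
  proof (rule T.inv_unique[of _ "Rk A n q m 1"])
    show "emb2 A n m (Rk_inv A n q 2 1) \<otimes>\<^bsub>?T\<^esub> Rk A n q m 1 = \<one>\<^bsub>?T\<^esub>"
      unfolding emb2_Rk[OF assms(1,2), symmetric] h(2)[OF i2(1) c(1), symmetric] i2(3) by (rule h(4))
  qed (use c im h(1)[OF i2(1)] in auto)
qed

text \<open>The entrywise differences of the two sides are among the relations, so corresponding
  entries have the same class.\<close>

lemma mtx_relation_eq:
  assumes "calg (mat_alg S (free_alg G))" "rels \<subseteq> carrier (free_alg G)"
    and X: "X \<in> carrier (mat_alg S (free_alg G))" and Y: "Y \<in> carrier (mat_alg S (free_alg G))"
    and "mtx_relation S X Y \<subseteq> rels"
  shows "map_mtx S (presented_proj G rels) X = map_mtx S (presented_proj G rels) Y"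
  unfolding map_mtx_def
proof (intro restrict_ext)
  fix i j assume "i \<in> S" "j \<in> S"
  then show "presented_proj G rels (X i j) = presented_proj G rels (Y i j)"
    using assms(5) mat_alg_entry[OF X] mat_alg_entry[OF Y]
    by (intro presented_proj_eqI[OF assms(2)]) (auto simp: mtx_relation_def)
qed

lemma mtx_relation_carrier:
  assumes "X \<in> carrier (mat_alg S (free_alg G))" "Y \<in> carrier (mat_alg S (free_alg G))"
  shows "mtx_relation S X Y \<subseteq> carrier (free_alg G)"
  using mat_alg_entry[OF assms(1)] mat_alg_entry[OF assms(2)] by (auto simp: mtx_relation_def)

lemma place_closed:
  assumes "calg A" "X \<in> carrier (mat_alg {1..n} A)" "1 \<le> a" "a \<le> m"
  shows "place A n m a X \<in> carrier (tens n m A)"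
proof -
  interpret calg A by fact
  have "I ! (a - 1) \<in> {1..n}" if "I \<in> tidx n m" for I
    using assms that by (intro tidx_nth[of I n m]) auto
  then show ?thesis
    unfolding place_def tens_def using mat_alg_entry[OF assms(2)] by (intro mat_alg_restrictI) auto
qed

lemma base_change_closed:
  assumes "calg A" "X \<in> carrier (tens n m complex_alg)"
  shows "base_change A n m X \<in> carrier (tens n m A)"
  using assms by (intro alg_homD(1)[OF base_change_hom])

section \<open>The Weyl algebra and its relations\<close>

context
  fixes n :: nat and q :: complex
  assumes q: "q \<noteq> 0"
begin

lemma M_free_closed: "M_free n \<in> carrier (mat_alg {1..n} (free_alg (weyl_gens n)))"
  unfolding M_free_def by (intro mat_alg_restrictI) (auto simp: weyl_gens_def)

lemma D_free_closed: "D_free n \<in> carrier (mat_alg {1..n} (free_alg (weyl_gens n)))"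
  unfolding D_free_def by (intro mat_alg_restrictI) (auto simp: weyl_gens_def)

abbreviation (input) "weyl_free \<equiv> free_alg (weyl_gens n)"
abbreviation (input) "weyl_free2 \<equiv> tens n 2 (free_alg (weyl_gens n))"

interpretation T2: calg "tens n 2 (free_alg (weyl_gens n))"
  by (intro calg_tens calg_free_alg)

lemma weyl_free_closed:
  "Rk weyl_free n q 2 1 \<in> carrier weyl_free2" "Rk_inv weyl_free n q 2 1 \<in> carrier weyl_free2"
  "place weyl_free n 2 1 (M_free n) \<in> carrier weyl_free2" "place weyl_free n 2 1 (D_free n) \<in> carrier weyl_free2"
  using q by (auto intro!: Rk_closed Rk_inv place_closed calg_free_alg M_free_closed D_free_closed simp del: One_nat_def)

lemma weyl_rels_carrier: "weyl_rels n q \<subseteq> carrier (free_alg (weyl_gens n))"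
  unfolding weyl_rels_def Let_def
  by (intro Un_least mtx_relation_carrier)
     (simp_all add: weyl_free_closed[simplified] flip: tens_def)

lemma calg_Weyl: "calg (Weyl n q)"
  unfolding Weyl_def by (rule calg_presented[OF weyl_rels_carrier])

lemma proj_Weyl_hom: "presented_proj (weyl_gens n) (weyl_rels n q) \<in> alg_hom (free_alg (weyl_gens n)) (Weyl n q)"
  unfolding Weyl_def by (rule presented_proj_hom[OF weyl_rels_carrier])

lemma Mmat_closed: "Mmat n q \<in> carrier (mat_alg {1..n} (Weyl n q))"
  unfolding Mmat_def using alg_homD(1)[OF map_mtx_hom[OF calg_free_alg calg_Weyl proj_Weyl_hom]] M_free_closed
  by auto

lemma Dmat_closed: "Dmat n q \<in> carrier (mat_alg {1..n} (Weyl n q))"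
  unfolding Dmat_def using alg_homD(1)[OF map_mtx_hom[OF calg_free_alg calg_Weyl proj_Weyl_hom]] D_free_closed
  by auto

text \<open>Between the free matrices these equations hold only modulo the relations. The entrywise
  projection is a homomorphism of matrix algebras that is compatible with scalar matrices and with
  placement, so it maps both sides to the same expressions over the Weyl algebra.\<close>

lemma weyl_relations_2:
  defines "T \<equiv> tens n 2 (Weyl n q)"
  defines "r \<equiv> Rk (Weyl n q) n q 2 1" and "r' \<equiv> Rk_inv (Weyl n q) n q 2 1"
  defines "X \<equiv> place (Weyl n q) n 2 1 (Mmat n q)" and "D \<equiv> place (Weyl n q) n 2 1 (Dmat n q)"
  shows "r' \<otimes>\<^bsub>T\<^esub> D \<otimes>\<^bsub>T\<^esub> r' \<otimes>\<^bsub>T\<^esub> D = D \<otimes>\<^bsub>T\<^esub> r' \<otimes>\<^bsub>T\<^esub> D \<otimes>\<^bsub>T\<^esub> r'"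
    and "D \<otimes>\<^bsub>T\<^esub> r \<otimes>\<^bsub>T\<^esub> X \<otimes>\<^bsub>T\<^esub> r = r \<otimes>\<^bsub>T\<^esub> X \<otimes>\<^bsub>T\<^esub> r' \<otimes>\<^bsub>T\<^esub> D \<oplus>\<^bsub>T\<^esub> r"
proof -
  let ?p = "map_mtx (tidx n 2) (presented_proj (weyl_gens n) (weyl_rels n q))"
  note h = alg_homD[OF tens_map_hom[OF calg_free_alg calg_Weyl proj_Weyl_hom, of n 2]]
  define R where "R = Rk weyl_free n q 2 1"
  define R' where "R' = Rk_inv weyl_free n q 2 1"
  define M1 where "M1 = place weyl_free n 2 1 (M_free n)"
  define D1 where "D1 = place weyl_free n 2 1 (D_free n)"
  note [simp] = weyl_free_closed[folded R_def R'_def M1_def D1_def]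
  have z: "presented_proj (weyl_gens n) (weyl_rels n q) \<zero>\<^bsub>weyl_free\<^esub> = \<zero>\<^bsub>Weyl n q\<^esub>"
    by (rule alg_hom_zero[OF calg_free_alg calg_Weyl proj_Weyl_hom])
  have img: "?p R = r" "?p R' = r'" "?p M1 = X" "?p D1 = D"
    unfolding R_def R'_def M1_def D1_def r_def r'_def X_def D_def Rk_def Rk_inv_def Mmat_def Dmat_def
    by (rule map_base_change[OF calg_free_alg proj_Weyl_hom] map_place[of "presented_proj (weyl_gens n) (weyl_rels n q)" weyl_free "Weyl n q", OF z]; simp)+
  have rels: "mtx_relation (tidx n 2) (R' \<otimes>\<^bsub>weyl_free2\<^esub> D1 \<otimes>\<^bsub>weyl_free2\<^esub> R' \<otimes>\<^bsub>weyl_free2\<^esub> D1) (D1 \<otimes>\<^bsub>weyl_free2\<^esub> R' \<otimes>\<^bsub>weyl_free2\<^esub> D1 \<otimes>\<^bsub>weyl_free2\<^esub> R') \<subseteq> weyl_rels n q"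
    "mtx_relation (tidx n 2) (D1 \<otimes>\<^bsub>weyl_free2\<^esub> R \<otimes>\<^bsub>weyl_free2\<^esub> M1 \<otimes>\<^bsub>weyl_free2\<^esub> R)
      (R \<otimes>\<^bsub>weyl_free2\<^esub> M1 \<otimes>\<^bsub>weyl_free2\<^esub> R' \<otimes>\<^bsub>weyl_free2\<^esub> D1 \<oplus>\<^bsub>weyl_free2\<^esub> R) \<subseteq> weyl_rels n q"
    unfolding weyl_rels_def Let_def R_def R'_def M1_def D1_def by blast+
  have "?p (R' \<otimes>\<^bsub>weyl_free2\<^esub> D1 \<otimes>\<^bsub>weyl_free2\<^esub> R' \<otimes>\<^bsub>weyl_free2\<^esub> D1) = ?p (D1 \<otimes>\<^bsub>weyl_free2\<^esub> R' \<otimes>\<^bsub>weyl_free2\<^esub> D1 \<otimes>\<^bsub>weyl_free2\<^esub> R')"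
    using rels(1) by (intro mtx_relation_eq weyl_rels_carrier) (simp_all add: T2.calg_axioms flip: tens_def)
  then show "r' \<otimes>\<^bsub>T\<^esub> D \<otimes>\<^bsub>T\<^esub> r' \<otimes>\<^bsub>T\<^esub> D = D \<otimes>\<^bsub>T\<^esub> r' \<otimes>\<^bsub>T\<^esub> D \<otimes>\<^bsub>T\<^esub> r'"
    by (simp add: h img T_def)
  have "?p (D1 \<otimes>\<^bsub>weyl_free2\<^esub> R \<otimes>\<^bsub>weyl_free2\<^esub> M1 \<otimes>\<^bsub>weyl_free2\<^esub> R) = ?p (R \<otimes>\<^bsub>weyl_free2\<^esub> M1 \<otimes>\<^bsub>weyl_free2\<^esub> R' \<otimes>\<^bsub>weyl_free2\<^esub> D1 \<oplus>\<^bsub>weyl_free2\<^esub> R)"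
    using rels(2) by (intro mtx_relation_eq weyl_rels_carrier) (simp_all add: T2.calg_axioms flip: tens_def)
  then show "D \<otimes>\<^bsub>T\<^esub> r \<otimes>\<^bsub>T\<^esub> X \<otimes>\<^bsub>T\<^esub> r = r \<otimes>\<^bsub>T\<^esub> X \<otimes>\<^bsub>T\<^esub> r' \<otimes>\<^bsub>T\<^esub> D \<oplus>\<^bsub>T\<^esub> r"
    by (simp add: h img T_def)
qed

text \<open>For m \<ge> 2 the relations in two factors are transported by \<open>emb2\<close>; for m
  = 1 the locale asks for none of them.\<close>

lemma weyl_rep_Weyl:
  assumes "1 \<le> m"
  shows "weyl_rep (tens n m (Weyl n q)) m (q - inverse q) (Rk (Weyl n q) n q m) (Rk_inv (Weyl n q) n q m)
    (place (Weyl n q) n m 1 (Mmat n q)) (place (Weyl n q) n m 1 (Dmat n q))"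
proof (intro weyl_rep.intro weyl_rep_axioms.intro)
  show "hecke_rep (tens n m (Weyl n q)) m (q - inverse q) (Rk (Weyl n q) n q m) (Rk_inv (Weyl n q) n q m)"
    by (rule hecke_rep_Rk[OF calg_Weyl q])
next
  assume m: "2 \<le> m"
  note h = alg_homD[OF emb2_hom[OF calg_Weyl m, of n]]
  interpret T: calg "tens n 2 (Weyl n q)" by (intro calg_tens calg_Weyl)
  have c: "Rk (Weyl n q) n q 2 1 \<in> carrier (tens n 2 (Weyl n q))"
    "Rk_inv (Weyl n q) n q 2 1 \<in> carrier (tens n 2 (Weyl n q))"
    "place (Weyl n q) n 2 1 (Mmat n q) \<in> carrier (tens n 2 (Weyl n q))"
    "place (Weyl n q) n 2 1 (Dmat n q) \<in> carrier (tens n 2 (Weyl n q))"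
    using q by (auto intro!: Rk_closed Rk_inv place_closed calg_Weyl Mmat_closed Dmat_closed simp del: One_nat_def)
  note e = emb2_place[OF m, of "Weyl n q" n] emb2_Rk[OF calg_Weyl m] emb2_Rk_inv[OF calg_Weyl m q]
  show "Rk_inv (Weyl n q) n q m 1 \<otimes>\<^bsub>tens n m (Weyl n q)\<^esub> place (Weyl n q) n m 1 (Dmat n q) \<otimes>\<^bsub>tens n m (Weyl n q)\<^esub>
      Rk_inv (Weyl n q) n q m 1 \<otimes>\<^bsub>tens n m (Weyl n q)\<^esub> place (Weyl n q) n m 1 (Dmat n q) =
    place (Weyl n q) n m 1 (Dmat n q) \<otimes>\<^bsub>tens n m (Weyl n q)\<^esub> Rk_inv (Weyl n q) n q m 1 \<otimes>\<^bsub>tens n m (Weyl n q)\<^esub>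
      place (Weyl n q) n m 1 (Dmat n q) \<otimes>\<^bsub>tens n m (Weyl n q)\<^esub> Rk_inv (Weyl n q) n q m 1"
    using arg_cong[OF weyl_relations_2(1), of "emb2 (Weyl n q) n m"] c
    by (simp only: h T.m_closed e)
  show "place (Weyl n q) n m 1 (Dmat n q) \<otimes>\<^bsub>tens n m (Weyl n q)\<^esub> Rk (Weyl n q) n q m 1 \<otimes>\<^bsub>tens n m (Weyl n q)\<^esub>
      place (Weyl n q) n m 1 (Mmat n q) \<otimes>\<^bsub>tens n m (Weyl n q)\<^esub> Rk (Weyl n q) n q m 1 =
    Rk (Weyl n q) n q m 1 \<otimes>\<^bsub>tens n m (Weyl n q)\<^esub> place (Weyl n q) n m 1 (Mmat n q) \<otimes>\<^bsub>tens n m (Weyl n q)\<^esub>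
      Rk_inv (Weyl n q) n q m 1 \<otimes>\<^bsub>tens n m (Weyl n q)\<^esub> place (Weyl n q) n m 1 (Dmat n q)
      \<oplus>\<^bsub>tens n m (Weyl n q)\<^esub> Rk (Weyl n q) n q m 1"
    using arg_cong[OF weyl_relations_2(2), of "emb2 (Weyl n q) n m"] c
    by (simp only: h T.m_closed e)
qed (use assms q in \<open>auto intro!: place_closed Rk_place_commute calg_Weyl Mmat_closed Dmat_closed simp del: One_nat_def\<close>)

end

section \<open>The Hecke action and the quantum group\<close>

context
  fixes B :: "(complex, 'b) module" and f :: "'g \<Rightarrow> 'b"
  assumes B: "calg B" and f: "\<And>g. f g \<in> carrier B"
begin

interpretation calg B by (rule B)

abbreviation (input) "eval_word w \<equiv> lprod B (map f (letters w))"

lemma eval_word_closed: "eval_word w \<in> carrier B"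
  using f by (intro lprod_closed) auto

text \<open>The support of a sum may be smaller than the union of the supports. Words with
  coefficient zero contribute nothing, so both summands and the sum can be evaluated over that
  union.\<close>

lemma free_eval_superset:
  assumes "finite S" "Poly_Mapping.keys p \<subseteq> S"
  shows "free_eval B f p = (\<Oplus>\<^bsub>B\<^esub>w\<in>S. Poly_Mapping.lookup p w \<odot>\<^bsub>B\<^esub> eval_word w)"
  unfolding free_eval_def using assms eval_word_closed
  by (intro add.finprod_mono_neutral_cong_left) (auto simp: in_keys_iff)

lemma free_eval_closed: "free_eval B f p \<in> carrier B"
  unfolding free_eval_def using eval_word_closed by (intro finsum_closed) auto

lemma free_eval_add: "free_eval B f (p + r) = free_eval B f p \<oplus>\<^bsub>B\<^esub> free_eval B f r"
proof -
  let ?S = "Poly_Mapping.keys p \<union> Poly_Mapping.keys r"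
  have "free_eval B f (p + r) = (\<Oplus>\<^bsub>B\<^esub>w\<in>?S. Poly_Mapping.lookup p w \<odot>\<^bsub>B\<^esub> eval_word w \<oplus>\<^bsub>B\<^esub> Poly_Mapping.lookup r w \<odot>\<^bsub>B\<^esub> eval_word w)"
    using free_eval_superset[OF _ Poly_Mapping.keys_add] eval_word_closed
    by (simp add: lookup_add smult_add_left)
  also have "\<dots> = (\<Oplus>\<^bsub>B\<^esub>w\<in>?S. Poly_Mapping.lookup p w \<odot>\<^bsub>B\<^esub> eval_word w) \<oplus>\<^bsub>B\<^esub> (\<Oplus>\<^bsub>B\<^esub>w\<in>?S. Poly_Mapping.lookup r w \<odot>\<^bsub>B\<^esub> eval_word w)"
    using eval_word_closed by (intro finsum_addf) auto
  also have "\<dots> = free_eval B f p \<oplus>\<^bsub>B\<^esub> free_eval B f r"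
    by (subst (1 2) free_eval_superset[of ?S]) auto
  finally show ?thesis .
qed

lemma free_eval_single: "free_eval B f (Poly_Mapping.single w c) = c \<odot>\<^bsub>B\<^esub> eval_word w"
  using eval_word_closed[of w] by (subst free_eval_superset[of "{w}"]) auto

lemma free_eval_zero: "free_eval B f 0 = \<zero>\<^bsub>B\<^esub>"
  by (simp add: free_eval_def)

text \<open>Both sides are additive in each argument, which reduces the claim to monomials, where
  concatenation of words becomes the product of their values.\<close>

lemma free_eval_mult: "free_eval B f (p * r) = free_eval B f p \<otimes>\<^bsub>B\<^esub> free_eval B f r"
proof (induction p rule: poly_mapping_add_induct)
  case (single u c)
  show ?case
  proof (induction r rule: poly_mapping_add_induct)
    case (single v d)
    have "eval_word (u + v) = eval_word u \<otimes>\<^bsub>B\<^esub> eval_word v"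
      using f lprod_append[of "map f (letters u)" "map f (letters v)"] by auto
    then show ?case
      using eval_word_closed by (simp add: mult_single free_eval_single smult_mult_left smult_mult_right smult_smult mult.commute)
  qed (simp_all add: free_eval_closed free_eval_zero distrib_left free_eval_add r_distr)
qed (simp_all add: free_eval_closed free_eval_zero distrib_right free_eval_add l_distr)

lemma free_eval_const: "free_eval B f (const c) = c \<odot>\<^bsub>B\<^esub> \<one>\<^bsub>B\<^esub>"
  by (simp add: const_def free_eval_single lprod_def)

lemma free_eval_gen: "free_eval B f (gen g) = f g"
  using f by (simp add: gen_def free_eval_single lprod_def)

lemma free_eval_hom: "free_eval B f \<in> alg_hom (free_alg X) B"
proof (rule alg_homI)
  show "free_eval B f \<one>\<^bsub>free_alg X\<^esub> = \<one>\<^bsub>B\<^esub>"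
    using free_eval_const[of 1] by (simp add: const_simps)
qed (simp_all add: free_eval_closed free_eval_add free_eval_mult free_eval_const smult_mult_left)

lemma free_eval_diff: "free_eval B f (p - r) = free_eval B f p \<ominus>\<^bsub>B\<^esub> free_eval B f r"
proof -
  have "free_eval B f p = free_eval B f (p - r) \<oplus>\<^bsub>B\<^esub> free_eval B f r"
    by (simp flip: free_eval_add)
  then show ?thesis
    using free_eval_closed by (simp add: a_minus_def a_assoc r_neg)
qed

text \<open>The kernel of the evaluation is an ideal containing the relations, hence the ideal
  generated by them. The evaluation is therefore constant on a class, and its image is the singleton
  from which \<open>hecke_action\<close> takes its element.\<close>

lemma free_eval_presented:
  assumes "rels \<subseteq> carrier (free_alg X)" "\<And>p. p \<in> rels \<Longrightarrow> free_eval B f p = \<zero>\<^bsub>B\<^esub>"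
    and "p \<in> carrier (free_alg X)"
  shows "free_eval B f ` presented_proj X rels p = {free_eval B f p}"
proof -
  interpret F: calg "free_alg X" by (rule calg_free_alg)
  interpret h: ring_hom_ring "free_alg X" B "free_eval B f"
    using free_eval_hom[of X]
    by (intro ring_hom_ring.intro ring_hom_ring_axioms.intro F.ring_axioms ring_axioms)
       (simp add: alg_hom_def)
  have "Idl\<^bsub>free_alg X\<^esub> rels \<subseteq> a_kernel (free_alg X) B (free_eval B f)"
  proof (rule F.genideal_minimal[OF h.kernel_is_ideal], rule subsetI)
    fix p assume "p \<in> rels"
    then show "p \<in> a_kernel (free_alg X) B (free_eval B f)"
      using assms(1) assms(2)[OF \<open>p \<in> rels\<close>] unfolding a_kernel_def' by blast
  qed
  then have *: "free_eval B f i = \<zero>\<^bsub>B\<^esub>" if "i \<in> Idl\<^bsub>free_alg X\<^esub> rels" for i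
    using that unfolding a_kernel_def' by blast
  have "0 \<in> Idl\<^bsub>free_alg X\<^esub> rels"
    using additive_subgroup.zero_closed[OF ideal.axioms(1)[OF F.genideal_ideal[OF assms(1)]]] by simp
  then have "free_eval B f (0 + p) \<in> free_eval B f ` presented_proj X rels p"
    unfolding presented_proj_def a_r_coset_def' free_alg_simps by blast
  moreover have "free_eval B f y = free_eval B f p" if y: "y \<in> presented_proj X rels p" for y
  proof -
    obtain i where "i \<in> Idl\<^bsub>free_alg X\<^esub> rels" "y = i + p"
      using y unfolding presented_proj_def a_r_coset_def' free_alg_simps by blast
    then show ?thesis using * free_eval_closed by (simp add: free_eval_add)
  qed
  ultimately show ?thesis by auto
qed

end

section \<open>The Hecke algebra acting on tensor powers\<close>

lemma hecke_rels_carrier: "hecke_rels m q \<subseteq> carrier (free_alg {1..<m})"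
  by (auto simp: hecke_rels_def simp del: atLeastLessThan_iff)

lemma hecke_rels_eval:
  assumes "q \<noteq> 0" "p \<in> hecke_rels m q"
  shows "free_eval (tens n m complex_alg) (Rcheck_at n q m) p = \<zero>\<^bsub>tens n m complex_alg\<^esub>"
proof -
  let ?T = "tens n m complex_alg" and ?R = "Rcheck_at n q m"
  interpret T: calg ?T by (intro calg_tens calg_complex_alg)
  note c = Rcheck_at_closed[of n q m]
  note e = free_eval_add[OF T.calg_axioms c] free_eval_mult[OF T.calg_axioms c] free_eval_diff[OF T.calg_axioms c]
    free_eval_const[OF T.calg_axioms c] free_eval_gen[OF T.calg_axioms c]
  from assms(2) consider
      i where "i \<in> {1..<m}" "p = (gen i - const q) * (gen i + const (inverse q))"
    | i where "i \<in> {1..<m}" "i + 1 \<in> {1..<m}" "p = gen i * gen (i + 1) * gen i - gen (i + 1) * gen i * gen (i + 1)"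
    | i j where "i \<in> {1..<m}" "j \<in> {1..<m}" "\<bar>int i - int j\<bar> > 1" "p = gen i * gen j - gen j * gen i"
    unfolding hecke_rels_def by blast
  then show ?thesis
  proof cases
    case (1 i)
    have i: "1 \<le> i" "i < m" using 1 by auto
    have cl: "?R i \<in> carrier ?T" by (rule c)
    have sq: "?R i \<otimes>\<^bsub>?T\<^esub> ?R i = (q - inverse q) \<odot>\<^bsub>?T\<^esub> ?R i \<oplus>\<^bsub>?T\<^esub> \<one>\<^bsub>?T\<^esub>"
      by (rule Rcheck_at_square[OF assms(1) i])
    \<comment> \<open>Expanded until the square of the matrix stands alone and can be replaced; what
      remains is a scalar identity in each entry.\<close>
    have "(?R i \<ominus>\<^bsub>?T\<^esub> q \<odot>\<^bsub>?T\<^esub> \<one>\<^bsub>?T\<^esub>) \<otimes>\<^bsub>?T\<^esub> (?R i \<oplus>\<^bsub>?T\<^esub> inverse q \<odot>\<^bsub>?T\<^esub> \<one>\<^bsub>?T\<^esub>)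
      = (?R i \<otimes>\<^bsub>?T\<^esub> ?R i \<oplus>\<^bsub>?T\<^esub> (- q) \<odot>\<^bsub>?T\<^esub> ?R i) \<oplus>\<^bsub>?T\<^esub> (inverse q \<odot>\<^bsub>?T\<^esub> ?R i \<oplus>\<^bsub>?T\<^esub> (inverse q * - q) \<odot>\<^bsub>?T\<^esub> \<one>\<^bsub>?T\<^esub>)"
      using cl by (simp only: a_minus_def T.smult_uminus[symmetric] T.l_distr T.r_distr T.smult_mult_left
        T.smult_mult_right T.l_one T.r_one T.smult_smult T.one_closed T.smult_closed T.a_closed T.m_closed T.smult_add_right)
    also have "\<dots> = \<zero>\<^bsub>?T\<^esub>"
      unfolding sq
      by (rule tens_eqI[of _ n m complex_alg])
         (use cl assms(1) in \<open>auto simp: tens_simps algebra_simps\<close>)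
    finally show ?thesis by (simp add: 1 e)
  next
    case (2 i)
    then show ?thesis
      using Rcheck_at_braid[OF assms(1), of i m n] c by (simp add: e a_minus_def T.r_neg)
  next
    case (3 i j)
    then have "?R i \<otimes>\<^bsub>?T\<^esub> ?R j = ?R j \<otimes>\<^bsub>?T\<^esub> ?R i"
      using Rcheck_at_far[of i j m n q] Rcheck_at_far[of j i m n q]
      by (cases "i < j") (auto simp: commutes_def)
    with 3 show ?thesis
      using c by (simp add: e a_minus_def T.r_neg)
  qed
qed

text \<open>The eigenvalue equation is lifted to polynomials: the word for y_k times a
  representative of e lies in the class of c times that representative. Evaluation has the same
  value on both, and it is multiplicative.\<close>

lemma hecke_action_jm:
  fixes n m k :: nat and q c :: complex
  assumes "q \<noteq> 0" "e \<in> carrier (Hecke m q)"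
    and "jucys_murphy m q k \<otimes>\<^bsub>Hecke m q\<^esub> e = c \<odot>\<^bsub>Hecke m q\<^esub> e" "k \<le> m"
  defines "T \<equiv> tens n m complex_alg"
  shows "hecke_action n q m e \<in> carrier T"
    and "lprod T (map (Rcheck_at n q m) (rev [1..<k] @ [1..<k])) \<otimes>\<^bsub>T\<^esub> hecke_action n q m e
      = c \<odot>\<^bsub>T\<^esub> hecke_action n q m e"
proof -
  interpret T: calg T unfolding T_def by (intro calg_tens calg_complex_alg)
  interpret F: calg "free_alg {1..<m}" by (rule calg_free_alg)
  interpret H: calg "Hecke m q" unfolding Hecke_def by (rule calg_presented[OF hecke_rels_carrier])
  let ?F = "free_alg {1..<m}"
  let ?proj = "presented_proj {1..<m} (hecke_rels m q)"
  let ?ev = "free_eval T (Rcheck_at n q m)"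
  have cl: "Rcheck_at n q m k \<in> carrier T" for k
    unfolding T_def by (rule Rcheck_at_closed)
  note ev = free_eval_presented[OF T.calg_axioms cl hecke_rels_carrier]
  have act: "hecke_action n q m (?proj p) = ?ev p" if "p \<in> carrier ?F" for p
    using ev[OF _ that] hecke_rels_eval[OF assms(1)]
    by (simp add: hecke_action_def T_def)
  obtain p where p: "p \<in> carrier ?F" "e = ?proj p"
    using assms(2) unfolding Hecke_def by (elim presented_carrierE[OF hecke_rels_carrier])
  show "hecke_action n q m e \<in> carrier T"
    unfolding p(2) act[OF p(1)] by (rule free_eval_closed[OF T.calg_axioms cl])
  have evc: "?ev r \<in> carrier T" for r by (rule free_eval_closed[OF T.calg_axioms cl])
  let ?ks = "rev [1..<k] @ [1..<k]"
  have ks: "set (map gen ?ks) \<subseteq> carrier ?F" using assms(4) by auto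
  note hproj = presented_proj_hom[OF hecke_rels_carrier, of m q, folded Hecke_def]
  define j where "j = lprod ?F (map gen ?ks)"
  have j: "j \<in> carrier ?F" unfolding j_def by (rule F.lprod_closed[OF ks])
  have "jucys_murphy m q k = ?proj j"
    using alg_hom_lprod[OF F.calg_axioms hproj ks]
    by (simp add: jucys_murphy_def j_def hecke_T_def[abs_def] comp_def)
  then have "?proj (j * p) = ?proj (const c * p)"
    using assms(3) alg_homD(2)[OF hproj j p(1)] alg_homD(5)[OF hproj p(1)] by (simp add: p(2))
  then have "?ev (j * p) = ?ev (const c * p)"
    using act j p(1) by (metis F.m_closed free_alg_simps(1) free_alg_closed(1,7))
  moreover have "?ev j = lprod T (map (Rcheck_at n q m) ?ks)"
    using alg_hom_lprod[OF F.calg_axioms free_eval_hom[OF T.calg_axioms cl] ks]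
    by (simp add: j_def comp_def free_eval_gen[OF T.calg_axioms cl])
  ultimately show "lprod T (map (Rcheck_at n q m) ?ks) \<otimes>\<^bsub>T\<^esub> hecke_action n q m e
      = c \<odot>\<^bsub>T\<^esub> hecke_action n q m e"
    unfolding p(2) act[OF p(1)]
    using evc
    by (simp add: free_eval_mult[OF T.calg_axioms cl] free_eval_const[OF T.calg_axioms cl] T.smult_mult_left)
qed

section \<open>The quantum group and the matrix K\<close>

lemma Lp_free_closed: "Lp_free n \<in> carrier (mat_alg {1..n} (free_alg (uq_gens n)))"
  unfolding Lp_free_def by (intro mat_alg_restrictI) (auto simp: uq_gens_def)

lemma Lm_free_closed: "Lm_free n \<in> carrier (mat_alg {1..n} (free_alg (uq_gens n)))"
  unfolding Lm_free_def by (intro mat_alg_restrictI) (auto simp: uq_gens_def)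

lemma Rmat_closed: "Rmat n q \<in> carrier (tens n 2 complex_alg)"
  unfolding Rmat_def tens_def by (intro mat_alg_restrictI) simp

lemma uq_rels_carrier: "uq_rels n q \<subseteq> carrier (free_alg (uq_gens n))"
proof -
  interpret T: calg "tens n 2 (free_alg (uq_gens n))" by (intro calg_tens calg_free_alg)
  have "{gen (LP i i) * gen (LM i i) - 1 | i. i \<in> {1..n}} \<subseteq> carrier (free_alg (uq_gens n))"
    "{gen (LM i i) * gen (LP i i) - 1 | i. i \<in> {1..n}} \<subseteq> carrier (free_alg (uq_gens n))"
    by (auto simp: uq_gens_def)
  moreover have cl: "base_change (free_alg (uq_gens n)) n 2 (Rmat n q) \<in> carrier (tens n 2 (free_alg (uq_gens n)))"
    "place (free_alg (uq_gens n)) n 2 a (Lp_free n) \<in> carrier (tens n 2 (free_alg (uq_gens n)))"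
    "place (free_alg (uq_gens n)) n 2 a (Lm_free n) \<in> carrier (tens n 2 (free_alg (uq_gens n)))"
    if "a \<in> {1, 2}" for a
    using that
    by (auto intro!: base_change_closed place_closed calg_free_alg Rmat_closed Lp_free_closed Lm_free_closed simp del: One_nat_def)
  ultimately show ?thesis
    unfolding uq_rels_def Let_def
    using cl[of 1] cl[of 2]
    by (intro Un_least mtx_relation_carrier) (simp_all del: One_nat_def flip: tens_def)
qed

lemma calg_Uq: "calg (Uq n q)"
  unfolding Uq_def by (rule calg_presented[OF uq_rels_carrier])

lemma proj_Uq_hom: "presented_proj (uq_gens n) (uq_rels n q) \<in> alg_hom (free_alg (uq_gens n)) (Uq n q)"
  unfolding Uq_def by (rule presented_proj_hom[OF uq_rels_carrier])

lemma Lp_closed: "Lp n q \<in> carrier (mat_alg {1..n} (Uq n q))"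
  unfolding Lp_def
  by (rule alg_homD(1)[OF map_mtx_hom[OF calg_free_alg calg_Uq proj_Uq_hom] Lp_free_closed]) simp

lemma Lm_closed: "Lm n q \<in> carrier (mat_alg {1..n} (Uq n q))"
  unfolding Lm_def
  by (rule alg_homD(1)[OF map_mtx_hom[OF calg_free_alg calg_Uq proj_Uq_hom] Lm_free_closed]) simp

text \<open>L^- is lower triangular, and its diagonal entries are inverted by those of L^+. Without
  this the inverse in \<open>Lmat\<close> would have no meaning.\<close>

lemma Lm_unit: "Lm n q \<in> Units (mat_alg {1..n} (Uq n q))"
proof (rule lower_triangular_unit[OF calg_Uq Lm_closed])
  let ?p = "presented_proj (uq_gens n) (uq_rels n q)"
  note hp = alg_homD[OF proj_Uq_hom[of n q]] alg_hom_zero[OF calg_free_alg calg_Uq proj_Uq_hom[of n q]]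
  show "Lm n q i j = \<zero>\<^bsub>Uq n q\<^esub>" if "i \<in> {1..n}" "j \<in> {1..n}" "i < j" for i j
    using that hp(6) by (simp add: Lm_def Lm_free_def)
  fix i assume i: "i \<in> {1..n}"
  have g: "gen (LP i i) \<in> carrier (free_alg (uq_gens n))" "gen (LM i i) \<in> carrier (free_alg (uq_gens n))"
    using i by (auto simp: uq_gens_def)
  have "gen (LP i i) * gen (LM i i) - 1 \<in> uq_rels n q" "gen (LM i i) * gen (LP i i) - 1 \<in> uq_rels n q"
    using i unfolding uq_rels_def Let_def by blast+
  note r = this
  have "?p (gen (LP i i) * gen (LM i i)) = ?p 1" "?p (gen (LM i i) * gen (LP i i)) = ?p 1"
    by (rule presented_proj_eqI[OF uq_rels_carrier r(1)] presented_proj_eqI[OF uq_rels_carrier r(2)];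
        simp add: g del: gen_in_free_alg)+
  moreover have "Lm n q i i = ?p (gen (LM i i))" using i by (simp add: Lm_def Lm_free_def)
  ultimately show "?p (gen (LP i i)) \<in> carrier (Uq n q)
      \<and> Lm n q i i \<otimes>\<^bsub>Uq n q\<^esub> ?p (gen (LP i i)) = \<one>\<^bsub>Uq n q\<^esub> \<and> ?p (gen (LP i i)) \<otimes>\<^bsub>Uq n q\<^esub> Lm n q i i = \<one>\<^bsub>Uq n q\<^esub>"
    using hp(1)[OF g(1)] hp(2)[OF g(1) g(2)] hp(2)[OF g(2) g(1)] hp(4) by simp
qed

lemma Lmat_closed: "Lmat n q \<in> carrier (mat_alg {1..n} (Uq n q))"
proof -
  interpret M: calg "mat_alg {1..n} (Uq n q)" by (intro calg_mat_alg calg_Uq) simp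
  show ?thesis
    unfolding Lmat_def using Lm_unit by (intro M.m_closed M.Units_inv_closed Lp_closed)
qed

lemma calg_Uq_circ: "calg (Uq_circ n q)"
  unfolding Uq_circ_def
  by (intro calg_subalg calg_Uq) (use mat_alg_entry[OF Lmat_closed] in blast)

text \<open>The entries of L are generators of the subalgebra. That L takes the undefined value
  outside its index range is inherited from its membership over the full algebra
  \<open>Uq\<close>.\<close>

lemma Kmat_closed: "Kmat n q \<in> carrier (mat_alg {1..n} (Uq_circ n q))"
proof -
  interpret M: calg "mat_alg {1..n} (Uq_circ n q)" by (intro calg_mat_alg calg_Uq_circ) simp
  have "Lmat n q \<in> carrier (mat_alg {1..n} (Uq_circ n q))"
  proof -
    have "Lmat n q i j \<in> carrier (Uq_circ n q)" if "i \<in> {1..n}" "j \<in> {1..n}" for i j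
      unfolding Uq_circ_def using that by (intro subalg_gen) blast
    moreover have "Lmat n q \<in> {1..n} \<rightarrow>\<^sub>E ({1..n} \<rightarrow>\<^sub>E carrier (Uq n q))"
      using Lmat_closed by (simp add: mat_alg_def)
    ultimately show ?thesis
      by (simp add: mat_alg_def PiE_iff)
  qed
  then show ?thesis
    unfolding Kmat_def Let_def by (intro M.a_closed M.smult_closed M.one_closed)
qed

text \<open>The quantum group is reduced to an algebra with a matrix K and a homomorphism taking K
  to the product of M and the derivatives. Entrywise application of \<open>\<phi>\<close> is itself
  a homomorphism that fixes scalar matrices, so the whole expression moves to the Weyl algebra,
  where \<open>capelli\<close> applies.\<close>

lemma map_mtx_product_eq_capelli_product:
  fixes n m :: nat and q :: complex and A :: "(complex, 'a) module" and \<phi> :: "'a \<Rightarrow> weyl_gen free_poly set"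
    and c :: "nat \<Rightarrow> complex"
  defines "W \<equiv> Weyl n q"
  defines "T \<equiv> tens n m W"
  assumes "1 \<le> m" "q \<noteq> 0" "q - inverse q \<noteq> 0"
    and A: "calg A" and K: "K \<in> carrier (mat_alg {1..n} A)" and \<phi>: "\<phi> \<in> alg_hom A W"
    and \<phi>K: "map_mtx {1..n} \<phi> K = Mmat n q \<otimes>\<^bsub>mat_alg {1..n} W\<^esub> Dmat n q"
    and E: "E \<in> carrier (tens n m complex_alg)"
    and c: "\<And>k. k \<in> {1..m} \<Longrightarrow> c k \<noteq> 0"
    and jm: "\<And>k. k \<in> {1..m} \<Longrightarrow>
      lprod (tens n m complex_alg) (map (Rcheck_at n q m) (rev [1..<k] @ [1..<k])) \<otimes>\<^bsub>tens n m complex_alg\<^esub> E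
        = c k \<odot>\<^bsub>tens n m complex_alg\<^esub> E"
  shows "map_mtx (tidx n m) \<phi>
       (lprod (tens n m A)
          (map (\<lambda>k. overl A n q m k K \<oplus>\<^bsub>tens n m A\<^esub>
                    ((inverse (c k) - 1) / (q - inverse q)) \<odot>\<^bsub>tens n m A\<^esub> \<one>\<^bsub>tens n m A\<^esub>)
               [1..<m+1])
        \<otimes>\<^bsub>tens n m A\<^esub> base_change A n m E)
     = (\<Prod>k=1..m. inverse (c k)) \<odot>\<^bsub>T\<^esub>
         (lprod T (map (\<lambda>k. overl W n q m k (Mmat n q)) [1..<m+1])
          \<otimes>\<^bsub>T\<^esub> lprod T (map (\<lambda>k. overl W n q m k (Dmat n q)) (rev [1..<m+1]))
          \<otimes>\<^bsub>T\<^esub> base_change W n m E)"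
proof -
  let ?C = "tens n m complex_alg" and ?TA = "tens n m A"
  interpret C: calg ?C by (intro calg_tens calg_complex_alg)
  interpret TA: calg ?TA by (intro calg_tens A)
  have W: "calg W" unfolding W_def by (rule calg_Weyl[OF assms(4)])
  let ?X = "place W n m 1 (Mmat n q)" and ?D = "place W n m 1 (Dmat n q)"
  interpret weyl_rep T m "q - inverse q" "Rk W n q m" "Rk_inv W n q m" ?X ?D
    unfolding T_def W_def by (rule weyl_rep_Weyl[OF assms(4,3)])
  have MD: "Mmat n q \<in> carrier (mat_alg {1..n} W)" "Dmat n q \<in> carrier (mat_alg {1..n} W)"
    unfolding W_def by (rule Mmat_closed[OF assms(4)] Dmat_closed[OF assms(4)])+
  note h\<phi> = tens_map_hom[OF A W \<phi>, of n m, folded T_def]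
  note hb = base_change_hom[OF W, of n m, folded T_def]
  have ov: "overl W n q m k Y = ov k (place W n m 1 Y)" if "Y \<in> carrier (mat_alg {1..n} W)" "k \<in> {1..m}" for Y k
    using overl_eq_ov[OF W assms(4) that(1), of k m] that(2) by (simp add: T_def)
  have ovA: "overl A n q m k K \<in> carrier ?TA" if "k \<in> {1..m}" for k
    using overl_eq_ov[OF A assms(4) K, of k m] that
      hecke_rep.ov_closed[OF hecke_rep_Rk[OF A assms(4)] place_closed[OF A K]] assms(3)
    by (simp del: One_nat_def)
  \<comment> \<open>\<open>\<phi>\<close> passes through the conjugating scalar matrices to K
    itself, and placement in the first factor is multiplicative.\<close>
  have map_ov: "map_mtx (tidx n m) \<phi> (overl A n q m k K) = ov k (?X \<otimes>\<^bsub>T\<^esub> ?D)" if k: "k \<in> {1..m}" for k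
  proof -
    let ?xs = "map (Rk A n q m) (rev [1..<k]) @ [place A n m 1 K] @ map (Rk_inv A n q m) [1..<k]"
    have "set ?xs \<subseteq> carrier ?TA"
      using k assms(3) Rk_closed[OF A] Rk_inv(1)[OF A assms(4)] place_closed[OF A K, of 1 m] by auto
    from alg_hom_lprod[OF TA.calg_axioms h\<phi> this]
    have "map_mtx (tidx n m) \<phi> (overl A n q m k K) = overl W n q m k (map_mtx {1..n} \<phi> K)"
      using assms(3) map_base_change[OF A \<phi>] map_place[where f = \<phi> and A = A and B = W, OF alg_hom_zero[OF A W \<phi>], of 1 m n K]
      by (simp add: overl_def T_def comp_def Rk_def[abs_def] Rk_inv_def[abs_def] del: One_nat_def)
    also have "\<dots> = ov k (place W n m 1 (map_mtx {1..n} \<phi> K))"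
      using alg_homD(1)[OF map_mtx_hom[OF A W \<phi>] K] k by (intro ov) auto
    also have "place W n m 1 (map_mtx {1..n} \<phi> K) = ?X \<otimes>\<^bsub>T\<^esub> ?D"
      unfolding \<phi>K T_def using MD by (rule alg_homD(2)[OF place_hom[OF W assms(3)]])
    finally show ?thesis .
  qed
  let ?E = "base_change W n m E"
  have E': "?E \<in> carrier T" by (rule alg_homD(1)[OF hb E])
  \<comment> \<open>The eigenvalue equation holds between complex matrices and is transported by
    \<open>base_change\<close>.\<close>
  have jm': "jm k \<otimes>\<^bsub>T\<^esub> ?E = c k \<odot>\<^bsub>T\<^esub> ?E" if k: "k \<in> {1..m}" for k
  proof -
    let ?xs = "map (Rcheck_at n q m) (rev [1..<k] @ [1..<k])"
    have xs: "set ?xs \<subseteq> carrier ?C" using Rcheck_at_closed by auto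
    have "jm k = lprod T (map (Rk W n q m) (rev [1..<k] @ [1..<k]))"
      using k by (intro jm_eq_lprod) auto
    also have "\<dots> = base_change W n m (lprod ?C ?xs)"
      using alg_hom_lprod[OF C.calg_axioms hb xs] by (simp add: comp_def Rk_def[abs_def])
    finally show ?thesis
      using arg_cong[OF jm[OF k], of "base_change W n m"] alg_homD(2)[OF hb C.lprod_closed[OF xs] E]
        alg_homD(5)[OF hb E] by simp
  qed
  let ?F = "\<lambda>k. overl A n q m k K \<oplus>\<^bsub>?TA\<^esub> ((inverse (c k) - 1) / (q - inverse q)) \<odot>\<^bsub>?TA\<^esub> \<one>\<^bsub>?TA\<^esub>"
  have F: "set (map ?F [1..<m+1]) \<subseteq> carrier ?TA" using ovA by auto
  have Fm: "map (map_mtx (tidx n m) \<phi>) (map ?F [1..<m+1])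
    = map (\<lambda>k. ov k (?X \<otimes>\<^bsub>T\<^esub> ?D) \<oplus>\<^bsub>T\<^esub> ((inverse (c k) - 1) / (q - inverse q)) \<odot>\<^bsub>T\<^esub> \<one>\<^bsub>T\<^esub>) [1..<m+1]"
    unfolding map_map comp_def
  proof (rule map_cong[OF refl])
    fix k assume "k \<in> set [1..<m+1]"
    then have k: "k \<in> {1..m}" by auto
    show "map_mtx (tidx n m) \<phi> (?F k)
      = ov k (?X \<otimes>\<^bsub>T\<^esub> ?D) \<oplus>\<^bsub>T\<^esub> ((inverse (c k) - 1) / (q - inverse q)) \<odot>\<^bsub>T\<^esub> \<one>\<^bsub>T\<^esub>"
      by (simp only: alg_homD[OF h\<phi>] ovA[OF k] TA.smult_closed TA.one_closed map_ov[OF k])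
  qed
  have "map_mtx (tidx n m) \<phi> (lprod ?TA (map ?F [1..<m+1]) \<otimes>\<^bsub>?TA\<^esub> base_change A n m E)
    = lprod T (map (\<lambda>k. ov k (?X \<otimes>\<^bsub>T\<^esub> ?D) \<oplus>\<^bsub>T\<^esub> ((inverse (c k) - 1) / (q - inverse q)) \<odot>\<^bsub>T\<^esub> \<one>\<^bsub>T\<^esub>) [1..<m+1]) \<otimes>\<^bsub>T\<^esub> ?E"
    unfolding alg_homD(2)[OF h\<phi> TA.lprod_closed[OF F] base_change_closed[OF A E]]
      alg_hom_lprod[OF TA.calg_axioms h\<phi> F] Fm map_base_change[OF A \<phi>] by (rule refl)
  also have "\<dots> = (\<Prod>k=1..m. inverse (c k)) \<odot>\<^bsub>T\<^esub> (lprod T (map (\<lambda>k. ov k ?X) [1..<m+1]) \<otimes>\<^bsub>T\<^esub> Dprod m \<otimes>\<^bsub>T\<^esub> ?E)"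
    using assms(5) E' c jm' by (intro capelli) auto
  also have "map (\<lambda>k. ov k ?X) [1..<m+1] = map (\<lambda>k. overl W n q m k (Mmat n q)) [1..<m+1]"
    by (rule map_cong[OF refl], rule ov[OF MD(1), symmetric]) auto
  also have "Dprod m = lprod T (map (\<lambda>k. overl W n q m k (Dmat n q)) (rev [1..<m+1]))"
    unfolding Dprod_eq_lprod[OF order.refl]
    by (rule arg_cong[where f = "lprod T"], rule map_cong[OF refl], rule ov[OF MD(2), symmetric]) auto
  finally show ?thesis .
qed

theorem theorem4p1:
  fixes n m :: nat and q :: complex
    and \<mu> :: "(nat \<times> nat) set" and U :: "nat \<times> nat \<Rightarrow> nat"
    and e :: "nat free_poly set"
    and \<phi> :: "uq_gen free_poly set \<Rightarrow> weyl_gen free_poly set"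
  defines "A \<equiv> Uq_circ n q" and "W \<equiv> Weyl n q"
  assumes "n \<ge> 1"
    and "q \<noteq> 0" and "\<forall>k::nat. k \<ge> 1 \<longrightarrow> q ^ k \<noteq> 1"
    and "young_diagram \<mu>" and "card \<mu> = m" and "standard_tableau \<mu> U"
    and "tableau_idempotent q \<mu> U e"
    and "\<phi> \<in> alg_hom A W"
    and "\<forall>i\<in>{1..n}. \<forall>j\<in>{1..n}.
           \<phi> (Kmat n q i j) = (Mmat n q \<otimes>\<^bsub>mat_alg {1..n} W\<^esub> Dmat n q) i j"
  shows
    "map_mtx (tidx n m) \<phi>
       (lprod (tens n m A)
          (map (\<lambda>k. overl A n q m k (Kmat n q) \<oplus>\<^bsub>tens n m A\<^esub>
                    ((q powi (- 2 * content_at \<mu> U k) - 1) / (q - inverse q))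
                      \<odot>\<^bsub>tens n m A\<^esub> \<one>\<^bsub>tens n m A\<^esub>)
               [1..<m+1])
        \<otimes>\<^bsub>tens n m A\<^esub> base_change A n m (hecke_action n q m e))
     = (\<Prod>\<alpha>\<in>\<mu>. q powi (- 2 * content \<alpha>)) \<odot>\<^bsub>tens n m W\<^esub>
         (lprod (tens n m W) (map (\<lambda>k. overl W n q m k (Mmat n q)) [1..<m+1])
          \<otimes>\<^bsub>tens n m W\<^esub>
          lprod (tens n m W) (map (\<lambda>k. overl W n q m k (Dmat n q)) (rev [1..<m+1]))
          \<otimes>\<^bsub>tens n m W\<^esub> base_change W n m (hecke_action n q m e))"
proof -
  have A: "calg A" unfolding A_def by (rule calg_Uq_circ)
  have W: "calg W" unfolding W_def by (rule calg_Weyl) fact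
  have fin: "finite \<mu>" using \<open>young_diagram \<mu>\<close> by (simp add: young_diagram_def)
  have bij: "bij_betw U \<mu> {1..m}"
    using \<open>standard_tableau \<mu> U\<close> \<open>card \<mu> = m\<close> by (simp add: standard_tableau_def)
  define c where "c = (\<lambda>k. q powi (2 * content_at \<mu> U k))"
  have c: "c k \<noteq> 0" "inverse (c k) = q powi (- 2 * content_at \<mu> U k)" for k
    using \<open>q \<noteq> 0\<close> by (simp_all add: c_def power_int_minus)
  have h: "q - inverse q \<noteq> 0"
  proof
    assume "q - inverse q = 0"
    then have "q ^ 2 = 1" using \<open>q \<noteq> 0\<close> by (simp add: power2_eq_square field_simps)
    then show False using \<open>\<forall>k\<ge>1. q ^ k \<noteq> 1\<close> by auto
  qed
  note e = \<open>tableau_idempotent q \<mu> U e\<close>[unfolded tableau_idempotent_def Let_def \<open>card \<mu> = m\<close>, folded c_def]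
  have eH: "e \<in> carrier (Hecke m q)" using e by blast
  have ejm: "jucys_murphy m q k \<otimes>\<^bsub>Hecke m q\<^esub> e = c k \<odot>\<^bsub>Hecke m q\<^esub> e" if "k \<in> {1..m}" for k
    using e that by (simp add: c_def)
  show ?thesis
  proof (cases "m = 0")
    \<comment> \<open>With no tensor factor there is no first factor in which to place M and the
      derivatives. All products are empty, and both sides are the image of e.\<close>
    case True
    then have "\<mu> = {}" using \<open>card \<mu> = m\<close> fin by simp
    interpret H: calg "Hecke m q" unfolding Hecke_def by (rule calg_presented[OF hecke_rels_carrier])
    interpret TA: calg "tens n 0 A" by (intro calg_tens A)
    interpret TW: calg "tens n 0 W" by (intro calg_tens W)
    \<comment> \<open>For m = 0 the idempotent provides no eigenvalue equation. The trivial one with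
      index 0, an empty product, serves to obtain that the image of e is a matrix of the right
      size.\<close>
    have "jucys_murphy m q 0 \<otimes>\<^bsub>Hecke m q\<^esub> e = 1 \<odot>\<^bsub>Hecke m q\<^esub> e"
      using eH by (simp add: jucys_murphy_def lprod_def)
    from hecke_action_jm(1)[OF \<open>q \<noteq> 0\<close> eH this]
    have "hecke_action n q m e \<in> carrier (tens n m complex_alg)" by simp
    then have "base_change A n m (hecke_action n q m e) \<in> carrier (tens n m A)"
      "base_change W n m (hecke_action n q m e) \<in> carrier (tens n m W)"
      using A W by (auto intro: base_change_closed)
    then show ?thesis
      using map_base_change[OF A \<open>\<phi> \<in> alg_hom A W\<close>]
      by (simp add: True[symmetric] \<open>\<mu> = {}\<close>) (simp add: True lprod_def)
  next
    case False
    then have m: "1 \<le> m" by simp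
    note act = hecke_action_jm[OF \<open>q \<noteq> 0\<close> eH ejm]
    have K: "Kmat n q \<in> carrier (mat_alg {1..n} A)" unfolding A_def by (rule Kmat_closed)
    interpret MW: calg "mat_alg {1..n} W" by (intro calg_mat_alg W) simp
    have "map_mtx {1..n} \<phi> (Kmat n q) = Mmat n q \<otimes>\<^bsub>mat_alg {1..n} W\<^esub> Dmat n q"
    proof (rule mat_alg_eqI)
      show "map_mtx {1..n} \<phi> (Kmat n q) \<in> carrier (mat_alg {1..n} W)"
        by (rule alg_homD(1)[OF map_mtx_hom[OF A W \<open>\<phi> \<in> alg_hom A W\<close>] K]) simp
      show "Mmat n q \<otimes>\<^bsub>mat_alg {1..n} W\<^esub> Dmat n q \<in> carrier (mat_alg {1..n} W)"
        unfolding W_def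
        by (rule MW.m_closed[unfolded W_def, OF Mmat_closed[OF \<open>q \<noteq> 0\<close>] Dmat_closed[OF \<open>q \<noteq> 0\<close>]])
      fix i j assume "i \<in> {1..n}" "j \<in> {1..n}"
      then show "map_mtx {1..n} \<phi> (Kmat n q) i j = (Mmat n q \<otimes>\<^bsub>mat_alg {1..n} W\<^esub> Dmat n q) i j"
        using \<open>\<forall>i\<in>{1..n}. \<forall>j\<in>{1..n}. \<phi> (Kmat n q i j) = (Mmat n q \<otimes>\<^bsub>mat_alg {1..n} W\<^esub> Dmat n q) i j\<close>
        by (simp only: map_mtx_entry)
    qed
    note \<phi>K = this
    have E: "hecke_action n q m e \<in> carrier (tens n m complex_alg)"
      using act(1)[of 1] m by simp
    have main: "map_mtx (tidx n m) \<phi>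
       (lprod (tens n m A)
          (map (\<lambda>k. overl A n q m k (Kmat n q) \<oplus>\<^bsub>tens n m A\<^esub>
                    ((inverse (c k) - 1) / (q - inverse q)) \<odot>\<^bsub>tens n m A\<^esub> \<one>\<^bsub>tens n m A\<^esub>)
               [1..<m+1])
        \<otimes>\<^bsub>tens n m A\<^esub> base_change A n m (hecke_action n q m e))
     = (\<Prod>k=1..m. inverse (c k)) \<odot>\<^bsub>tens n m W\<^esub>
         (lprod (tens n m W) (map (\<lambda>k. overl W n q m k (Mmat n q)) [1..<m+1])
          \<otimes>\<^bsub>tens n m W\<^esub> lprod (tens n m W) (map (\<lambda>k. overl W n q m k (Dmat n q)) (rev [1..<m+1]))
          \<otimes>\<^bsub>tens n m W\<^esub> base_change W n m (hecke_action n q m e))"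
      unfolding W_def
      by (rule map_mtx_product_eq_capelli_product[OF m \<open>q \<noteq> 0\<close> h A K
          \<open>\<phi> \<in> alg_hom A W\<close>[unfolded W_def] \<phi>K[unfolded W_def] E c(1) act(2)]) auto
    \<comment> \<open>The content of k is read off at the box where U takes the value k, so the
      bijection U turns the product over entries into the product over boxes.\<close>
    have "(\<Prod>k=1..m. inverse (c k)) = (\<Prod>\<alpha>\<in>\<mu>. inverse (c (U \<alpha>)))"
      using prod.reindex_bij_betw[OF bij, of "\<lambda>k. inverse (c k)"] by simp
    also have "\<dots> = (\<Prod>\<alpha>\<in>\<mu>. q powi (- 2 * content \<alpha>))"
      using bij by (intro prod.cong refl) (simp add: c(2) content_at_def bij_betw_def inv_into_f_f)
    finally show ?thesis
      using main unfolding c(2) by simp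
  qed
qed

end
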